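(* Assume that the function $$m(t)=\mathbb{E}\left[\int_0^\infty\lambda(u)\,e^{-(\Lambda(u+t)-\Lambda(u))}\,du\right],\qquad t\ge0,$$ is twice continuously differentiable in $(0,\infty)$. Let $M(t)=\int_0^t m(s)\,ds$ for $t\ge 0$, fix $\theta>0$, let $t_\theta=M^{-1}(\theta)$, and let $$e(t_\theta)=\frac{\theta^2}{2\,m(t_\theta)^2}\left(m''(t_\theta)-\frac{m'(t_\theta)^2}{m(t_\theta)}\right).$$ Then, as $C\to\infty$ with the scaling $C=\gamma\theta$ (that is, the catalog arrival rate is $\gamma=C/\theta$, while $\theta$ and the law of the canonical intensity $\lambda$ are kept fixed), the expected number of misses of the tagged document in an LRU cache of size $C$ satisfies $$\mathbb{E}[\mu_C]=m(t_\theta)+\frac{e(t_\theta)}{C}+o\left(\frac1C\right).$$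
   Context: Model. $\Gamma^g$ is a homogeneous Poisson process on $\mathbb{R}$ with intensity $\gamma>0$; its points $a$ are the arrival times of documents to a catalog. Each $a\in\Gamma^g$ carries a document request process $\xi_a$, a Cox point process on $\mathbb{R}$ directed by a random intensity function $\lambda_a\ge0$. Given $\Gamma^g$, the pairs $(\lambda_a,\xi_a)$, $a\in\Gamma^g$, are independent; $\lambda_a(t)=0$ for $t<a$; and $\lambda_a(\cdot)$ has the same law as $\lambda(\cdot-a)$, where $\lambda=\lambda_0$ is a canonical random intensity supported in $[0,\infty)$. Set $\Lambda_a(t)=\int_a^t\lambda_a(u)\,du$ for $t\ge a$ (and $\Lambda_a(t)=0$ for $t<a$), and $\Lambda=\Lambda_0$. It is assumed that $\Lambda(\infty)<\infty$ almost surely, that $\int_{-\infty}^t\mathbb{E}[1-e^{-(\Lambda_a(t)-\Lambda_a(s))}]\,da<\infty$ for all $s\le t$, and that $0<\mathbb{E}[\Lambda(\infty)]<\infty$. Tagged document and rest. The probability space carries two independent objects: (i) a tagged document arriving at time $0$, with canonical intensity $\lambda$ and request process $\xi$, a Cox process directed by $\lambda$; (ii) the rest, a marked point process with the same law as $\sum_{a\in\Gamma^g}\delta_{(a,\xi_a)}$, where $\Gamma^g$ is the homogeneous Poisson process on $\mathbb{R}$ with intensity $\gamma$ and, given $\Gamma^g$, the marks $\xi_a$, $a\in\Gamma^g$, are independent Cox processes directed by the random intensities $\lambda_a$, with $\lambda_a(\cdot)$ distributed as $\lambda(\cdot-a)$. Let $N$ be the number of points of $\xi$ (finite almost surely) and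 $\Theta_1<\dots<\Theta_N$ its points, the request times of the tagged document. Exit times. For $s\in\mathbb{R}$ and $t\ge s$, let $X_t^s$ be the number of documents $(a,\xi_a)$ of the rest having at least one request in $[s,t]$, and for an integer $C\ge1$ let $T_C^s=\inf\{t\ge s:X_t^s=C\}$. LRU misses. An LRU cache of size $C$ holds $C$ unit-size documents as a list. A requested document is placed at the front; if it was not already present (a miss), the last document in the list is removed. Hence a document requested at time $s$ and not requested again leaves the cache at time $T_C^s$. The first request of the tagged document is always a miss and, for $r\ge2$, the request at $\Theta_r$ is a miss iff $\Theta_r>T_C^{\Theta_{r-1}}$. The number of misses of the tagged document is therefore $$\mu_C=\mathbf{1}\{N\ge1\}+\mathbf{1}\{N\ge2\}\sum_{r=2}^{N}\mathbf{1}\{\Theta_r>T_C^{\Theta_{r-1}}\}.$$ $M^{-1}$ denotes the inverse function of $M$. *)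

theory Defs
  imports "HOL-Probability.Probability" "HOL-Library.Landau_Symbols"
begin

section \<open>Point processes\<close>

text \<open>
  Simple point processes are random sets of points. A Poisson or Cox process with a
  diffuse directing measure is simple almost surely, so nothing is lost for them.
\<close>

definition ecard :: "'a set \<Rightarrow> enat" where
  "ecard X = (if finite X then enat (card X) else \<infinity>)"

text \<open>The sets of points of \<open>S\<close>, with the sigma-algebra generated by the counts
  \<open>X \<mapsto> #(X \<inter> B)\<close>, \<open>B\<close> measurable.\<close>

definition configurations :: "'a measure \<Rightarrow> 'a set measure" where
  "configurations S =
     sigma (Pow (space S)) {{X \<in> Pow (space S). ecard (X \<inter> B) = k} | B k. B \<in> sets S}"

text \<open>A Poisson variable of infinite mean is infinite almost surely, whence the value 0.
  The library's \<open>poisson_pmf\<close> is only specified for a finite positive rate.\<close>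

definition poisson_prob :: "ennreal \<Rightarrow> nat \<Rightarrow> real" where
  "poisson_prob r n =
     (if r = \<infinity> then 0 else enn2real r ^ n / fact n * exp (- enn2real r))"

definition counts_event ::
  "'w measure \<Rightarrow> ('w \<Rightarrow> real set) \<Rightarrow> nat \<Rightarrow> (nat \<Rightarrow> real set) \<Rightarrow> (nat \<Rightarrow> nat) \<Rightarrow> 'w set" where
  "counts_event M X k B n = {w \<in> space M. \<forall>i<k. ecard (X w \<inter> B i) = enat (n i)}"

definition disjoint_borel :: "nat \<Rightarrow> (nat \<Rightarrow> real set) \<Rightarrow> bool" where
  "disjoint_borel k B \<longleftrightarrow> (\<forall>i<k. B i \<in> sets borel) \<and> disjoint_family_on B {..<k}"

definition poisson_process :: "'w measure \<Rightarrow> real measure \<Rightarrow> ('w \<Rightarrow> real set) \<Rightarrow> bool" where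
  "poisson_process M \<nu> X \<longleftrightarrow>
     X \<in> measurable M (configurations borel) \<and>
     (\<forall>k B n. disjoint_borel k B \<longrightarrow>
        measure M (counts_event M X k B n) = (\<Prod>i<k. poisson_prob (emeasure \<nu> (B i)) (n i)))"

definition homogeneous_poisson :: "'w measure \<Rightarrow> real \<Rightarrow> ('w \<Rightarrow> real set) \<Rightarrow> bool" where
  "homogeneous_poisson M \<gamma> X \<longleftrightarrow> poisson_process M (density lborel (\<lambda>_. ennreal \<gamma>)) X"

section \<open>Conditioning on a sub-sigma-algebra\<close>

definition cond_prob_given :: "'w measure \<Rightarrow> 'w measure \<Rightarrow> 'w set \<Rightarrow> 'w \<Rightarrow> real" where
  "cond_prob_given M F E = real_cond_exp M F (indicator E)"

definition cond_indep_vars ::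
  "'w measure \<Rightarrow> 'w measure \<Rightarrow> 'b measure \<Rightarrow> (nat \<Rightarrow> 'w \<Rightarrow> 'b) \<Rightarrow> bool" where
  "cond_indep_vars M F N Y \<longleftrightarrow>
     (\<forall>j. Y j \<in> measurable M N) \<and>
     (\<forall>J E. finite J \<and> (\<forall>j\<in>J. E j \<in> sets N) \<longrightarrow>
        (AE w in M. cond_prob_given M F {w \<in> space M. \<forall>j\<in>J. Y j w \<in> E j} w =
           (\<Prod>j\<in>J. cond_prob_given M F {w \<in> space M. Y j w \<in> E j} w)))"

section \<open>Random intensities and Cox processes\<close>

abbreviation paths :: "(real \<Rightarrow> real) measure" where
  "paths \<equiv> (\<Pi>\<^sub>M t\<in>UNIV. borel)"

definition random_intensity :: "'w measure \<Rightarrow> ('w \<Rightarrow> real \<Rightarrow> real) \<Rightarrow> bool" where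
  "random_intensity M lam \<longleftrightarrow>
     (\<lambda>(w, t). lam w t) \<in> borel_measurable (M \<Otimes>\<^sub>M borel) \<and> (\<forall>w\<in>space M. \<forall>t. 0 \<le> lam w t)"

text \<open>Given \<open>F\<close>, the process \<open>X\<close> is Poisson with intensity function \<open>lam\<close>.\<close>

definition cond_poisson ::
  "'w measure \<Rightarrow> 'w measure \<Rightarrow> ('w \<Rightarrow> real \<Rightarrow> real) \<Rightarrow> ('w \<Rightarrow> real set) \<Rightarrow> bool" where
  "cond_poisson M F lam X \<longleftrightarrow>
     X \<in> measurable M (configurations borel) \<and>
     (\<forall>k B n. disjoint_borel k B \<longrightarrow>
        (AE w in M. cond_prob_given M F (counts_event M X k B n) w =
           (\<Prod>i<k. poisson_prob (emeasure (density lborel (\<lambda>u. ennreal (lam w u))) (B i)) (n i))))"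

definition cox_process :: "'w measure \<Rightarrow> ('w \<Rightarrow> real \<Rightarrow> real) \<Rightarrow> ('w \<Rightarrow> real set) \<Rightarrow> bool" where
  "cox_process M lam X \<longleftrightarrow>
     random_intensity M lam \<and> cond_poisson M (vimage_algebra (space M) lam paths) lam X"

definition canonical_intensity :: "'w measure \<Rightarrow> ('w \<Rightarrow> real \<Rightarrow> real) \<Rightarrow> bool" where
  "canonical_intensity P lam \<longleftrightarrow>
     prob_space P \<and> random_intensity P lam \<and> (\<forall>w\<in>space P. \<forall>t<0. lam w t = 0)"

text \<open>\<open>\<Lambda>\<^sub>a(t)\<close> for the intensity path \<open>f\<close> of a document arriving at \<open>a\<close>; it is 0 for \<open>t < a\<close>.\<close>

definition cum_intensity :: "(real \<Rightarrow> real) \<Rightarrow> real \<Rightarrow> real \<Rightarrow> real" where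
  "cum_intensity f a t = (LINT u:{a..t}|lborel. f u)"

definition total_intensity :: "(real \<Rightarrow> real) \<Rightarrow> ennreal" where
  "total_intensity f = (\<integral>\<^sup>+u\<in>{0..}. ennreal (f u) \<partial>lborel)"

section \<open>The catalog\<close>

text \<open>
  The \<open>n\<close>-th document has arrival time \<open>a n\<close>, intensity \<open>l n\<close> and requests \<open>x n\<close>. The
  arrival times enumerate the points of \<open>\<Gamma>\<close> without repetition and are functions of \<open>\<Gamma>\<close>, so
  that conditioning on \<open>\<Gamma>\<close> fixes them. The last condition says that, given \<open>\<Gamma>\<close>, the process
  \<open>x n\<close> is a Cox process directed by \<open>l n\<close>.
\<close>

definition catalog ::
  "'q measure \<Rightarrow> real \<Rightarrow> 'p measure \<Rightarrow> ('p \<Rightarrow> real \<Rightarrow> real) \<Rightarrow> ('q \<Rightarrow> real set) \<Rightarrow>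
   (nat \<Rightarrow> 'q \<Rightarrow> real) \<Rightarrow> (nat \<Rightarrow> 'q \<Rightarrow> real \<Rightarrow> real) \<Rightarrow> (nat \<Rightarrow> 'q \<Rightarrow> real set) \<Rightarrow> bool" where
  "catalog Q \<gamma> P lam \<Gamma> a l x \<longleftrightarrow>
     prob_space Q \<and>
     homogeneous_poisson Q \<gamma> \<Gamma> \<and>
     (let F = vimage_algebra (space Q) \<Gamma> (configurations borel) in
       (\<forall>n. a n \<in> borel_measurable F) \<and>
       (\<forall>w\<in>space Q. bij_betw (\<lambda>n. a n w) UNIV (\<Gamma> w)) \<and>
       (\<forall>n. random_intensity Q (l n)) \<and>
       (\<forall>n. \<forall>w\<in>space Q. \<forall>t<a n w. l n w t = 0) \<and>
       cond_indep_vars Q F (paths \<Otimes>\<^sub>M configurations borel) (\<lambda>n w. (l n w, x n w)) \<and>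
       (\<forall>n. \<forall>E\<in>sets paths.
          AE w in Q. cond_prob_given Q F {w \<in> space Q. l n w \<in> E} w =
            measure P {v \<in> space P. (\<lambda>t. lam v (t - a n w)) \<in> E}) \<and>
       (\<forall>n. cond_poisson Q
          (vimage_algebra (space Q) (\<lambda>w. (\<Gamma> w, l n w)) (configurations borel \<Otimes>\<^sub>M paths))
          (l n) (x n)))"

abbreviation marked_configurations :: "(real \<times> real set) set measure" where
  "marked_configurations \<equiv> configurations (borel \<Otimes>\<^sub>M configurations borel)"

definition marked_process ::
  "(nat \<Rightarrow> 'q \<Rightarrow> real) \<Rightarrow> (nat \<Rightarrow> 'q \<Rightarrow> real set) \<Rightarrow> 'q \<Rightarrow> (real \<times> real set) set" where
  "marked_process a x w = range (\<lambda>n. (a n w, x n w))"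

definition indep_objects ::
  "'w measure \<Rightarrow> 'b measure \<Rightarrow> ('w \<Rightarrow> 'b) \<Rightarrow> 'c measure \<Rightarrow> ('w \<Rightarrow> 'c) \<Rightarrow> bool" where
  "indep_objects M N Y N' Y' \<longleftrightarrow>
     prob_space.indep_set M (sets (vimage_algebra (space M) Y N))
       (sets (vimage_algebra (space M) Y' N'))"

section \<open>Exit times and misses\<close>

definition active_docs :: "(real \<times> real set) set \<Rightarrow> real \<Rightarrow> real \<Rightarrow> enat" where
  "active_docs R s t = ecard {(a, y) \<in> R. y \<inter> {s..t} \<noteq> {}}"

text \<open>Extended reals, since the infimum of the empty set is infinite.\<close>

definition exit_time :: "nat \<Rightarrow> (real \<times> real set) set \<Rightarrow> real \<Rightarrow> ereal" where
  "exit_time C R s = Inf {ereal t | t. s \<le> t \<and> active_docs R s t = enat C}"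

definition request_time :: "real set \<Rightarrow> nat \<Rightarrow> real" where
  "request_time y r = sorted_list_of_set y ! (r - 1)"

text \<open>For the null event that \<open>y\<close> is infinite, the value is 0.\<close>

definition misses :: "nat \<Rightarrow> real set \<Rightarrow> (real \<times> real set) set \<Rightarrow> real" where
  "misses C y R =
     of_bool (1 \<le> card y) +
     of_bool (2 \<le> card y) *
       (\<Sum>r = 2..card y. of_bool (ereal (request_time y r) > exit_time C R (request_time y (r - 1))))"

text \<open>The completion is used because \<open>misses\<close> is a measurable function of the point
  configurations only outside a null set (for instance, of configurations that are not locally
  finite), and the Bochner integral of a non-measurable function is 0 by convention.\<close>

definition expected_misses ::
  "'w measure \<Rightarrow> nat \<Rightarrow> ('w \<Rightarrow> real set) \<Rightarrow> ('w \<Rightarrow> (real \<times> real set) set) \<Rightarrow> real" where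
  "expected_misses M C X R = (LINT w|completion M. misses C (X w) (R w))"

section \<open>The functions of the asymptotic expansion\<close>

definition m_fun :: "'p measure \<Rightarrow> ('p \<Rightarrow> real \<Rightarrow> real) \<Rightarrow> real \<Rightarrow> real" where
  "m_fun P lam t =
     (LINT w|P. (LINT u:{0..}|lborel.
        lam w u * exp (- (cum_intensity (lam w) 0 (u + t) - cum_intensity (lam w) 0 u))))"

definition M_fun :: "'p measure \<Rightarrow> ('p \<Rightarrow> real \<Rightarrow> real) \<Rightarrow> real \<Rightarrow> real" where
  "M_fun P lam t = (LINT s:{0..t}|lborel. m_fun P lam s)"

definition char_time :: "'p measure \<Rightarrow> ('p \<Rightarrow> real \<Rightarrow> real) \<Rightarrow> real \<Rightarrow> real" where
  "char_time P lam \<theta> = inv_into {0..} (M_fun P lam) \<theta>"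

definition e_fun :: "'p measure \<Rightarrow> ('p \<Rightarrow> real \<Rightarrow> real) \<Rightarrow> real \<Rightarrow> real" where
  "e_fun P lam \<theta> =
     (let m = m_fun P lam; t = char_time P lam \<theta> in
       \<theta>\<^sup>2 / (2 * (m t)\<^sup>2) * (deriv (deriv m) t - (deriv m t)\<^sup>2 / m t))"

end

theory Submission
  imports Defs
begin

text \<open>
  For every \<open>C\<close> the expected number of misses is exactly the mean of \<open>m \<circ> M^{-1}\<close> under a gamma law of mean
  \<open>\<theta>\<close> and variance \<open>\<theta>^2 / C\<close> (\<open>expected_misses_eq\<close>). The expansion is then the second-order Taylor expansion
  of \<open>m \<circ> M^{-1}\<close> at \<open>\<theta>\<close>: the linear term vanishes in the mean, the quadratic term contributes
  \<open>\<theta>^2 / (2 C)\<close> times the second derivative, which is \<open>e(t\<^sub>\<theta>) / C\<close>, and the remainder is \<open>o(1 / C)\<close> because the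
  fourth central moment is \<open>O(1 / C^2)\<close> (\<open>gamma_law_expansion\<close>, \<open>gamma_mean_expansion\<close>).

  The gamma law comes from the exit times. Given the arrivals, the documents of the rest are requested in
  \<open>[s, t]\<close> independently of each other, with a probability that depends on the arrival time. Their number is
  therefore a thinned Poisson count (\<open>marked_count_pgf\<close>, \<open>catalog_count\<close>). Its mean is \<open>\<gamma> M(t - s)\<close>: for a single
  intensity path, decomposing according to the age at the last request in the window and exchanging the
  integrals over ages and arrival times gives the integral that defines \<open>M\<close> (\<open>exp_integral_identity\<close>,
  \<open>active_identity\<close>, \<open>active_mean\<close>). Counts of new documents in a step of length \<open>\<delta>\<close> exceed 1 with probability
  \<open>O(\<delta>^2)\<close>, so the count almost surely does not jump over \<open>C\<close>, and the exit time lies before \<open>t\<close> with the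
  probability that a Poisson variable of mean \<open>\<gamma> M(t - s)\<close> is at least \<open>C\<close> (\<open>exit_before\<close>, \<open>steady_fill_prob\<close>).
  With \<open>\<gamma> = C / \<theta>\<close> this is the probability of \<open>M^{-1}(Z) < t - s\<close> for a gamma variable \<open>Z\<close> of shape \<open>C\<close> and mean
  \<open>\<theta>\<close> (\<open>fill_law\<close>).

  The function \<open>m\<close> comes from the tagged document. If documents left the cache after a fixed time \<open>\<tau>\<close>, the
  number of misses would be the number of requests that no other request follows within \<open>\<tau>\<close>
  (\<open>long_gaps_eq_card\<close>). A request at age \<open>u\<close> has intensity \<open>\<lambda>(u)\<close> and none follows with probability
  \<open>exp (- (\<Lambda>(u + \<tau>) - \<Lambda>(u)))\<close>, so the mean is \<open>m \<tau>\<close>; this is derived from void probabilities by cutting time into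
  small cells (\<open>cells_expectation_tendsto\<close>, \<open>long_gaps_mean\<close>). The expected number of misses is a sum over the
  gaps between requests, and in each term only the law of the exit delay matters; so the delays may be
  replaced by the single variable \<open>M^{-1}(Z)\<close>, independent of the requests (\<open>gap_mean\<close>).

  Two questions of measurability shape the details. The laws of the intensities are given on the product
  sigma-algebra, for which the integral of a path is not measurable; equality of laws is carried over to void
  probabilities through moments (\<open>same_law_avoid\<close>). The number of misses need not be a measurable
  function of the configurations; it is squeezed between functions of counts on a grid whose means have the same limit
  (\<open>misses_bounds\<close>, \<open>integral_completion_sandwich\<close>).
\<close>

section \<open>Integrals of functions squeezed between measurable ones\<close>

text \<open>
  The supremum of the lower bounds and the infimum of the upper bounds are measurable and have the
  same integral, so they agree almost everywhere, and \<open>f\<close> lies between them. Hence \<open>f\<close> is measurable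
  for the completion although nothing is known about its measurability beforehand.
\<close>

lemma integral_completion_sandwich:
  fixes f :: "'a \<Rightarrow> real"
  assumes g: "\<And>n. integrable M (g n)" and h: "\<And>n. integrable M (h n)"
    and gf: "\<And>n x. x \<in> space M \<Longrightarrow> g n x \<le> f x"
    and fh: "\<And>n x. x \<in> space M \<Longrightarrow> f x \<le> h n x"
    and gL: "(\<lambda>n. \<integral>x. g n x \<partial>M) \<longlonglongrightarrow> L" and hL: "(\<lambda>n. \<integral>x. h n x \<partial>M) \<longlonglongrightarrow> L"
  shows "(\<integral>x. f x \<partial>completion M) = L"
proof -
  define G where "G x = (SUP n. g n x)" for x
  define H where "H x = (INF n. h n x)" for x
  have bddG: "bdd_above (range (\<lambda>n. g n x))" if "x \<in> space M" for x
    using gf[OF that] by (intro bdd_aboveI2) auto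
  have bddH: "bdd_below (range (\<lambda>n. h n x))" if "x \<in> space M" for x
    using fh[OF that] by (intro bdd_belowI2) auto
  have mG[measurable]: "G \<in> borel_measurable M"
    unfolding G_def using g bddG by (intro borel_measurable_cSUP) auto
  have mH[measurable]: "H \<in> borel_measurable M"
    unfolding H_def using h bddH by (intro borel_measurable_cINF) auto
  have gG: "g n x \<le> G x" if "x \<in> space M" for n x
    unfolding G_def using bddG[OF that] by (intro cSUP_upper) auto
  have Hh: "H x \<le> h n x" if "x \<in> space M" for n x
    unfolding H_def using bddH[OF that] by (intro cINF_lower) auto
  have Gf: "G x \<le> f x" if "x \<in> space M" for x
    unfolding G_def using gf[OF that] by (intro cSUP_least) auto
  have fH: "f x \<le> H x" if "x \<in> space M" for x
    unfolding H_def using fh[OF that] by (intro cINF_greatest) auto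
  have dom: "integrable M (\<lambda>x. \<bar>g 0 x\<bar> + \<bar>h 0 x\<bar>)" using g h by auto
  have Gh: "G x \<le> h 0 x" "g 0 x \<le> H x" if "x \<in> space M" for x
    using Gf[OF that] fh[OF that, of 0] gf[OF that, of 0] fH[OF that] by auto
  have iG: "integrable M G"
    by (rule Bochner_Integration.integrable_bound[OF dom]) (use gG[of _ 0] Gh in \<open>auto intro!: AE_I2\<close>, fastforce)
  have iH: "integrable M H"
    by (rule Bochner_Integration.integrable_bound[OF dom]) (use Hh[of _ 0] Gh in \<open>auto intro!: AE_I2\<close>, fastforce)
  have G1: "(\<integral>x. g n x \<partial>M) \<le> (\<integral>x. G x \<partial>M)" for n
    using g iG gG by (intro integral_mono) auto
  have G2: "(\<integral>x. G x \<partial>M) \<le> (\<integral>x. H x \<partial>M)"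
    using iG iH Gf fH by (intro integral_mono) (auto intro: order_trans)
  have G3: "(\<integral>x. H x \<partial>M) \<le> (\<integral>x. h n x \<partial>M)" for n
    using iH h Hh by (intro integral_mono) auto
  have "L \<le> (\<integral>x. G x \<partial>M)" by (rule LIMSEQ_le_const2[OF gL]) (use G1 in auto)
  moreover have "(\<integral>x. H x \<partial>M) \<le> L" by (rule LIMSEQ_le_const[OF hL]) (use G3 in auto)
  ultimately have GL: "(\<integral>x. G x \<partial>M) = L" and HL: "(\<integral>x. H x \<partial>M) = L" using G2 by auto
  have "(\<integral>x. H x - G x \<partial>M) = 0" using GL HL iG iH by simp
  moreover have "AE x in M. 0 \<le> H x - G x" using Gf fH by (intro AE_I2) (auto intro: order_trans)
  ultimately have "AE x in M. H x - G x = 0"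
    using integral_nonneg_eq_0_iff_AE[of M "\<lambda>x. H x - G x"] iG iH by auto
  then have AE: "AE x in M. f x = G x"
    using AE_space
  proof eventually_elim
    case (elim x)
    then show ?case using Gf[of x] fH[of x] by simp
  qed
  have AEc: "AE x in completion M. f x = G x" by (rule AE_completion[OF AE])
  have mGc: "G \<in> borel_measurable (completion M)" by (rule measurable_completion[OF mG])
  have mf: "f \<in> borel_measurable (completion M)"
  proof (subst borel_measurable_iff_le, rule allI)
    fix c :: real
    show "{x \<in> space (completion M). f x \<le> c} \<in> sets (completion M)"
    proof (rule completion.in_sets_AE)
      show "{x \<in> space (completion M). G x \<le> c} \<in> sets (completion M)" using mGc by measurable
      show "AE x in completion M. x \<in> {x \<in> space (completion M). G x \<le> c} \<longleftrightarrow> x \<in> {x \<in> space (completion M). f x \<le> c}"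
        using AEc by eventually_elim auto
    qed auto
  qed
  show ?thesis
    using integral_cong_AE[OF mf mGc AEc] integral_completion[OF mG] GL by simp
qed

section \<open>Second-order expansion under concentrating gamma laws\<close>

text \<open>
  Peano form of Taylor's theorem, asking for the second derivative at the centre only: the
  derivative of the remainder is \<open>o(z - c)\<close> by definition of \<open>D\<close>, and the mean value theorem multiplies
  this by another factor \<open>z - c\<close>.
\<close>

lemma second_order_remainder:
  fixes f f' :: "real \<Rightarrow> real"
  assumes r: "0 < r" and df: "\<And>z. \<bar>z - c\<bar> < r \<Longrightarrow> (f has_real_derivative f' z) (at z)"
    and d2: "(f' has_real_derivative D) (at c)" and e: "0 < \<epsilon>"
  shows "\<exists>d>0. \<forall>z. \<bar>z - c\<bar> < d \<longrightarrow>
           \<bar>f z - f c - f' c * (z - c) - D / 2 * (z - c)\<^sup>2\<bar> \<le> \<epsilon> * (z - c)\<^sup>2"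
proof -
  from d2 have "(f' has_derivative (\<lambda>h. D * h)) (at c)" by (simp add: has_field_derivative_def)
  then obtain d1 where d1: "0 < d1" "\<And>y. \<bar>y - c\<bar> < d1 \<Longrightarrow> \<bar>f' y - f' c - D * (y - c)\<bar> \<le> \<epsilon> * \<bar>y - c\<bar>"
    unfolding has_derivative_at_alt using e by (auto simp: real_norm_def)
  define g where "g z = f z - f c - f' c * (z - c) - D / 2 * (z - c)\<^sup>2" for z
  have dg: "(g has_real_derivative (f' z - f' c - D * (z - c))) (at z)" if "\<bar>z - c\<bar> < r" for z
    unfolding g_def by (rule derivative_eq_intros df[OF that] refl | simp)+
  have gc: "g c = 0" by (simp add: g_def)
  have "\<bar>g z\<bar> \<le> \<epsilon> * (z - c)\<^sup>2" if z: "\<bar>z - c\<bar> < min r d1" for z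
  proof (cases "z = c")
    case True then show ?thesis by (simp add: gc)
  next
    case False
    obtain y where y: "\<bar>y - c\<bar> \<le> \<bar>z - c\<bar>" "g z - g c = (z - c) * (f' y - f' c - D * (y - c))"
    proof (cases "c < z")
      case True
      have "\<exists>y>c. y < z \<and> g z - g c = (z - c) * (f' y - f' c - D * (y - c))"
        using True z by (intro MVT2[of c z g "\<lambda>z. f' z - f' c - D * (z - c)"] dg) auto
      then obtain y where "c < y" "y < z" "g z - g c = (z - c) * (f' y - f' c - D * (y - c))" by auto
      then show ?thesis by (intro that[of y]) auto
    next
      case F: False
      have "\<exists>y>z. y < c \<and> g c - g z = (c - z) * (f' y - f' c - D * (y - c))"
        using F False z by (intro MVT2[of z c g "\<lambda>z. f' z - f' c - D * (z - c)"] dg) auto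
      then obtain y where "z < y" "y < c" "g c - g z = (c - z) * (f' y - f' c - D * (y - c))" by auto
      then show ?thesis by (intro that[of y]) (auto simp: algebra_simps)
    qed
    have "\<bar>g z\<bar> = \<bar>z - c\<bar> * \<bar>f' y - f' c - D * (y - c)\<bar>" using y(2) gc by (simp add: abs_mult)
    also have "\<dots> \<le> \<bar>z - c\<bar> * (\<epsilon> * \<bar>y - c\<bar>)" using d1(2)[of y] y(1) z by (intro mult_left_mono) auto
    also have "\<dots> \<le> \<bar>z - c\<bar> * (\<epsilon> * \<bar>z - c\<bar>)" using y(1) e by (intro mult_left_mono) auto
    also have "\<dots> = \<epsilon> * (z - c)\<^sup>2" by (simp add: power2_eq_square)
    finally show ?thesis .
  qed
  then show ?thesis unfolding g_def using r d1(1) by (intro exI[of _ "min r d1"]) auto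
qed

text \<open>
  The law of the \<open>n\<close>-th arrival time of a Poisson process of rate \<open>n / \<theta>\<close>. Its mean is \<open>\<theta>\<close> for every
  \<open>n\<close> and its variance is \<open>\<theta>^2 / n\<close>.
\<close>

definition gamma_law :: "nat \<Rightarrow> real \<Rightarrow> real measure" where
  "gamma_law n \<theta> = density lborel (erlang_density (n - 1) (real n / \<theta>))"

lemma prob_space_gamma_law: "0 < \<theta> \<Longrightarrow> 1 \<le> n \<Longrightarrow> prob_space (gamma_law n \<theta>)"
  unfolding gamma_law_def by (intro prob_space_erlang_density) auto

lemma sets_gamma_law[simp, measurable_cong]: "sets (gamma_law n \<theta>) = sets borel"
  by (simp add: gamma_law_def)

lemma space_gamma_law[simp]: "space (gamma_law n \<theta>) = UNIV"
  by (simp add: gamma_law_def)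

lemma gamma_law_AE_nonneg: "AE z in gamma_law n \<theta>. 0 \<le> z"
  unfolding gamma_law_def by (subst AE_density) (auto simp: erlang_density_def)

lemma gamma_law_moment:
  assumes "0 < \<theta>" "1 \<le> n"
  shows "integrable (gamma_law n \<theta>) (\<lambda>z. z ^ i)"
    and "(\<integral>z. z ^ i \<partial>gamma_law n \<theta>) = fact (n - 1 + i) / (fact (n - 1) * (real n / \<theta>) ^ i)"
proof -
  have l: "0 < real n / \<theta>" using assms by simp
  have nn: "(\<integral>\<^sup>+z. ennreal (z ^ i) \<partial>gamma_law n \<theta>) = fact (n - 1 + i) / (fact (n - 1) * (real n / \<theta>) ^ i)"
    unfolding gamma_law_def
    by (subst nn_integral_density)
       (auto simp flip: nn_integral_erlang_ith_moment[OF l] simp: l less_imp_le ennreal_mult'[symmetric] intro!: nn_integral_cong)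
  have AE: "AE z in gamma_law n \<theta>. 0 \<le> z ^ i" using gamma_law_AE_nonneg by eventually_elim auto
  show int: "integrable (gamma_law n \<theta>) (\<lambda>z. z ^ i)"
    using nn AE by (intro integrableI_nonneg) auto
  show "(\<integral>z. z ^ i \<partial>gamma_law n \<theta>) = fact (n - 1 + i) / (fact (n - 1) * (real n / \<theta>) ^ i)"
    using nn AE l by (subst integral_eq_nn_integral) (auto intro!: divide_nonneg_nonneg)
qed

text \<open>
  The left-hand side is the binomial expansion of the fourth central moment in terms of the raw
  moments of \<open>gamma_law\<close>.
\<close>

lemma gamma_fourth_moment_identity:
  fixes n \<theta> :: real
  assumes "0 < n"
  shows "\<theta>^4 * (n + 1) * (n + 2) * (n + 3) / n^3 - 4 * \<theta> * (\<theta>^3 * (n + 1) * (n + 2) / n^2)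
      + 6 * \<theta>^2 * (\<theta>^2 * (n + 1) / n) - 4 * \<theta>^3 * \<theta> + \<theta>^4
    = \<theta>^4 * (3 * n^2 + 6 * n) / n^4"
proof -
  define q where "q = inverse n"
  have q: "n * q = 1" using assms by (simp add: q_def)
  have i: "x / n = x * q" "x / n^2 = x * q^2" "x / n^3 = x * q^3" "x / n^4 = x * q^4" for x
    by (simp_all add: q_def divide_inverse power_inverse)
  have "(n + 1) * (n + 2) * (n + 3) * q^3 - 4 * ((n + 1) * (n + 2) * q^2) + 6 * ((n + 1) * q) - 3
    = (3 * n^2 + 6 * n) * q^4"
    using q by algebra
  then show ?thesis unfolding i by algebra
qed

lemma gamma_law_central_moments:
  assumes "0 < \<theta>" "1 \<le> n"
  shows "(\<integral>z. (z - \<theta>) \<partial>gamma_law n \<theta>) = 0"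
    and "(\<integral>z. (z - \<theta>)\<^sup>2 \<partial>gamma_law n \<theta>) = \<theta>\<^sup>2 / n"
    and "(\<integral>z. (z - \<theta>) ^ 4 \<partial>gamma_law n \<theta>) = \<theta> ^ 4 * (3 * real n ^ 2 + 6 * real n) / real n ^ 4"
    and "integrable (gamma_law n \<theta>) (\<lambda>z. (z - \<theta>) ^ i)"
proof -
  interpret prob_space "gamma_law n \<theta>" by (rule prob_space_gamma_law[OF assms])
  have p1: "measure (gamma_law n \<theta>) UNIV = 1" using prob_space by simp
  obtain k where k: "n = Suc k" using assms by (cases n) auto
  note [simp] = gamma_law_moment(1)[OF assms]
  have i1: "integrable (gamma_law n \<theta>) (\<lambda>z. z)" using gamma_law_moment(1)[OF assms, of 1] by simp
  have m: "expectation (\<lambda>z. z) = \<theta>" "expectation (\<lambda>z. z ^ 2) = \<theta>^2 * (real n + 1) / n"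
    "expectation (\<lambda>z. z ^ 3) = \<theta>^3 * (real n + 1) * (real n + 2) / real n^2"
    "expectation (\<lambda>z. z ^ 4) = \<theta>^4 * (real n + 1) * (real n + 2) * (real n + 3) / real n^3"
  proof -
    have f: "fact (n - 1 + 1) = real n * fact k" "fact (n - 1 + 2) = real n * (real n + 1) * fact k"
      "fact (n - 1 + 3) = real n * (real n + 1) * (real n + 2) * fact k"
      "fact (n - 1 + 4) = real n * (real n + 1) * (real n + 2) * (real n + 3) * fact k"
      by (simp_all add: k numeral_eq_Suc algebra_simps)
    have n0: "real n \<noteq> 0" "(fact k :: real) \<noteq> 0" "n - 1 = k" using k by auto
    have E: "expectation (\<lambda>z. z) = real n / (real n / \<theta>)"
      "expectation (\<lambda>z. z ^ 2) = real n * (real n + 1) / (real n / \<theta>) ^ 2"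
      "expectation (\<lambda>z. z ^ 3) = real n * (real n + 1) * (real n + 2) / (real n / \<theta>) ^ 3"
      "expectation (\<lambda>z. z ^ 4) = real n * (real n + 1) * (real n + 2) * (real n + 3) / (real n / \<theta>) ^ 4"
      using gamma_law_moment(2)[OF assms, of 1] gamma_law_moment(2)[OF assms, of 2]
        gamma_law_moment(2)[OF assms, of 3] gamma_law_moment(2)[OF assms, of 4] n0(2)
      unfolding f unfolding n0(3) by simp_all
    have n1: "0 < real n" using assms by simp
    show "expectation (\<lambda>z. z) = \<theta>" using E(1) n1 by simp
    show "expectation (\<lambda>z. z ^ 2) = \<theta>^2 * (real n + 1) / n"
      unfolding E(2) using n1 by (simp add: power_divide power2_eq_square)
    show "expectation (\<lambda>z. z ^ 3) = \<theta>^3 * (real n + 1) * (real n + 2) / real n^2"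
      unfolding E(3) using n1 by (simp add: ac_simps power_divide power3_eq_cube power2_eq_square)
    show "expectation (\<lambda>z. z ^ 4) = \<theta>^4 * (real n + 1) * (real n + 2) * (real n + 3) / real n^3"
      unfolding E(4) using n1 by (simp add: ac_simps power_divide power4_eq_xxxx power3_eq_cube power2_eq_square)
  qed
  show "(\<integral>z. (z - \<theta>) \<partial>gamma_law n \<theta>) = 0" using m i1 by (simp add: p1)
  have e2: "(\<lambda>z::real. (z - \<theta>)\<^sup>2) = (\<lambda>z. z^2 - (2 * \<theta>) * z + \<theta>^2)" by (auto simp: power2_eq_square algebra_simps)
  show "(\<integral>z. (z - \<theta>)\<^sup>2 \<partial>gamma_law n \<theta>) = \<theta>\<^sup>2 / n"
  proof -
    have n1: "0 < real n" using assms by simp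
    have "(\<integral>z. (z - \<theta>)\<^sup>2 \<partial>gamma_law n \<theta>) = \<theta>^2 * (real n + 1) / n - 2 * \<theta> * \<theta> + \<theta>^2"
      unfolding e2 using m(1,2) i1 by (simp add: p1)
    also have "\<dots> = \<theta>\<^sup>2 / n" using n1 by (simp add: field_simps power2_eq_square)
    finally show ?thesis .
  qed
  have e4: "(\<lambda>z::real. (z - \<theta>)^4) = (\<lambda>z. z^4 - (4 * \<theta>) * z^3 + (6 * \<theta>^2) * z^2 - (4 * \<theta>^3) * z + \<theta>^4)"
    by (simp add: fun_eq_iff power4_eq_xxxx power3_eq_cube power2_eq_square algebra_simps)
  show "(\<integral>z. (z - \<theta>) ^ 4 \<partial>gamma_law n \<theta>) = \<theta> ^ 4 * (3 * real n ^ 2 + 6 * real n) / real n ^ 4"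
  proof -
    have n1: "0 < real n" using assms by simp
    have "(\<integral>z. (z - \<theta>)^4 \<partial>gamma_law n \<theta>) = \<theta>^4 * (real n + 1) * (real n + 2) * (real n + 3) / real n^3
        - 4 * \<theta> * (\<theta>^3 * (real n + 1) * (real n + 2) / real n^2) + 6 * \<theta>^2 * (\<theta>^2 * (real n + 1) / n) - 4 * \<theta>^3 * \<theta> + \<theta>^4"
      unfolding e4 using m i1 by (simp add: p1)
    also have "\<dots> = \<theta> ^ 4 * (3 * real n ^ 2 + 6 * real n) / real n ^ 4"
      by (rule gamma_fourth_moment_identity[OF n1])
    finally show ?thesis .
  qed
  have "(\<lambda>z. (z - \<theta>) ^ i) = (\<lambda>z. \<Sum>j\<le>i. (of_nat (i choose j) * (- \<theta>) ^ (i - j)) * z ^ j)"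
    unfolding diff_conv_add_uminus binomial_ring by (simp add: mult.commute mult.left_commute)
  then show "integrable (gamma_law n \<theta>) (\<lambda>z. (z - \<theta>) ^ i)"
    by (auto intro!: Bochner_Integration.integrable_sum)
qed

text \<open>
  The first and second central moments produce the two displayed terms. The remainder is at most
  \<open>\<epsilon> (z - \<theta>)^2\<close> near \<open>\<theta>\<close>, and away from \<open>\<theta>\<close>, where \<open>f\<close> is merely bounded, at most a multiple of
  \<open>(z - \<theta>)^4\<close>; the variance is of order \<open>1 / n\<close> and the fourth central moment of order \<open>1 / n^2\<close>.
\<close>

lemma gamma_law_expansion:
  fixes f :: "real \<Rightarrow> real"
  assumes th: "0 < \<theta>" and f[measurable]: "f \<in> borel_measurable borel" and K: "\<And>z. \<bar>f z\<bar> \<le> K"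
    and peano: "\<And>\<epsilon>. 0 < \<epsilon> \<Longrightarrow> \<exists>d>0. \<forall>z. \<bar>z - \<theta>\<bar> < d \<longrightarrow>
           \<bar>f z - f \<theta> - f1 * (z - \<theta>) - f2 / 2 * (z - \<theta>)\<^sup>2\<bar> \<le> \<epsilon> * (z - \<theta>)\<^sup>2"
  shows "(\<lambda>n. (\<integral>z. f z \<partial>gamma_law n \<theta>) - (f \<theta> + \<theta>\<^sup>2 / 2 * f2 / real n)) \<in> o(\<lambda>n. 1 / real n)"
proof (rule landau_o.smallI)
  fix c :: real assume c: "0 < c"
  \<comment> \<open>with this \<open>\<epsilon>\<close> the quadratic part of the bound contributes exactly \<open>c / 2 / n\<close>\<close>
  define \<epsilon> where "\<epsilon> = c / (2 * \<theta>\<^sup>2)"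
  have "0 < \<epsilon>" using c th by (simp add: \<epsilon>_def)
  from peano[OF this] obtain d where d: "0 < d"
    "\<And>z. \<bar>z - \<theta>\<bar> < d \<Longrightarrow> \<bar>f z - f \<theta> - f1 * (z - \<theta>) - f2 / 2 * (z - \<theta>)\<^sup>2\<bar> \<le> \<epsilon> * (z - \<theta>)\<^sup>2"
    by blast
  define rem where "rem z = f z - f \<theta> - f1 * (z - \<theta>) - f2 / 2 * (z - \<theta>)\<^sup>2" for z
  define L where "L = 2 * K / d^4 + \<bar>f1\<bar> / d^3 + \<bar>f2\<bar> / 2 / d\<^sup>2"
  have K0: "0 \<le> K" using K[of 0] by linarith
  have L0: "0 \<le> L" using d(1) K0 by (simp add: L_def)
  have rem: "\<bar>rem z\<bar> \<le> \<epsilon> * (z - \<theta>)\<^sup>2 + L * (z - \<theta>)^4" for z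
  proof (cases "\<bar>z - \<theta>\<bar> < d")
    case True
    have "0 \<le> L * (z - \<theta>)^4" using L0 by simp
    with d(2)[OF True] show ?thesis by (simp add: rem_def)
  next
    case False
    define u where "u = \<bar>z - \<theta>\<bar>"
    have u: "d \<le> u" "0 < u" using False d(1) by (auto simp: u_def)
    have u4: "(z - \<theta>)^4 = u^4" "(z - \<theta>)\<^sup>2 = u\<^sup>2" by (simp_all add: u_def power_even_abs)
    have "2 * K * d^4 \<le> 2 * K * u^4" using u d K0 by (intro mult_left_mono power_mono) auto
    then have a: "2 * K \<le> 2 * K / d^4 * u^4" using d(1) by (simp add: field_simps)
    have "\<bar>f1\<bar> * u * d^3 \<le> \<bar>f1\<bar> * u * u^3" using u d by (intro mult_left_mono power_mono) auto
    then have b: "\<bar>f1\<bar> * u \<le> \<bar>f1\<bar> / d^3 * u^4" using d(1) by (simp add: field_simps eval_nat_numeral)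
    have "\<bar>f2\<bar> / 2 * u^2 * d^2 \<le> \<bar>f2\<bar> / 2 * u^2 * u^2" using u d by (intro mult_left_mono power_mono) auto
    then have c: "\<bar>f2\<bar> / 2 * u^2 \<le> \<bar>f2\<bar> / 2 / d^2 * u^4" using d(1) by (simp add: field_simps eval_nat_numeral)
    have "\<bar>rem z\<bar> \<le> \<bar>f z\<bar> + \<bar>f \<theta>\<bar> + \<bar>f1 * (z - \<theta>)\<bar> + \<bar>f2 / 2 * (z - \<theta>)\<^sup>2\<bar>" unfolding rem_def by linarith
    also have "\<dots> \<le> K + K + \<bar>f1\<bar> * u + \<bar>f2\<bar> / 2 * u\<^sup>2"
      using K[of z] K[of \<theta>] by (simp add: abs_mult u_def)
    also have "\<dots> \<le> L * u^4" using a b c by (simp add: L_def ring_distribs)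
    also have "\<dots> \<le> \<epsilon> * (z - \<theta>)\<^sup>2 + L * (z - \<theta>)^4" using \<open>0 < \<epsilon>\<close> by (simp add: u4)
    finally show ?thesis .
  qed
  \<comment> \<open>the fourth central moment is at most \<open>9 \<theta>^4 / n^2\<close>, so from \<open>N\<close> on the quartic part
    contributes at most \<open>c / 2 / n\<close>\<close>
  define N where "N = nat \<lceil>18 * L * \<theta>^4 / c\<rceil> + 1"
  have "norm ((\<integral>z. f z \<partial>gamma_law n \<theta>) - (f \<theta> + \<theta>\<^sup>2 / 2 * f2 / real n)) \<le> c * norm (1 / real n)"
    if n: "N \<le> n" for n
  proof -
    have n1: "1 \<le> n" "0 < real n" using n by (auto simp: N_def)
    interpret prob_space "gamma_law n \<theta>" by (rule prob_space_gamma_law[OF th n1(1)])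
    note [simp] = gamma_law_central_moments(4)[OF th n1(1)]
    have i1: "integrable (gamma_law n \<theta>) (\<lambda>z. z - \<theta>)"
      using gamma_law_central_moments(4)[OF th n1(1), of 1] by simp
    have fi: "integrable (gamma_law n \<theta>) f" by (rule integrable_const_bound[of _ K]) (use K in auto)
    have p1: "measure (gamma_law n \<theta>) UNIV = 1" using prob_space by simp
    have "expectation rem = expectation f - f \<theta> - f2 / 2 * (\<theta>\<^sup>2 / n)"
      unfolding rem_def using fi i1 gamma_law_central_moments(1,2)[OF th n1(1)] p1 by simp
    then have "(\<integral>z. f z \<partial>gamma_law n \<theta>) - (f \<theta> + \<theta>\<^sup>2 / 2 * f2 / real n) = expectation rem" by simp
    moreover have "\<bar>expectation rem\<bar> \<le> expectation (\<lambda>z. \<epsilon> * (z - \<theta>)\<^sup>2 + L * (z - \<theta>)^4)"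
    proof -
      have "integrable (gamma_law n \<theta>) rem" unfolding rem_def using fi i1 by simp
      then have "\<bar>expectation rem\<bar> \<le> expectation (\<lambda>z. \<bar>rem z\<bar>)" by (intro integral_abs_bound)
      also have "\<dots> \<le> expectation (\<lambda>z. \<epsilon> * (z - \<theta>)\<^sup>2 + L * (z - \<theta>)^4)"
        using \<open>integrable (gamma_law n \<theta>) rem\<close> rem by (intro integral_mono) auto
      finally show ?thesis .
    qed
    moreover have "expectation (\<lambda>z. \<epsilon> * (z - \<theta>)\<^sup>2 + L * (z - \<theta>)^4)
        = \<epsilon> * (\<theta>\<^sup>2 / n) + L * (\<theta> ^ 4 * (3 * real n ^ 2 + 6 * real n) / real n ^ 4)"
      using gamma_law_central_moments(2,3)[OF th n1(1)] by simp
    moreover have "\<epsilon> * (\<theta>\<^sup>2 / n) = c / 2 / n" using th by (simp add: \<epsilon>_def)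
    moreover have "L * (\<theta> ^ 4 * (3 * real n ^ 2 + 6 * real n) / real n ^ 4) \<le> c / 2 / n"
    proof -
      have "3 * real n ^ 2 + 6 * real n \<le> 9 * real n ^ 2" using n1 by (simp add: power2_eq_square)
      then have "L * (\<theta> ^ 4 * (3 * real n ^ 2 + 6 * real n) / real n ^ 4) \<le> L * (\<theta> ^ 4 * (9 * real n ^ 2) / real n ^ 4)"
        using L0 th by (intro mult_left_mono divide_right_mono) auto
      also have "\<dots> = (18 * L * \<theta>^4) / (2 * real n * real n)"
        using n1 by (simp add: divide_simps eval_nat_numeral)
      also have "\<dots> \<le> (c * real n) / (2 * real n * real n)"
      proof (rule divide_right_mono)
        have "18 * L * \<theta>^4 / c \<le> real n" using n unfolding N_def by linarith
        then show "18 * L * \<theta>^4 \<le> c * real n" using c by (simp add: field_simps)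
      qed (use n1 in auto)
      also have "\<dots> = c / 2 / n" using n1 by simp
      finally show ?thesis .
    qed
    ultimately show ?thesis by simp
  qed
  then show "\<forall>\<^sub>F n in sequentially. norm ((\<integral>z. f z \<partial>gamma_law n \<theta>) - (f \<theta> + \<theta>\<^sup>2 / 2 * f2 / real n)) \<le> c * norm (1 / real n)"
    by (intro eventually_sequentiallyI)
qed

section \<open>The exponential of an indefinite integral\<close>

text \<open>
  If \<open>f\<close> were continuous this would be the fundamental theorem of calculus for \<open>exp (- (F d - F v))\<close>.
  For an integrable \<open>f\<close> it holds because the continuous monotone function \<open>F\<close> maps the measure with
  density \<open>f\<close> on \<open>{c..d}\<close> to Lebesgue measure on \<open>{F c..F d}\<close>, where the integrand is an exponential.
\<close>

lemma exp_integral_identity: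
  fixes f :: "real \<Rightarrow> real"
  assumes f[measurable]: "f \<in> borel_measurable borel" and f0: "\<And>u. 0 \<le> f u" and fi: "integrable lborel f"
    and cd: "c \<le> d"
  defines "F \<equiv> cdf (density lborel f)"
  shows "(\<integral>\<^sup>+v. ennreal (f v * exp (- (F d - F v))) * indicator {c..d} v \<partial>lborel) = ennreal (1 - exp (- (F d - F c)))"
proof -
  define M where "M = density lborel (\<lambda>u. ennreal (f u))"
  have sM[simp, measurable_cong]: "sets M = sets borel" by (simp add: M_def)
  have "finite_measure M"
    using fi f0 by (intro finite_measureI) (simp add: M_def emeasure_density nn_integral_eq_integral)
  then interpret finite_borel_measure M
    by (intro finite_borel_measure.intro finite_borel_measure_axioms.intro) simp_all
  have F: "F = cdf M" by (simp add: F_def M_def)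
  have pt: "emeasure M {x} = 0" for x unfolding M_def by (subst emeasure_density) auto
  have cont: "isCont F x" for x unfolding F isCont_cdf by (simp add: measure_def pt)
  have mono: "F x \<le> F y" if "x \<le> y" for x y unfolding F by (rule cdf_nondecreasing[OF that])
  have Fm[measurable]: "F \<in> borel_measurable borel"
    by (rule borel_measurable_mono) (auto intro!: monoI mono)
  have Ioc: "emeasure M {a<..b} = ennreal (F b - F a)" if "a \<le> b" for a b
    unfolding F using emeasure_Ioc[OF that] .
  have Icc: "emeasure M {a..b} = ennreal (F b - F a)" if "a \<le> b" for a b
  proof -
    have "{a..b} = {a} \<union> {a<..b}" using that by auto
    then have "emeasure M {a..b} = emeasure M {a} + emeasure M {a<..b}"
      by (simp add: plus_emeasure)
    then show ?thesis using pt Ioc[OF that] by simp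
  qed
  define N where "N = distr (density M (indicator {c..d})) borel F"
  have N: "N = density lborel (indicator {F c..F d})"
  proof (rule measure_eqI_lessThan)
    fix x
    have N1: "emeasure N {x<..} = emeasure M ({c..d} \<inter> {v. x < F v})"
      unfolding N_def by (subst emeasure_distr) (auto simp: emeasure_restricted borel_UNIV vimage_def)
    have N2: "emeasure (density lborel (indicator {F c..F d})) {x<..} = emeasure lborel ({F c..F d} \<inter> {x<..})"
      by (simp add: emeasure_restricted)
    consider "F d \<le> x" | "x < F c" | "F c \<le> x" "x < F d" by linarith
    then have "emeasure M ({c..d} \<inter> {v. x < F v}) = emeasure lborel ({F c..F d} \<inter> {x<..})"
    proof cases
      case 1
      have "\<not> x < F v" if "v \<in> {c..d}" for v using mono[of v d] that 1 by auto
      then have "{c..d} \<inter> {v. x < F v} = {}" "{F c..F d} \<inter> {x<..} = {}" using 1 by auto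
      then show ?thesis by simp
    next
      case 2
      have "x < F v" if "v \<in> {c..d}" for v using mono[of c v] that 2 by auto
      then have "{c..d} \<inter> {v. x < F v} = {c..d}" "{F c..F d} \<inter> {x<..} = {F c..F d}" using 2 by auto
      then show ?thesis using Icc[OF cd] mono[OF cd] by simp
    next
      case 3
      \<comment> \<open>\<open>F\<close> may be constant on an interval, so the set where \<open>x < F\<close> starts after the last point
        at which \<open>F\<close> takes the value \<open>x\<close>\<close>
      define S where "S = {v\<in>{c..d}. F v = x}"
      have "\<exists>v. c \<le> v \<and> v \<le> d \<and> F v = x" using 3 cd cont by (intro IVT) simp_all
      then have S0: "S \<noteq> {}" by (auto simp: S_def)
      have "compact S"
      proof -
        have "continuous_on UNIV F" using cont by (simp add: continuous_at_imp_continuous_on)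
        then have "closed (F -` {x})" by (intro closed_vimage closed_singleton)
        moreover have "S = {c..d} \<inter> F -` {x}" by (auto simp: S_def)
        ultimately show ?thesis by (metis compact_Icc compact_Int_closed)
      qed
      from compact_attains_sup[OF this S0] obtain v1 where v1: "v1 \<in> S" "\<And>v. v \<in> S \<Longrightarrow> v \<le> v1"
        by auto
      have "{c..d} \<inter> {v. x < F v} = {v1<..d}"
      proof (intro set_eqI iffI)
        fix v assume v: "v \<in> {c..d} \<inter> {v. x < F v}"
        then have "\<not> v \<le> v1" using mono[of v v1] v1(1) by (auto simp: S_def)
        then show "v \<in> {v1<..d}" using v by auto
      next
        fix v assume v: "v \<in> {v1<..d}"
        then have vc: "v \<in> {c..d}" using v1(1) by (auto simp: S_def)
        then have "F v \<noteq> x" using v1(2)[of v] v by (auto simp: S_def)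
        moreover have "x \<le> F v" using mono[of v1 v] v v1(1) by (auto simp: S_def)
        ultimately show "v \<in> {c..d} \<inter> {v. x < F v}" using vc by auto
      qed
      moreover have "{F c..F d} \<inter> {x<..} = {x<..F d}" using 3 by auto
      moreover have "v1 \<le> d" "F v1 = x" using v1(1) by (auto simp: S_def)
      ultimately show ?thesis using Ioc[of v1 d] 3 by simp
    qed
    then show "emeasure N {x<..} = emeasure (density lborel (indicator {F c..F d})) {x<..}" using N1 N2 by simp
    show "emeasure N {x<..} < \<infinity>" unfolding N1 by (simp add: emeasure_eq_measure)
  qed (simp_all add: N_def)
  have "(\<integral>\<^sup>+v. ennreal (f v * exp (- (F d - F v))) * indicator {c..d} v \<partial>lborel)
      = (\<integral>\<^sup>+v. ennreal (exp (- (F d - F v))) * indicator {c..d} v \<partial>M)"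
    unfolding M_def using f0 by (subst nn_integral_density) (auto simp: ennreal_mult' mult.assoc)
  also have "\<dots> = (\<integral>\<^sup>+v. ennreal (exp (- (F d - F v))) \<partial>density M (indicator {c..d}))"
    by (subst nn_integral_density) (auto simp: mult.commute)
  also have "\<dots> = (\<integral>\<^sup>+z. ennreal (exp (- (F d - z))) \<partial>N)"
    unfolding N_def by (subst nn_integral_distr) auto
  also have "\<dots> = (\<integral>\<^sup>+z. ennreal (exp (- (F d - z))) * indicator {F c..F d} z \<partial>lborel)"
    unfolding N by (subst nn_integral_density) (auto simp: mult.commute)
  also have "\<dots> = ennreal (exp (- (F d - F d)) - exp (- (F d - F c)))"
    using mono[OF cd] by (intro nn_integral_FTC_Icc) (auto intro!: derivative_eq_intros)
  finally show ?thesis by simp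
qed

section \<open>Void probabilities and the law of a random intensity\<close>

text \<open>
  \<open>exp (- r)\<close> with the value 0 at infinity: the probability that a Poisson variable of mean \<open>r\<close>
  vanishes, also for infinite \<open>r\<close>.
\<close>

definition exp_neg :: "ennreal \<Rightarrow> real" where "exp_neg r = poisson_prob r 0"

lemma exp_neg_ennreal: "0 \<le> x \<Longrightarrow> exp_neg (ennreal x) = exp (- x)"
  by (simp add: exp_neg_def poisson_prob_def)

lemma exp_neg_top[simp]: "exp_neg \<top> = 0"
  by (simp add: exp_neg_def poisson_prob_def)

lemma exp_neg_0[simp]: "exp_neg 0 = 1"
  by (simp add: exp_neg_def poisson_prob_def)

lemma exp_neg_nonneg[simp]: "0 \<le> exp_neg r"
  by (simp add: exp_neg_def poisson_prob_def)

lemma exp_neg_le_1[simp]: "exp_neg r \<le> 1"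
  by (simp add: exp_neg_def poisson_prob_def)

lemma exp_neg_add: "exp_neg (r + s) = exp_neg r * exp_neg s"
  by (cases r rule: ennreal_cases; cases s rule: ennreal_cases)
     (simp_all add: exp_neg_ennreal exp_diff[symmetric] exp_add[symmetric] flip: ennreal_plus)

lemma exp_neg_antimono: "r \<le> s \<Longrightarrow> exp_neg s \<le> exp_neg r"
  by (cases r rule: ennreal_cases; cases s rule: ennreal_cases) (auto simp: exp_neg_ennreal top_unique)

lemma tendsto_exp_neg:
  assumes "(X \<longlongrightarrow> r) F"
  shows "((\<lambda>i. exp_neg (X i)) \<longlongrightarrow> exp_neg r) F"
proof (cases r rule: ennreal_cases)
  case (real x)
  have ev: "\<forall>\<^sub>F i in F. X i < \<top>" using assms real by (intro order_tendstoD(2)) auto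
  have "((\<lambda>i. exp (- enn2real (X i))) \<longlongrightarrow> exp (- x)) F"
    using assms real by (intro tendsto_intros) auto
  moreover have "\<forall>\<^sub>F i in F. exp (- enn2real (X i)) = exp_neg (X i)"
    using ev by eventually_elim (auto simp: exp_neg_def poisson_prob_def)
  ultimately show ?thesis using real by (simp add: exp_neg_ennreal tendsto_cong)
next
  case top
  have "\<forall>\<^sub>F i in F. \<bar>exp_neg (X i)\<bar> < e" if "0 < e" for e
  proof -
    \<comment> \<open>\<open>exp (ln e - 1) < e\<close>; the maximum keeps the level \<open>K\<close> nonnegative\<close>
    define K where "K = max 0 (1 - ln e)"
    have K0: "0 \<le> K" by (simp add: K_def)
    have "\<forall>\<^sub>F i in F. ennreal K < X i" using assms top by (intro order_tendstoD(1)) auto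
    then show ?thesis
    proof eventually_elim
      case (elim i)
      have "exp_neg (X i) \<le> exp_neg (ennreal K)" using elim by (intro exp_neg_antimono) auto
      also have "\<dots> = exp (- K)" by (rule exp_neg_ennreal[OF K0])
      also have "\<dots> < e" using that by (subst ln_less_cancel_iff[symmetric]) (auto simp: K_def)
      finally show ?case by simp
    qed
  qed
  then show ?thesis using top by (intro tendstoI) (auto simp: dist_real_def)
qed

lemma exp_neg_measurable[measurable]: "exp_neg \<in> borel_measurable borel"
  by (intro borel_measurable_continuous_onI) (auto simp: continuous_on_def intro!: tendsto_exp_neg)

text \<open>
  The probability that a Poisson process with intensity function \<open>f\<close> has no point in \<open>B\<close>.
\<close>

definition avoid :: "(real \<Rightarrow> real) \<Rightarrow> real set \<Rightarrow> real" where
  "avoid f B = exp_neg (\<integral>\<^sup>+u\<in>B. ennreal (f u) \<partial>lborel)"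

lemma avoid_bounds[simp]: "0 \<le> avoid f B" "avoid f B \<le> 1"
  by (simp_all add: avoid_def)

lemma random_intensity_section:
  assumes "random_intensity M Y" "w \<in> space M"
  shows "Y w \<in> borel_measurable borel"
  using assms measurable_Pair2[of "\<lambda>(w, t). Y w t" M borel borel w]
  by (simp add: random_intensity_def)

lemma random_intensity_paths:
  assumes "random_intensity M Y"
  shows "Y \<in> measurable M paths"
proof -
  have "(\<lambda>w. \<lambda>t\<in>UNIV. Y w t) \<in> measurable M paths"
  proof (rule measurable_restrict)
    fix t :: real
    show "(\<lambda>w. Y w t) \<in> borel_measurable M"
      using assms measurable_Pair1[of "\<lambda>(w, t). Y w t" M borel borel t] by (simp add: random_intensity_def)
  qed
  then show ?thesis by (simp add: restrict_def)
qed

lemma random_intensity_measurable: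
  assumes "random_intensity M Y" "sets N = sets borel"
  shows "(\<lambda>(w, t). Y w t) \<in> borel_measurable (M \<Otimes>\<^sub>M N)"
  using assms(1) unfolding measurable_cong_sets[OF sets_pair_measure_cong[OF refl assms(2)] refl]
  by (simp add: random_intensity_def)

lemma random_intensity_avoid[measurable (raw)]:
  assumes Y: "random_intensity M Y" and [measurable]: "B \<in> sets borel"
  shows "(\<lambda>w. avoid (Y w) B) \<in> borel_measurable M"
proof -
  have [measurable]: "(\<lambda>(w, t). Y w t) \<in> borel_measurable (M \<Otimes>\<^sub>M lborel)"
    using Y by (intro random_intensity_measurable) simp_all
  show ?thesis unfolding avoid_def by measurable
qed

text \<open>
  Equality of laws on \<open>paths\<close> speaks of countably many coordinates only, whereas an integral over
  \<open>u\<close> involves all of them and is not a measurable function on \<open>paths\<close>. Moments of such integrals are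
  nevertheless determined by the law: by Fubini each factor of the power becomes an outer integral over
  one more coordinate, which the induction absorbs into the bounded measurable function \<open>g\<close>.
\<close>

lemma same_law_moments:
  assumes M1: "finite_measure M1" and M2: "finite_measure M2"
    and Y1: "random_intensity M1 Y1" and Y2: "random_intensity M2 Y2"
    and law: "distr M1 paths Y1 = distr M2 paths Y2"
    and N: "finite_measure N" and sN[measurable_cong]: "sets N = sets borel" and K: "0 \<le> K"
    and g: "g \<in> borel_measurable paths" "\<And>f. \<bar>g f\<bar> \<le> c"
  shows "(\<integral>w. g (Y1 w) * (\<integral>u. min (Y1 w u) K \<partial>N) ^ k \<partial>M1) = (\<integral>w. g (Y2 w) * (\<integral>u. min (Y2 w u) K \<partial>N) ^ k \<partial>M2)"
  using g
proof (induction k arbitrary: g c)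
  case 0
  have "(\<integral>w. g (Y1 w) \<partial>M1) = (\<integral>f. g f \<partial>distr M1 paths Y1)"
    using 0 random_intensity_paths[OF Y1] by (subst integral_distr) auto
  also have "\<dots> = (\<integral>w. g (Y2 w) \<partial>M2)"
    unfolding law using 0 random_intensity_paths[OF Y2] by (subst integral_distr) auto
  finally show ?case by simp
next
  case (Suc k)
  interpret N: finite_measure N by fact
  have c0: "0 \<le> c" using Suc.prems(2)[of undefined] by linarith
  define Z where "Z f = (\<integral>u. min (f u) K \<partial>N)" for f
  have step: "(\<integral>w. g (Y w) * Z (Y w) ^ Suc k \<partial>M) = (\<integral>u. (\<integral>w. (g (Y w) * min (Y w u) K) * Z (Y w) ^ k \<partial>M) \<partial>N)"
    if M: "finite_measure M" and Y: "random_intensity M Y" for M :: "'z measure" and Y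
  proof -
    interpret M: finite_measure M by fact
    interpret P: pair_sigma_finite M N ..
    interpret P: finite_measure "M \<Otimes>\<^sub>M N" by (rule finite_measure_pair_measure) fact+
    have [measurable]: "(\<lambda>(w, t). Y w t) \<in> borel_measurable (M \<Otimes>\<^sub>M N)"
      using Y sN by (rule random_intensity_measurable)
    have pos: "0 \<le> Y w t" if "w \<in> space M" for w t using Y that by (simp add: random_intensity_def)
    have [measurable]: "(\<lambda>w. g (Y w)) \<in> borel_measurable M"
      using measurable_compose[OF random_intensity_paths[OF Y] Suc.prems(1)] .
    have Zm[measurable]: "(\<lambda>w. Z (Y w)) \<in> borel_measurable M" unfolding Z_def by measurable
    have Zb: "\<bar>Z (Y w)\<bar> \<le> K * measure N (space N)" if w: "w \<in> space M" for w
    proof -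
      have "\<bar>Z (Y w)\<bar> \<le> (\<integral>u. \<bar>min (Y w u) K\<bar> \<partial>N)" unfolding Z_def by (rule integral_abs_bound)
      also have "\<dots> \<le> (\<integral>u. K \<partial>N)"
        using w pos[OF w] K random_intensity_section[OF Y w]
        by (intro integral_mono N.integrable_const_bound[of _ K]) (auto simp: min_def measurable_cong_sets[OF sN refl])
      finally show ?thesis by (simp add: mult.commute)
    qed
    have "(\<integral>w. g (Y w) * Z (Y w) ^ Suc k \<partial>M) = (\<integral>w. (\<integral>u. (g (Y w) * min (Y w u) K) * Z (Y w) ^ k \<partial>N) \<partial>M)"
    proof (intro Bochner_Integration.integral_cong refl)
      fix w
      have "(\<integral>u. (g (Y w) * min (Y w u) K) * Z (Y w) ^ k \<partial>N) = (\<integral>u. (g (Y w) * Z (Y w) ^ k) * min (Y w u) K \<partial>N)"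
        by (simp only: mult_ac)
      also have "\<dots> = (g (Y w) * Z (Y w) ^ k) * Z (Y w)" unfolding integral_mult_right_zero Z_def ..
      finally show "g (Y w) * Z (Y w) ^ Suc k = (\<integral>u. (g (Y w) * min (Y w u) K) * Z (Y w) ^ k \<partial>N)"
        by (simp only: power_Suc mult_ac)
    qed
    also have "\<dots> = (\<integral>u. (\<integral>w. (g (Y w) * min (Y w u) K) * Z (Y w) ^ k \<partial>M) \<partial>N)"
    proof (rule P.Fubini_integral[symmetric], rule P.integrable_const_bound)
      show "AE x in M \<Otimes>\<^sub>M N. norm (case x of (w, u) \<Rightarrow> g (Y w) * min (Y w u) K * Z (Y w) ^ k)
         \<le> c * K * (K * measure N (space N)) ^ k"
      proof (rule AE_I2)
        fix x assume "x \<in> space (M \<Otimes>\<^sub>M N)"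
        then obtain w u where x: "x = (w, u)" "w \<in> space M" by (auto simp: space_pair_measure)
        have "\<bar>min (Y w u) K\<bar> \<le> K" using pos[OF x(2), of u] K by auto
        then have "\<bar>g (Y w) * min (Y w u) K * Z (Y w) ^ k\<bar> \<le> c * K * (K * measure N (space N)) ^ k"
          unfolding abs_mult power_abs using c0 K Suc.prems(2) Zb[OF x(2)]
          by (intro mult_mono power_mono) auto
        then show "norm (case x of (w, u) \<Rightarrow> g (Y w) * min (Y w u) K * Z (Y w) ^ k)
         \<le> c * K * (K * measure N (space N)) ^ k" using x by simp
      qed
    qed measurable
    finally show ?thesis .
  qed
  \<comment> \<open>\<open>max 0\<close> changes nothing for nonnegative intensities and makes the new factor bounded on all
    paths, as required of \<open>g\<close>\<close>
  have IH: "(\<integral>w. (g (Y1 w) * max 0 (min (Y1 w u) K)) * Z (Y1 w) ^ k \<partial>M1)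
      = (\<integral>w. (g (Y2 w) * max 0 (min (Y2 w u) K)) * Z (Y2 w) ^ k \<partial>M2)" for u
  proof -
    have 1: "(\<lambda>f. g f * max 0 (min (f u) K)) \<in> borel_measurable paths"
      using Suc.prems(1) by measurable
    have 2: "\<bar>g f * max 0 (min (f u) K)\<bar> \<le> c * K" for f
      unfolding abs_mult using Suc.prems(2)[of f] K c0 by (intro mult_mono) auto
    show ?thesis using Suc.IH[OF 1 2] by (simp add: Z_def)
  qed
  have nn: "(\<integral>w. (g (Y w) * min (Y w u) K) * Z (Y w) ^ k \<partial>M) = (\<integral>w. (g (Y w) * max 0 (min (Y w u) K)) * Z (Y w) ^ k \<partial>M)"
    if "random_intensity M Y" for M :: "'z measure" and Y u
    using that K by (intro Bochner_Integration.integral_cong refl) (auto simp: random_intensity_def max_def min_def)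
  show ?case
    unfolding Z_def[symmetric] step[OF M1 Y1] step[OF M2 Y2] nn[OF Y1] nn[OF Y2] IH ..
qed

text \<open>
  Void probabilities depend on the law of the intensity only: the exponential of a bounded integral
  is the sum of its moment series, and the cut-off at \<open>K\<close> is removed by monotone convergence.
\<close>

lemma same_law_avoid:
  assumes M1: "finite_measure M1" and M2: "finite_measure M2"
    and Y1: "random_intensity M1 Y1" and Y2: "random_intensity M2 Y2"
    and law: "distr M1 paths Y1 = distr M2 paths Y2"
    and B[measurable]: "B \<in> sets borel" and Bfin: "emeasure lborel B < \<infinity>"
  shows "(\<integral>w. avoid (Y1 w) B \<partial>M1) = (\<integral>w. avoid (Y2 w) B \<partial>M2)"
proof -
  define N where "N = density lborel (indicator B :: real \<Rightarrow> ennreal)"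
  have sN[measurable_cong]: "sets N = sets borel" by (simp add: N_def)
  have fN: "finite_measure N"
    using Bfin by (intro finite_measureI) (simp add: N_def emeasure_density)
  interpret N: finite_measure N by fact
  define Z where "Z K f = (\<integral>u. min (f u) K \<partial>N)" for K and f :: "real \<Rightarrow> real"
  have lim1: "(\<lambda>n. \<Sum>k<n. (- 1) ^ k / fact k * (\<integral>w. Z K (Y w) ^ k \<partial>M)) \<longlonglongrightarrow> (\<integral>w. exp (- Z K (Y w)) \<partial>M)"
    and lim2: "(\<lambda>n. \<integral>w. exp (- Z (real n) (Y w)) \<partial>M) \<longlonglongrightarrow> (\<integral>w. avoid (Y w) B \<partial>M)"
    if M: "finite_measure M" and Y: "random_intensity M Y" and K: "0 \<le> K" for M :: "'z measure" and Y K
  proof -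
    interpret M: finite_measure M by fact
    have [measurable]: "(\<lambda>(w, t). Y w t) \<in> borel_measurable (M \<Otimes>\<^sub>M N)"
      using Y sN by (rule random_intensity_measurable)
    have pos: "0 \<le> Y w t" if "w \<in> space M" for w t using Y that by (simp add: random_intensity_def)
    have Zm[measurable]: "(\<lambda>w. Z K (Y w)) \<in> borel_measurable M" for K unfolding Z_def by measurable
    have sec[measurable]: "Y w \<in> borel_measurable borel" if "w \<in> space M" for w
      using random_intensity_section[OF Y that] .
    have int: "integrable N (\<lambda>u. min (Y w u) K)" if w: "w \<in> space M" and K: "0 \<le> K" for w K
      using w pos[OF w] K sec[OF w]
      by (intro N.integrable_const_bound[of _ K]) (auto simp: min_def measurable_cong_sets[OF sN refl])
    have Z0: "0 \<le> Z K (Y w)" if w: "w \<in> space M" and K: "0 \<le> K" for w K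
      unfolding Z_def using pos[OF w] K by (intro integral_nonneg_AE) auto
    define b where "b = K * measure N (space N)"
    have Zb: "Z K (Y w) \<le> b" if w: "w \<in> space M" for w
    proof -
      have "Z K (Y w) \<le> (\<integral>u. K \<partial>N)" unfolding Z_def using int[OF w K] by (intro integral_mono) auto
      then show ?thesis by (simp add: b_def mult.commute)
    qed
    have intZ: "integrable M (\<lambda>w. Z K (Y w) ^ k)" for k
      by (rule M.integrable_const_bound[of _ "b ^ k"])
         (use Z0[OF _ K] Zb in \<open>auto intro!: AE_I2 power_mono simp: abs_of_nonneg\<close>)
    have "(\<lambda>n. \<integral>w. (\<Sum>k<n. (- 1) ^ k / fact k * Z K (Y w) ^ k) \<partial>M) \<longlonglongrightarrow> (\<integral>w. exp (- Z K (Y w)) \<partial>M)"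
    proof (rule integral_dominated_convergence[where w="\<lambda>_. exp b"])
      show "AE w in M. (\<lambda>n. \<Sum>k<n. (- 1) ^ k / fact k * Z K (Y w) ^ k) \<longlonglongrightarrow> exp (- Z K (Y w))"
      proof (rule AE_I2)
        fix w
        show "(\<lambda>n. \<Sum>k<n. (- 1) ^ k / fact k * Z K (Y w) ^ k) \<longlonglongrightarrow> exp (- Z K (Y w))"
          using exp_converges[of "- Z K (Y w)"] unfolding sums_def
          by (simp add: power_minus[of "Z K (Y w)"] field_simps scaleR_conv_of_real)
      qed
      show "AE w in M. norm (\<Sum>k<n. (- 1) ^ k / fact k * Z K (Y w) ^ k) \<le> exp b" for n
      proof (rule AE_I2)
        fix w assume w: "w \<in> space M"
        have "norm (\<Sum>k<n. (- 1) ^ k / fact k * Z K (Y w) ^ k) \<le> (\<Sum>k<n. Z K (Y w) ^ k / fact k)"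
          by (rule sum_norm_le) (use Z0[OF w K] in \<open>simp add: abs_mult power_abs\<close>)
        also have "\<dots> \<le> (\<Sum>k. Z K (Y w) ^ k / fact k)"
          using exp_converges[of "Z K (Y w)"] Z0[OF w K]
          by (intro sum_le_suminf) (auto simp: field_simps sums_iff)
        also have "\<dots> = exp (Z K (Y w))"
          using exp_converges[of "Z K (Y w)"] by (simp add: sums_iff field_simps)
        also have "\<dots> \<le> exp b" using Zb[OF w] by simp
        finally show "norm (\<Sum>k<n. (- 1) ^ k / fact k * Z K (Y w) ^ k) \<le> exp b" .
      qed
    qed auto
    then show "(\<lambda>n. \<Sum>k<n. (- 1) ^ k / fact k * (\<integral>w. Z K (Y w) ^ k \<partial>M)) \<longlonglongrightarrow> (\<integral>w. exp (- Z K (Y w)) \<partial>M)"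
      using intZ by simp
    show "(\<lambda>n. \<integral>w. exp (- Z (real n) (Y w)) \<partial>M) \<longlonglongrightarrow> (\<integral>w. avoid (Y w) B \<partial>M)"
    proof (rule integral_dominated_convergence[where w="\<lambda>_. 1"])
      show "(\<lambda>w. avoid (Y w) B) \<in> borel_measurable M" using Y B by (rule random_intensity_avoid)
      show "AE w in M. norm (exp (- Z (real n) (Y w))) \<le> 1" for n
        using Z0 by (intro AE_I2) auto
      show "AE w in M. (\<lambda>n. exp (- Z (real n) (Y w))) \<longlonglongrightarrow> avoid (Y w) B"
      proof (rule AE_I2)
        fix w assume w: "w \<in> space M"
        note [measurable] = sec[OF w]
        have "exp (- Z (real n) (Y w)) = exp_neg (\<integral>\<^sup>+u. ennreal (min (Y w u) (real n)) \<partial>N)" for n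
        proof -
          have "(\<integral>\<^sup>+u. ennreal (min (Y w u) (real n)) \<partial>N) = ennreal (Z (real n) (Y w))"
            unfolding Z_def using int[OF w, of "real n"] pos[OF w] by (intro nn_integral_eq_integral) auto
          then show ?thesis using exp_neg_ennreal[OF Z0[OF w, of "real n"]] by simp
        qed
        moreover have "(\<lambda>n. \<integral>\<^sup>+u. ennreal (min (Y w u) (real n)) \<partial>N) \<longlonglongrightarrow> (\<integral>\<^sup>+u. ennreal (Y w u) \<partial>N)"
        proof (rule nn_integral_LIMSEQ)
          show "incseq (\<lambda>n u. ennreal (min (Y w u) (real n)))"
            by (auto simp: incseq_def le_fun_def intro!: ennreal_leI)
          fix u
          have "\<forall>\<^sub>F n in sequentially. min (Y w u) (real n) = Y w u"
            by (rule eventually_sequentiallyI[of "nat \<lceil>Y w u\<rceil>"]) linarith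
          then show "(\<lambda>n. ennreal (min (Y w u) (real n))) \<longlonglongrightarrow> ennreal (Y w u)"
            by (intro tendsto_eventually) (auto elim!: eventually_mono)
        qed measurable
        ultimately have "(\<lambda>n. exp (- Z (real n) (Y w))) \<longlonglongrightarrow> exp_neg (\<integral>\<^sup>+u. ennreal (Y w u) \<partial>N)"
          by (simp add: tendsto_exp_neg)
        moreover have "(\<integral>\<^sup>+u. ennreal (Y w u) \<partial>N) = (\<integral>\<^sup>+u\<in>B. ennreal (Y w u) \<partial>lborel)"
          unfolding N_def by (subst nn_integral_density) (auto simp: mult.commute)
        ultimately show "(\<lambda>n. exp (- Z (real n) (Y w))) \<longlonglongrightarrow> avoid (Y w) B"
          by (simp add: avoid_def)
      qed
    qed auto
  qed
  have "(\<integral>w. exp (- Z K (Y1 w)) \<partial>M1) = (\<integral>w. exp (- Z K (Y2 w)) \<partial>M2)" if K: "0 \<le> K" for K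
  proof -
    have "(\<integral>w. Z K (Y1 w) ^ k \<partial>M1) = (\<integral>w. Z K (Y2 w) ^ k \<partial>M2)" for k
      using same_law_moments[OF M1 M2 Y1 Y2 law fN sN K, of "\<lambda>_. 1" 1 k] by (simp add: Z_def)
    then show ?thesis
      using LIMSEQ_unique[OF lim1[OF M1 Y1 K]] lim1[OF M2 Y2 K] by simp
  qed
  then show ?thesis using LIMSEQ_unique[OF lim2[OF M1 Y1 order_refl]] lim2[OF M2 Y2 order_refl] by simp
qed

section \<open>Configurations\<close>

lemma ecard_eq_0_iff[simp]: "ecard X = 0 \<longleftrightarrow> X = {}"
  by (auto simp: ecard_def zero_enat_def)

lemma ecard_mono: "X \<subseteq> Y \<Longrightarrow> ecard X \<le> ecard Y"
  by (auto simp: ecard_def card_mono finite_subset)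

lemma ecard_inj_image: "inj_on f X \<Longrightarrow> ecard (f ` X) = ecard X"
  by (auto simp: ecard_def card_image finite_image_iff)

lemma ennreal_of_enat_ecard: "ennreal_of_enat (ecard {n. p n}) = (\<Sum>n. indicator {n. p n} n)"
proof -
  have "(\<Sum>n. indicator {n. p n} n) = (\<integral>\<^sup>+n. indicator {n. p n} n \<partial>count_space UNIV)"
    by (rule nn_integral_count_space_nat[symmetric])
  also have "\<dots> = emeasure (count_space UNIV) {n. p n}" by simp
  finally show ?thesis by (simp add: ecard_def emeasure_count_space)
qed

lemma space_configurations[simp]: "space (configurations S) = Pow (space S)"
  unfolding configurations_def by (rule space_measure_of) auto

lemma configuration_count_measurable[measurable]:
  assumes "B \<in> sets S"
  shows "(\<lambda>X. ecard (X \<inter> B)) \<in> measurable (configurations S) (count_space UNIV)"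
proof (subst measurable_count_space_eq2_countable)
  have "{X \<in> Pow (space S). ecard (X \<inter> B) = k} \<in> sets (configurations S)" for k
    unfolding configurations_def using assms by (subst sets_measure_of) (auto intro!: sigma_sets.Basic)
  moreover have "(\<lambda>X. ecard (X \<inter> B)) -` {k} \<inter> space (configurations S) = {X \<in> Pow (space S). ecard (X \<inter> B) = k}" for k
    by auto
  ultimately show "(\<lambda>X. ecard (X \<inter> B)) \<in> space (configurations S) \<rightarrow> UNIV \<and>
    (\<forall>a\<in>UNIV. (\<lambda>X. ecard (X \<inter> B)) -` {a} \<inter> space (configurations S) \<in> sets (configurations S))" by simp
qed

lemma configuration_void_measurable[measurable]:
  assumes "B \<in> sets S"
  shows "Measurable.pred (configurations S) (\<lambda>X. X \<inter> B = {})"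
proof -
  have "Measurable.pred (configurations S) (\<lambda>X. ecard (X \<inter> B) = 0)" using assms by measurable
  then show ?thesis by simp
qed

lemma measurable_configurationsI:
  assumes "\<And>w. w \<in> space M \<Longrightarrow> X w \<subseteq> space S"
    and m: "\<And>B. B \<in> sets S \<Longrightarrow> (\<lambda>w. ecard (X w \<inter> B)) \<in> measurable M (count_space UNIV)"
  shows "X \<in> measurable M (configurations S)"
  unfolding configurations_def
proof (rule measurable_measure_of)
  fix A assume "A \<in> {{X \<in> Pow (space S). ecard (X \<inter> B) = k} |B k. B \<in> sets S}"
  then obtain B k where A: "A = {X \<in> Pow (space S). ecard (X \<inter> B) = k}" "B \<in> sets S" by auto
  have "X -` A \<inter> space M = (\<lambda>w. ecard (X w \<inter> B)) -` {k} \<inter> space M" using assms(1) A(1) by auto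
  then show "X -` A \<inter> space M \<in> sets M" using m[OF A(2)] by (simp add: measurable_sets)
qed (use assms(1) in auto)

section \<open>Void probabilities of a document given its arrival time\<close>

text \<open>
  The probability that a document arriving at \<open>b\<close> has no request in \<open>B\<close>.
\<close>

definition void_prob :: "'p measure \<Rightarrow> ('p \<Rightarrow> real \<Rightarrow> real) \<Rightarrow> real set \<Rightarrow> real \<Rightarrow> real" where
  "void_prob P lam B b = (\<integral>v. avoid (\<lambda>u. lam v (u - b)) B \<partial>P)"

lemma random_intensity_shift:
  assumes "random_intensity P lam" and g[measurable]: "g \<in> borel_measurable M"
  shows "random_intensity (M \<Otimes>\<^sub>M P) (\<lambda>(w, v) t. lam v (t - g w))"
proof -
  have [measurable]: "(\<lambda>(w, t). lam w t) \<in> borel_measurable (P \<Otimes>\<^sub>M borel)"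
    using assms by (simp add: random_intensity_def)
  have "(\<lambda>p. (\<lambda>(w, t). lam w t) (snd (fst p), snd p - g (fst (fst p)))) \<in> borel_measurable ((M \<Otimes>\<^sub>M P) \<Otimes>\<^sub>M borel)"
    by measurable
  then show ?thesis using assms(1) by (auto simp: random_intensity_def split_beta' space_pair_measure)
qed

lemma void_prob_measurable[measurable]:
  assumes "canonical_intensity P lam" and [measurable]: "B \<in> sets borel"
  shows "void_prob P lam B \<in> borel_measurable borel"
proof -
  interpret P: prob_space P using assms by (simp add: canonical_intensity_def)
  have "random_intensity (borel \<Otimes>\<^sub>M P) (\<lambda>(b, v) t. lam v (t - b))"
    using assms by (intro random_intensity_shift) (auto simp: canonical_intensity_def)
  from random_intensity_avoid[OF this assms(2)]
  have [measurable]: "(\<lambda>(b, v). avoid (\<lambda>u. lam v (u - b)) B) \<in> borel_measurable (borel \<Otimes>\<^sub>M P)"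
    by (simp add: split_beta')
  show ?thesis unfolding void_prob_def[abs_def] by measurable
qed

lemma void_prob_nonneg: "0 \<le> void_prob P lam B b"
  unfolding void_prob_def by (intro integral_nonneg_AE) auto

lemma avoid_antimono: "B \<subseteq> B' \<Longrightarrow> avoid f B' \<le> avoid f B"
  unfolding avoid_def by (intro exp_neg_antimono nn_integral_mono) (auto split: split_indicator)

lemma avoid_empty[simp]: "avoid f {} = 1" by (simp add: avoid_def)

lemma integrable_avoid:
  assumes "finite_measure M" "random_intensity M Y" "B \<in> sets borel"
  shows "integrable M (\<lambda>w. avoid (Y w) B)"
proof -
  interpret finite_measure M by fact
  show ?thesis using random_intensity_avoid[OF assms(2,3)] by (intro integrable_const_bound[of _ 1]) auto
qed

lemma random_intensity_shift_const:
  assumes "random_intensity P lam"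
  shows "random_intensity P (\<lambda>v t. lam v (t - b))"
proof -
  have [measurable]: "(\<lambda>(w, t). lam w t) \<in> borel_measurable (P \<Otimes>\<^sub>M borel)"
    using assms by (simp add: random_intensity_def)
  have "(\<lambda>p. (\<lambda>(w, t). lam w t) (fst p, snd p - b)) \<in> borel_measurable (P \<Otimes>\<^sub>M borel)" by measurable
  then show ?thesis using assms by (simp add: random_intensity_def split_beta')
qed

lemma void_prob_antimono:
  assumes "canonical_intensity P lam" "B \<in> sets borel" "B' \<in> sets borel" "B \<subseteq> B'"
  shows "void_prob P lam B' b \<le> void_prob P lam B b"
  unfolding void_prob_def using assms
  by (intro integral_mono integrable_avoid random_intensity_shift_const avoid_antimono)
     (auto simp: canonical_intensity_def prob_space.finite_measure)

lemma void_prob_empty: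
  assumes "canonical_intensity P lam"
  shows "void_prob P lam {} b = 1"
  using assms by (simp add: void_prob_def canonical_intensity_def prob_space.prob_space)

lemma catalog_subalgebras:
  assumes cat: "catalog Q \<gamma> P lam \<Gamma> a l x"
  defines "F \<equiv> vimage_algebra (space Q) \<Gamma> (configurations borel)"
    and "F2 n \<equiv> vimage_algebra (space Q) (\<lambda>w. (\<Gamma> w, l n w)) (configurations borel \<Otimes>\<^sub>M paths)"
  shows "finite_measure_subalgebra Q F" "finite_measure_subalgebra Q (F2 n)" "sets F \<subseteq> sets (F2 n)"
    "a n \<in> borel_measurable F" "a n \<in> borel_measurable Q" "x n \<in> measurable Q (configurations borel)"
    "random_intensity Q (l n)" "\<Gamma> \<in> measurable Q (configurations borel)"
proof -
  have Q: "prob_space Q" using cat by (simp add: catalog_def)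
  show G: "\<Gamma> \<in> measurable Q (configurations borel)"
    using cat by (simp add: catalog_def homogeneous_poisson_def poisson_process_def)
  show l: "random_intensity Q (l n)" using cat by (simp add: catalog_def Let_def)
  note [measurable] = G random_intensity_paths[OF l]
  have sF: "sets F \<subseteq> sets Q" unfolding F_def by (rule sets_image_in_sets) auto
  show F: "finite_measure_subalgebra Q F"
    using Q sF by (simp add: finite_measure_subalgebra_def finite_measure_subalgebra_axioms_def
      prob_space.finite_measure subalgebra_def F_def)
  have "sets (F2 n) \<subseteq> sets Q" unfolding F2_def by (rule sets_image_in_sets) auto
  then show "finite_measure_subalgebra Q (F2 n)"
    using Q by (simp add: finite_measure_subalgebra_def finite_measure_subalgebra_axioms_def
      prob_space.finite_measure subalgebra_def F2_def)
  show "sets F \<subseteq> sets (F2 n)"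
    unfolding F_def
  proof (rule sets_image_in_sets)
    have "(\<lambda>w. (\<Gamma> w, l n w)) \<in> measurable (F2 n) (configurations borel \<Otimes>\<^sub>M paths)"
      unfolding F2_def by (rule measurable_vimage_algebra1) (auto simp: space_pair_measure space_PiM)
    from measurable_compose[OF this measurable_fst] show "\<Gamma> \<in> measurable (F2 n) (configurations borel)" by simp
  qed (simp add: F2_def)
  show aF: "a n \<in> borel_measurable F" using cat by (simp add: catalog_def Let_def F_def)
  then show "a n \<in> borel_measurable Q"
    using sF by (intro measurable_from_subalg[OF _ aF]) (simp add: subalgebra_def F_def)
  show "x n \<in> measurable Q (configurations borel)" using cat by (simp add: catalog_def Let_def cond_poisson_def)
qed

lemma integral_density_indicator:
  fixes f :: "'a \<Rightarrow> real"
  assumes "A \<in> sets M" "f \<in> borel_measurable M"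
  shows "(\<integral>x. f x \<partial>density M (indicator A)) = (\<integral>x\<in>A. f x \<partial>M)"
  using integral_density[of f M "indicator A"] assms
  by (simp add: set_lebesgue_integral_def ennreal_indicator)

text \<open>
  The conditional expectation is tested on events \<open>A\<close> of the arrivals. The intensity \<open>l n\<close> under the
  restriction of \<open>Q\<close> to \<open>A\<close>, and the shifted canonical intensity under the product of this restriction
  with \<open>P\<close>, have the same law on \<open>paths\<close>; \<open>same_law_avoid\<close> passes from one void probability to the other.
\<close>

lemma catalog_void_prob:
  assumes cat: "catalog Q \<gamma> P lam \<Gamma> a l x" and can: "canonical_intensity P lam"
    and B[measurable]: "B \<in> sets borel" and Bfin: "emeasure lborel B < \<infinity>"
  defines "F \<equiv> vimage_algebra (space Q) \<Gamma> (configurations borel)"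
  shows "AE w in Q. cond_prob_given Q F {w \<in> space Q. x n w \<inter> B = {}} w = void_prob P lam B (a n w)"
proof -
  define F2 where "F2 = vimage_algebra (space Q) (\<lambda>w. (\<Gamma> w, l n w)) (configurations borel \<Otimes>\<^sub>M paths)"
  note sub = catalog_subalgebras(1)[OF cat, folded F_def] catalog_subalgebras(2,3)[OF cat, of n, folded F_def F2_def]
    catalog_subalgebras(4,5,6,7)[OF cat, of n, folded F_def] catalog_subalgebras(8)[OF cat]
  interpret Q: prob_space Q using cat by (simp add: catalog_def)
  interpret P: prob_space P using can by (simp add: canonical_intensity_def)
  interpret F: finite_measure_subalgebra Q F by (rule sub(1))
  interpret F2: finite_measure_subalgebra Q F2 by (rule sub(2))
  note [measurable] = sub(4-6) B
  have intI: "integrable Q (indicator S :: _ \<Rightarrow> real)" if "S \<in> sets Q" for S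
    using that by (intro Q.integrable_const_bound[of _ 1]) (auto split: split_indicator)
  have lamP: "random_intensity P lam" using can by (simp add: canonical_intensity_def)
  have [measurable]: "void_prob P lam B \<in> borel_measurable borel" by (rule void_prob_measurable[OF can B])
  define D where "D = {w \<in> space Q. x n w \<inter> B = {}}"
  have D[measurable]: "D \<in> sets Q" unfolding D_def by measurable
  \<comment> \<open>conditioning on the arrivals and the intensity first: a Cox process given its intensity is Poisson\<close>
  have cox: "AE w in Q. cond_prob_given Q F2 D w = avoid (l n w) B"
  proof -
    have cp: "cond_poisson Q F2 (l n) (x n)" using cat by (simp add: catalog_def Let_def F2_def)
    have dis: "disjoint_borel 1 (\<lambda>_. B)" by (simp add: disjoint_borel_def disjoint_family_on_def)
    have cD: "counts_event Q (x n) 1 (\<lambda>_. B) (\<lambda>_. 0) = D"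
      by (auto simp: counts_event_def D_def enat_0)
    have "AE w in Q. cond_prob_given Q F2 D w = poisson_prob (emeasure (density lborel (\<lambda>u. ennreal (l n w u))) B) 0"
      using cp[unfolded cond_poisson_def, THEN conjunct2, rule_format, of 1 "\<lambda>_. B" "\<lambda>_. 0", OF dis]
      by (simp add: cD[simplified])
    then show ?thesis using AE_space
    proof eventually_elim
      case (elim w)
      have [measurable]: "l n w \<in> borel_measurable borel" by (rule random_intensity_section[OF sub(7) elim(2)])
      show ?case using elim(1) by (simp add: emeasure_density avoid_def exp_neg_def)
    qed
  qed
  show ?thesis
    unfolding D_def[symmetric] cond_prob_given_def
  proof (rule F.real_cond_exp_charact)
    fix A assume A: "A \<in> sets F"
    have A2: "A \<in> sets F2" and AQ[measurable]: "A \<in> sets Q"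
      using A sub(3) F.subalg by (auto simp: subalgebra_def)
    have "(\<integral>w\<in>A. indicator D w \<partial>Q) = (\<integral>w\<in>A. real_cond_exp Q F2 (indicator D) w \<partial>Q)"
      using A2 D by (intro F2.real_cond_exp_intA intI) auto
    also have "\<dots> = (\<integral>w\<in>A. avoid (l n w) B \<partial>Q)"
      unfolding set_lebesgue_integral_def
      using random_intensity_avoid[OF sub(7) B] cox
      by (intro integral_cong_AE) (auto simp: cond_prob_given_def)
    also have "\<dots> = (\<integral>w. avoid (l n w) B \<partial>density Q (indicator A))"
      using random_intensity_avoid[OF sub(7) B]
      by (intro integral_density_indicator[symmetric]) auto
    also have "\<dots> = (\<integral>p. avoid ((\<lambda>(w, v) t. lam v (t - a n w)) p) B \<partial>(density Q (indicator A) \<Otimes>\<^sub>M P))"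
    proof (rule same_law_avoid[OF _ _ _ _ _ B Bfin])
      show f1: "finite_measure (density Q (indicator A))"
        by (intro finite_measureI) (simp add: emeasure_restricted)
      show "finite_measure (density Q (indicator A) \<Otimes>\<^sub>M P)"
        by (rule finite_measure_pair_measure[OF P.finite_measure_axioms f1])
      show l1: "random_intensity (density Q (indicator A)) (l n)"
        using sub(7) unfolding random_intensity_def
        by (simp add: measurable_cong_sets[OF sets_pair_measure_cong[OF sets_density refl] refl])
      show s1: "random_intensity (density Q (indicator A) \<Otimes>\<^sub>M P) (\<lambda>(w, v) t. lam v (t - a n w))"
        by (rule random_intensity_shift[OF lamP]) simp
      show "distr (density Q (indicator A)) paths (l n)
        = distr (density Q (indicator A) \<Otimes>\<^sub>M P) paths (\<lambda>(w, v) t. lam v (t - a n w))" (is "?L = ?R")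
      proof (rule measure_eqI)
        fix E assume "E \<in> sets ?L"
        then have E[measurable]: "E \<in> sets paths" by simp
        note [measurable] = random_intensity_paths[OF sub(7)] random_intensity_paths[OF s1]
        define p where "p b = measure P {v \<in> space P. (\<lambda>t. lam v (t - b)) \<in> E}" for b
        have "emeasure ?L E = emeasure (density Q (indicator A)) (l n -` E \<inter> space Q)"
          using random_intensity_paths[OF l1] by (subst emeasure_distr) auto
        also have "\<dots> = emeasure Q (A \<inter> (l n -` E \<inter> space Q))" by (simp add: emeasure_restricted)
        also have "\<dots> = ennreal (\<integral>w\<in>A. indicator {w\<in>space Q. l n w \<in> E} w \<partial>Q)"
        proof -
          have "(\<integral>w\<in>A. indicat_real {w\<in>space Q. l n w \<in> E} w \<partial>Q) = (\<integral>w. indicat_real (A \<inter> (l n -` E \<inter> space Q)) w \<partial>Q)"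
            unfolding set_lebesgue_integral_def by (intro Bochner_Integration.integral_cong) (auto split: split_indicator)
          moreover have "A \<inter> (l n -` E \<inter> space Q) \<inter> space Q = A \<inter> (l n -` E \<inter> space Q)" by auto
          ultimately show ?thesis by (simp add: Q.emeasure_eq_measure)
        qed
        also have "(\<integral>w\<in>A. indicator {w\<in>space Q. l n w \<in> E} w \<partial>Q)
          = (\<integral>w\<in>A. real_cond_exp Q F (indicator {w\<in>space Q. l n w \<in> E}) w \<partial>Q)"
          using A random_intensity_paths[OF sub(7)] E by (intro F.real_cond_exp_intA intI) (auto intro: measurable_sets_Collect)
        also have "\<dots> = (\<integral>w\<in>A. p (a n w) \<partial>Q)"
        proof -
          have AE: "AE w in Q. cond_prob_given Q F {w \<in> space Q. l n w \<in> E} w = p (a n w)"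
            using cat E by (simp add: catalog_def Let_def F_def p_def)
          have pm[measurable]: "(\<lambda>w. p (a n w)) \<in> borel_measurable Q"
          proof -
            have "random_intensity (Q \<Otimes>\<^sub>M P) (\<lambda>(w, v) t. lam v (t - a n w))"
              by (rule random_intensity_shift[OF lamP]) simp
            from random_intensity_paths[OF this]
            have m: "{z \<in> space (Q \<Otimes>\<^sub>M P). (\<lambda>t. lam (snd z) (t - a n (fst z))) \<in> E} \<in> sets (Q \<Otimes>\<^sub>M P)"
              by (auto simp: split_beta')
            have "(\<lambda>w. measure P (Pair w -` {z \<in> space (Q \<Otimes>\<^sub>M P). (\<lambda>t. lam (snd z) (t - a n (fst z))) \<in> E})) \<in> borel_measurable Q"
              unfolding measure_def using P.measurable_emeasure_Pair[OF m] by measurable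
            then show ?thesis
              by (rule measurable_cong[THEN iffD1, rotated]) (auto simp: p_def space_pair_measure intro!: arg_cong[of _ _ "measure P"])
          qed
          show ?thesis unfolding set_lebesgue_integral_def using AE
            by (intro integral_cong_AE) (auto simp: cond_prob_given_def)
        qed
        also have "ennreal \<dots> = (\<integral>\<^sup>+w. indicator A w * ennreal (p (a n w)) \<partial>Q)"
        proof -
          have "integrable Q (\<lambda>w. indicator A w * p (a n w))"
            by (rule Q.integrable_const_bound[of _ 1]) (auto simp: p_def split: split_indicator)
          then have "(\<integral>\<^sup>+w. ennreal (indicator A w * p (a n w)) \<partial>Q) = ennreal (\<integral>w. indicator A w * p (a n w) \<partial>Q)"
            by (rule nn_integral_eq_integral) (auto simp: p_def)
          moreover have "(\<integral>\<^sup>+w. ennreal (indicator A w * p (a n w)) \<partial>Q) = (\<integral>\<^sup>+w. indicator A w * ennreal (p (a n w)) \<partial>Q)"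
            by (intro nn_integral_cong) (auto split: split_indicator)
          ultimately show ?thesis by (simp add: set_lebesgue_integral_def)
        qed
        also have "\<dots> = (\<integral>\<^sup>+w. emeasure P (Pair w -` ((\<lambda>(w, v) t. lam v (t - a n w)) -` E \<inter> space (density Q (indicator A) \<Otimes>\<^sub>M P))) \<partial>density Q (indicator A))"
        proof -
          have S[measurable]: "(\<lambda>(w, v) t. lam v (t - a n w)) -` E \<inter> space (density Q (indicator A) \<Otimes>\<^sub>M P) \<in> sets (Q \<Otimes>\<^sub>M P)"
            using measurable_sets[OF random_intensity_paths[OF s1] E]
            by (simp add: sets_pair_measure_cong[OF sets_density refl])
          have "emeasure P (Pair w -` ((\<lambda>(w, v) t. lam v (t - a n w)) -` E \<inter> space (density Q (indicator A) \<Otimes>\<^sub>M P))) = ennreal (p (a n w))"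
            if "w \<in> space Q" for w
          proof -
            have "Pair w -` ((\<lambda>(w, v) t. lam v (t - a n w)) -` E \<inter> space (density Q (indicator A) \<Otimes>\<^sub>M P))
                = {v \<in> space P. (\<lambda>t. lam v (t - a n w)) \<in> E}"
              using that by (auto simp: space_pair_measure)
            then show ?thesis unfolding p_def P.emeasure_eq_measure by simp
          qed
          then show ?thesis
            using P.measurable_emeasure_Pair[OF S]
            by (subst nn_integral_density) (auto intro!: nn_integral_cong)
        qed
        also have "\<dots> = emeasure ?R E"
          unfolding emeasure_distr[OF random_intensity_paths[OF s1] E]
          by (rule P.emeasure_pair_measure_alt[symmetric], rule measurable_sets[OF random_intensity_paths[OF s1] E])
        finally show "emeasure ?L E = emeasure ?R E" .
      qed simp
    qed
    also have "\<dots> = (\<integral>w. (\<integral>v. avoid (\<lambda>t. lam v (t - a n w)) B \<partial>P) \<partial>density Q (indicator A))"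
    proof -
      have f1: "finite_measure (density Q (indicator A))"
        by (intro finite_measureI) (simp add: emeasure_restricted)
      then interpret D: finite_measure "density Q (indicator A)" .
      interpret DP: pair_sigma_finite "density Q (indicator A)" P ..
      have "random_intensity (density Q (indicator A) \<Otimes>\<^sub>M P) (\<lambda>(w, v) t. lam v (t - a n w))"
        by (rule random_intensity_shift[OF lamP]) simp
      from integrable_avoid[OF finite_measure_pair_measure[OF P.finite_measure_axioms f1] this B]
      show ?thesis by (subst DP.integral_fst'[symmetric]) (auto simp: split_beta')
    qed
    also have "\<dots> = (\<integral>w\<in>A. void_prob P lam B (a n w) \<partial>Q)"
      unfolding void_prob_def[symmetric]
      by (intro integral_density_indicator) auto
    finally show "(\<integral>w\<in>A. indicator D w \<partial>Q) = (\<integral>w\<in>A. void_prob P lam B (a n w) \<partial>Q)" .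
  next
    have "void_prob P lam B b \<le> 1" for b
      using void_prob_antimono[OF can _ B, of "{}" b] by (simp add: void_prob_empty[OF can])
    then show "integrable Q (\<lambda>w. void_prob P lam B (a n w))"
      by (intro Q.integrable_const_bound[of _ 1]) (auto simp: void_prob_nonneg)
    show "(\<lambda>w. void_prob P lam B (a n w)) \<in> borel_measurable F" by measurable
    show "integrable Q (indicator D :: _ \<Rightarrow> real)" by (rule intI[OF D])
  qed
qed

section \<open>The Laplace functional of a Poisson process\<close>

lemma suminf_exp_neg_limit:
  assumes g: "\<And>n. 0 \<le> g n"
  shows "(\<lambda>J. exp (- (\<Sum>n<J. g n))) \<longlonglongrightarrow> exp_neg (\<Sum>n. ennreal (g n))"
proof -
  have "(\<lambda>J. \<Sum>n<J. ennreal (g n)) \<longlonglongrightarrow> (\<Sum>n. ennreal (g n))"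
    by (rule summable_LIMSEQ) simp
  then have "(\<lambda>J. exp_neg (\<Sum>n<J. ennreal (g n))) \<longlonglongrightarrow> exp_neg (\<Sum>n. ennreal (g n))"
    by (rule tendsto_exp_neg)
  moreover have "exp_neg (\<Sum>n<J. ennreal (g n)) = exp (- (\<Sum>n<J. g n))" for J
    using g by (simp add: sum_ennreal exp_neg_ennreal sum_nonneg)
  ultimately show ?thesis by simp
qed

text \<open>
  An infinite count contributes nothing to either side; this lets generating functions of counts be
  expanded before the counts are known to be finite.
\<close>

lemma exp_neg_enat_series:
  assumes "0 < v"
  shows "ennreal (exp_neg (ennreal v * ennreal_of_enat K)) = (\<Sum>m. ennreal (exp (- v * real m)) * indicator {w. w = enat m} K)"
proof (cases K)
  case (enat k)
  have "(\<Sum>m. ennreal (exp (- v * real m)) * indicator {w. w = enat m} K) = ennreal (exp (- v * real k))"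
    using suminf_finite[of "{k}" "\<lambda>m. ennreal (exp (- v * real m)) * indicator {w. w = enat m} K"] enat by auto
  moreover have "ennreal v * ennreal_of_enat K = ennreal (v * real k)"
    using assms enat by (simp add: ennreal_mult ennreal_of_nat_eq_real_of_nat)
  ultimately show ?thesis using assms by (simp add: exp_neg_ennreal)
next
  case infinity
  then show ?thesis using assms by (simp add: ennreal_mult_top)
qed

lemma poisson_pgf_sums:
  fixes \<mu> z :: real
  shows "(\<lambda>m. z ^ m * (\<mu> ^ m / fact m * exp (- \<mu>))) sums exp (- \<mu> * (1 - z))"
proof -
  have "(\<lambda>m. exp (- \<mu>) * ((\<mu> * z) ^ m /\<^sub>R fact m)) sums (exp (- \<mu>) * exp (\<mu> * z))"
    by (intro sums_mult exp_converges)
  then show ?thesis by (simp add: power_mult_distrib field_simps flip: exp_add)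
qed

text \<open>
  At stage \<open>j\<close> the counts in \<open>B 0, ..., B (j - 1)\<close> are integrated out and the others are still pinned to
  the values \<open>n\<close>. Stage 0 is the definition of a Poisson process, and releasing one more count sums a
  Poisson generating function. Stage \<open>k\<close> is the joint Laplace transform of the counts.
\<close>

lemma poisson_process_laplace_step:
  assumes Q: "prob_space Q" and X: "poisson_process Q \<nu> X"
    and B: "disjoint_borel k B" and fin: "\<And>i. i < k \<Longrightarrow> emeasure \<nu> (B i) = ennreal (\<mu> i)" "\<And>i. 0 \<le> \<mu> i"
    and v: "\<And>i. i < k \<Longrightarrow> 0 < v i" and j: "j \<le> k"
  shows "(\<integral>\<^sup>+w. ennreal (\<Prod>i<j. exp_neg (ennreal (v i) * ennreal_of_enat (ecard (X w \<inter> B i))))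
            * indicator {w\<in>space Q. \<forall>i\<in>{j..<k}. ecard (X w \<inter> B i) = enat (n i)} w \<partial>Q)
       = ennreal ((\<Prod>i<j. exp (- \<mu> i * (1 - exp (- v i)))) * (\<Prod>i\<in>{j..<k}. \<mu> i ^ n i / fact (n i) * exp (- \<mu> i)))"
  using j
proof (induction j arbitrary: n)
  case 0
  interpret Q: prob_space Q by fact
  have [measurable]: "X \<in> measurable Q (configurations borel)" using X by (simp add: poisson_process_def)
  have Bm[measurable]: "B i \<in> sets borel" if "i < k" for i using B that by (simp add: disjoint_borel_def)
  have "{w\<in>space Q. \<forall>i\<in>{0..<k}. ecard (X w \<inter> B i) = enat (n i)} = counts_event Q X k B n"
    by (auto simp: counts_event_def)
  moreover have "counts_event Q X k B n \<in> sets Q"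
    unfolding counts_event_def by measurable
  moreover have "measure Q (counts_event Q X k B n) = (\<Prod>i<k. \<mu> i ^ n i / fact (n i) * exp (- \<mu> i))"
    using X B fin by (simp add: poisson_process_def poisson_prob_def)
  ultimately show ?case by (simp add: Q.emeasure_eq_measure atLeast0LessThan)
next
  case (Suc j)
  interpret Q: prob_space Q by fact
  have [measurable]: "X \<in> measurable Q (configurations borel)" using X by (simp add: poisson_process_def)
  have Bm[measurable]: "B i \<in> sets borel" if "i < k" for i using B that by (simp add: disjoint_borel_def)
  have jk: "j < k" using Suc.prems by simp
  have vj: "0 < v j" using v[OF jk] .
  define p where "p m = (\<mu> j) ^ m / fact m * exp (- \<mu> j)" for m
  define L where "L w = ennreal (\<Prod>i<j. exp_neg (ennreal (v i) * ennreal_of_enat (ecard (X w \<inter> B i))))" for w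
  define S where "S m = {w\<in>space Q. \<forall>i\<in>{j..<k}. ecard (X w \<inter> B i) = enat ((n(j := m)) i)}" for m
  define c where "c = (\<Prod>i<j. exp (- \<mu> i * (1 - exp (- v i)))) * (\<Prod>i\<in>{Suc j..<k}. \<mu> i ^ n i / fact (n i) * exp (- \<mu> i))"
  have Em[measurable]: "(\<lambda>w. ecard (X w \<inter> B i)) \<in> measurable Q (count_space UNIV)" if "i < k" for i
    using that by measurable
  have Lm[measurable]: "L \<in> borel_measurable Q"
    unfolding L_def using jk
    by (intro measurable_compose[OF _ measurable_ennreal] borel_measurable_prod
        measurable_compose[OF _ exp_neg_measurable] borel_measurable_times_ennreal measurable_compose[OF Em]) auto
  have Sm[measurable]: "S m \<in> sets Q" for m unfolding S_def by measurable
  have c0: "0 \<le> c" unfolding c_def using fin by (intro mult_nonneg_nonneg prod_nonneg) auto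
  have "(\<integral>\<^sup>+w. ennreal (\<Prod>i<Suc j. exp_neg (ennreal (v i) * ennreal_of_enat (ecard (X w \<inter> B i))))
            * indicator {w\<in>space Q. \<forall>i\<in>{Suc j..<k}. ecard (X w \<inter> B i) = enat (n i)} w \<partial>Q)
      = (\<integral>\<^sup>+w. (\<Sum>m. ennreal (exp (- v j * real m)) * (L w * indicator (S m) w)) \<partial>Q)"
  proof (rule nn_integral_cong)
    fix w assume w: "w \<in> space Q"
    have "ennreal (\<Prod>i<Suc j. exp_neg (ennreal (v i) * ennreal_of_enat (ecard (X w \<inter> B i))))
        * indicator {w\<in>space Q. \<forall>i\<in>{Suc j..<k}. ecard (X w \<inter> B i) = enat (n i)} w
      = ennreal (exp_neg (ennreal (v j) * ennreal_of_enat (ecard (X w \<inter> B j))))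
        * (L w * indicator {w\<in>space Q. \<forall>i\<in>{Suc j..<k}. ecard (X w \<inter> B i) = enat (n i)} w)"
      by (simp add: L_def ennreal_mult prod_nonneg mult_ac)
    also have "\<dots> = (\<Sum>m. ennreal (exp (- v j * real m)) * indicator {w. w = enat m} (ecard (X w \<inter> B j)) *
         (L w * indicator {w\<in>space Q. \<forall>i\<in>{Suc j..<k}. ecard (X w \<inter> B i) = enat (n i)} w))"
      unfolding exp_neg_enat_series[OF vj] by simp
    also have "\<dots> = (\<Sum>m. ennreal (exp (- v j * real m)) * (L w * indicator (S m) w))"
    proof (rule suminf_cong)
      fix m
      have "{j..<k} = insert j {Suc j..<k}" using jk by auto
      then have "indicator {w. w = enat m} (ecard (X w \<inter> B j)) *
          indicator {w\<in>space Q. \<forall>i\<in>{Suc j..<k}. ecard (X w \<inter> B i) = enat (n i)} w = (indicator (S m) w :: ennreal)"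
        using w by (auto simp: S_def split: split_indicator)
      then show "ennreal (exp (- v j * real m)) * indicator {w. w = enat m} (ecard (X w \<inter> B j)) *
         (L w * indicator {w\<in>space Q. \<forall>i\<in>{Suc j..<k}. ecard (X w \<inter> B i) = enat (n i)} w)
        = ennreal (exp (- v j * real m)) * (L w * indicator (S m) w)"
        by (simp add: mult_ac)
    qed
    finally show "ennreal (\<Prod>i<Suc j. exp_neg (ennreal (v i) * ennreal_of_enat (ecard (X w \<inter> B i))))
            * indicator {w\<in>space Q. \<forall>i\<in>{Suc j..<k}. ecard (X w \<inter> B i) = enat (n i)} w
       = (\<Sum>m. ennreal (exp (- v j * real m)) * (L w * indicator (S m) w))" .
  qed
  also have "\<dots> = (\<Sum>m. ennreal (exp (- v j * real m)) * (\<integral>\<^sup>+w. L w * indicator (S m) w \<partial>Q))"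
    by (subst nn_integral_suminf) (auto simp: nn_integral_cmult)
  also have "\<dots> = (\<Sum>m. ennreal (c * (exp (- v j) ^ m * p m)))"
  proof (rule suminf_cong)
    fix m
    have e: "{j..<k} = insert j {Suc j..<k}" using jk by auto
    have "(\<Prod>i\<in>{Suc j..<k}. \<mu> i ^ (n(j := m)) i / fact ((n(j := m)) i) * exp (- \<mu> i))
      = (\<Prod>i\<in>{Suc j..<k}. \<mu> i ^ n i / fact (n i) * exp (- \<mu> i))"
      by (intro prod.cong) auto
    then have "(\<integral>\<^sup>+w. L w * indicator (S m) w \<partial>Q) = ennreal (c * p m)"
      unfolding L_def S_def Suc.IH[OF less_imp_le[OF jk]] unfolding e c_def p_def by (simp add: mult_ac)
    then show "ennreal (exp (- v j * real m)) * (\<integral>\<^sup>+w. L w * indicator (S m) w \<partial>Q) = ennreal (c * (exp (- v j) ^ m * p m))"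
      using c0 fin(2) by (simp add: ennreal_mult'[symmetric] p_def mult_ac flip: exp_of_nat_mult)
  qed
  also have "\<dots> = ennreal (c * exp (- \<mu> j * (1 - exp (- v j))))"
    by (rule suminf_ennreal_eq[OF _ sums_mult[OF poisson_pgf_sums[of "exp (- v j)" "\<mu> j", folded p_def]]])
       (use c0 fin(2) in \<open>simp add: p_def\<close>)
  finally show ?case by (simp add: c_def mult_ac)
qed

lemma suminf_simple_count:
  fixes h :: "real \<Rightarrow> ennreal"
  assumes bij: "bij_betw a UNIV X" and fin: "finite (range h)"
  shows "(\<Sum>n. h (a n)) = (\<Sum>y\<in>range h - {0}. y * ennreal_of_enat (ecard (X \<inter> h -` {y})))"
proof -
  have c: "ecard (X \<inter> h -` {y}) = ecard {n. h (a n) = y}" for y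
  proof -
    have "X \<inter> h -` {y} = a ` {n. h (a n) = y}" using bij by (auto simp: bij_betw_def)
    moreover have "inj_on a {n. h (a n) = y}" using bij by (auto simp: bij_betw_def intro: inj_on_subset)
    ultimately show ?thesis by (simp add: ecard_inj_image)
  qed
  have eq: "h (a n) = (\<Sum>y\<in>range h - {0}. y * indicator {n. h (a n) = y} n)" for n
  proof (cases "h (a n) = 0")
    case True then show ?thesis by (auto intro!: sum.neutral[symmetric] split: split_indicator)
  next
    case False
    then have "(\<Sum>y\<in>range h - {0}. y * indicator {n. h (a n) = y} n) = (\<Sum>y\<in>{h (a n)}. y * indicator {n. h (a n) = y} n)"
      using fin by (intro sum.mono_neutral_right) (auto split: split_indicator)
    then show ?thesis by simp
  qed
  have "(\<Sum>n. h (a n)) = (\<Sum>n. \<Sum>y\<in>range h - {0}. y * indicator {n. h (a n) = y} n)"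
    by (rule suminf_cong) (rule eq)
  also have "\<dots> = (\<Sum>y\<in>range h - {0}. y * (\<Sum>n. indicator {n. h (a n) = y} n))"
    by (subst suminf_sum) simp_all
  finally show ?thesis by (simp add: ennreal_of_enat_ecard c)
qed

lemma exp_neg_sum: "finite I \<Longrightarrow> exp_neg (\<Sum>i\<in>I. g i) = (\<Prod>i\<in>I. exp_neg (g i))"
  by (induction I rule: finite_induct) (simp_all add: exp_neg_add)

text \<open>
  The level sets of \<open>h\<close> at its nonzero values are disjoint and of finite measure, so the sum of \<open>h\<close> over
  the points is a combination of independent Poisson counts and its Laplace transform factorises.
\<close>

lemma poisson_laplace_simple:
  assumes Q: "prob_space Q" and X: "homogeneous_poisson Q \<gamma> X" and \<gamma>: "0 < \<gamma>"
    and bij: "\<And>w. w \<in> space Q \<Longrightarrow> bij_betw (\<lambda>n. a n w) UNIV (X w)"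
    and h[measurable]: "h \<in> borel_measurable borel" and fin: "finite (range h)" and top: "\<And>b. h b < \<top>"
    and supp: "\<And>b. r < \<bar>b\<bar> \<Longrightarrow> h b = 0"
  shows "(\<integral>w. exp_neg (\<Sum>n. h (a n w)) \<partial>Q) = exp_neg (ennreal \<gamma> * (\<integral>\<^sup>+b. ennreal (1 - exp_neg (h b)) \<partial>lborel))"
proof -
  interpret Q: prob_space Q by fact
  define V where "V = range h - {0}"
  have fV: "finite V" using fin by (simp add: V_def)
  obtain y where y: "bij_betw y {..<card V} V"
    using ex_bij_betw_nat_finite[OF fV] by (auto simp: atLeast0LessThan)
  define k where "k = card V"
  define B where "B i = h -` {y i}" for i
  define \<mu> where "\<mu> i = (if i < k then \<gamma> * measure lborel (B i) else 0)" for i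
  define v where "v i = enn2real (y i)" for i
  have yV: "y i \<in> V" if "i < k" for i using y that by (auto simp: bij_betw_def k_def)
  have ytop: "y i < \<top>" "y i \<noteq> 0" if "i < k" for i using yV[OF that] top by (auto simp: V_def)
  have yv: "y i = ennreal (v i)" "0 < v i" if "i < k" for i
    using ytop[OF that] by (auto simp: v_def enn2real_positive_iff zero_less_iff_neq_zero)
  have Bm[measurable]: "B i \<in> sets borel" for i
    using measurable_sets[OF h, of "{y i}"] by (simp add: B_def)
  have Bfin: "emeasure lborel (B i) < \<infinity>" if "i < k" for i
  proof -
    have "B i \<subseteq> {-r..r}"
    proof
      fix b assume "b \<in> B i"
      then have "\<not> r < \<bar>b\<bar>" using supp[of b] ytop(2)[OF that] by (auto simp: B_def)
      then show "b \<in> {-r..r}" by auto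
    qed
    then have "emeasure lborel (B i) \<le> emeasure lborel {-r..r}" by (intro emeasure_mono) auto
    also have "\<dots> < \<infinity>" by (simp add: emeasure_lborel_Icc_eq)
    finally show ?thesis .
  qed
  have dis: "disjoint_borel k B"
    using y Bm by (auto simp: disjoint_borel_def disjoint_family_on_def B_def bij_betw_def inj_on_def k_def)
  have \<mu>: "emeasure (density lborel (\<lambda>_. ennreal \<gamma>)) (B i) = ennreal (\<mu> i)" if "i < k" for i
    using Bfin[OF that] \<gamma> that by (simp add: emeasure_density_const \<mu>_def emeasure_eq_ennreal_measure ennreal_mult')
  have \<mu>0: "0 \<le> \<mu> i" for i using \<gamma> by (simp add: \<mu>_def)
  have Xp: "poisson_process Q (density lborel (\<lambda>_. ennreal \<gamma>)) X" using X by (simp add: homogeneous_poisson_def)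
  have [measurable]: "X \<in> measurable Q (configurations borel)" using Xp by (simp add: poisson_process_def)
  have sum: "exp_neg (\<Sum>n. h (a n w)) = (\<Prod>i<k. exp_neg (ennreal (v i) * ennreal_of_enat (ecard (X w \<inter> B i))))"
    if "w \<in> space Q" for w
  proof -
    have "(\<Sum>n. h (a n w)) = (\<Sum>y\<in>V. y * ennreal_of_enat (ecard (X w \<inter> h -` {y})))"
      unfolding V_def by (rule suminf_simple_count[OF bij[OF that] fin])
    also have "\<dots> = (\<Sum>i<k. y i * ennreal_of_enat (ecard (X w \<inter> B i)))"
      using sum.reindex_bij_betw[OF y, of "\<lambda>y. y * ennreal_of_enat (ecard (X w \<inter> h -` {y}))"] by (simp add: B_def k_def)
    also have "\<dots> = (\<Sum>i<k. ennreal (v i) * ennreal_of_enat (ecard (X w \<inter> B i)))"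
      using yv by (intro sum.cong) auto
    finally show ?thesis by (simp add: exp_neg_sum)
  qed
  have "ennreal (\<integral>w. exp_neg (\<Sum>n. h (a n w)) \<partial>Q) = ennreal (\<integral>w. (\<Prod>i<k. exp_neg (ennreal (v i) * ennreal_of_enat (ecard (X w \<inter> B i)))) \<partial>Q)"
    using sum by (intro arg_cong[of _ _ ennreal] Bochner_Integration.integral_cong) auto
  also have "\<dots> = (\<integral>\<^sup>+w. ennreal (\<Prod>i<k. exp_neg (ennreal (v i) * ennreal_of_enat (ecard (X w \<inter> B i)))) \<partial>Q)"
    by (intro nn_integral_eq_integral[symmetric] Q.integrable_const_bound[of _ 1])
       (auto simp: prod_nonneg intro!: prod_le_1)
  also have "\<dots> = ennreal (\<Prod>i<k. exp (- \<mu> i * (1 - exp (- v i))))"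
  proof -
    have e: "{w \<in> space Q. \<forall>i\<in>{k..<k}. ecard (X w \<inter> B i) = enat 0} = space Q" by auto
    have "(\<integral>\<^sup>+w. ennreal (\<Prod>i<k. exp_neg (ennreal (v i) * ennreal_of_enat (ecard (X w \<inter> B i)))) \<partial>Q)
      = (\<integral>\<^sup>+w. ennreal (\<Prod>i<k. exp_neg (ennreal (v i) * ennreal_of_enat (ecard (X w \<inter> B i)))) *
          indicator {w \<in> space Q. \<forall>i\<in>{k..<k}. ecard (X w \<inter> B i) = enat 0} w \<partial>Q)"
      unfolding e by (intro nn_integral_cong) auto
    also have "\<dots> = ennreal (\<Prod>i<k. exp (- \<mu> i * (1 - exp (- v i))))"
      using poisson_process_laplace_step[OF Q Xp dis \<mu> \<mu>0, of v k "\<lambda>_. 0"] yv(2) by simp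
    finally show ?thesis .
  qed
  finally have L: "(\<integral>w. exp_neg (\<Sum>n. h (a n w)) \<partial>Q) = (\<Prod>i<k. exp (- \<mu> i * (1 - exp (- v i))))"
    by (simp add: prod_nonneg integral_nonneg_AE)
  have nn: "0 \<le> \<mu> i * (1 - exp (- v i))" if "i < k" for i
    using \<mu>0[of i] yv(2)[OF that] by (intro mult_nonneg_nonneg) auto
  have "(\<integral>\<^sup>+b. ennreal (1 - exp_neg (h b)) \<partial>lborel) = (\<integral>\<^sup>+b. (\<Sum>i<k. ennreal (1 - exp (- v i)) * indicator (B i) b) \<partial>lborel)"
  proof (rule nn_integral_cong)
    fix b
    show "ennreal (1 - exp_neg (h b)) = (\<Sum>i<k. ennreal (1 - exp (- v i)) * indicator (B i) b)"
    proof (cases "h b = 0")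
      case True
      then have "(\<Sum>i<k. ennreal (1 - exp (- v i)) * indicator (B i) b) = 0"
        using ytop(2) by (intro sum.neutral) (auto simp: B_def split: split_indicator)
      with True show ?thesis by simp
    next
      case False
      then have "h b \<in> y ` {..<k}" using y by (simp add: bij_betw_def V_def k_def)
      then obtain i where i: "i < k" "h b = y i" by auto
      have inj: "inj_on y {..<k}" using y by (simp add: bij_betw_def k_def)
      have "(\<Sum>j<k. ennreal (1 - exp (- v j)) * indicator (B j) b) = (\<Sum>j\<in>{i}. ennreal (1 - exp (- v j)) * indicator (B j) b)"
      proof (rule sum.mono_neutral_right)
        show "\<forall>j\<in>{..<k} - {i}. ennreal (1 - exp (- v j)) * indicator (B j) b = 0"
          using i inj_onD[OF inj] by (auto simp: B_def split: split_indicator)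
      qed (use i in auto)
      then show ?thesis using i yv[OF i(1)] by (simp add: B_def exp_neg_ennreal)
    qed
  qed
  also have "\<dots> = (\<Sum>i<k. ennreal (1 - exp (- v i)) * emeasure lborel (B i))"
    by (subst nn_integral_sum) (simp_all add: nn_integral_cmult_indicator)
  also have "ennreal \<gamma> * \<dots> = ennreal (\<Sum>i<k. \<mu> i * (1 - exp (- v i)))"
  proof -
    have "(\<Sum>i<k. ennreal (\<mu> i * (1 - exp (- v i)))) = ennreal (\<Sum>i<k. \<mu> i * (1 - exp (- v i)))"
      by (rule sum_ennreal) (rule nn, simp)
    moreover
    have "ennreal \<gamma> * (ennreal (1 - exp (- v i)) * emeasure lborel (B i)) = ennreal (\<mu> i * (1 - exp (- v i)))" if "i < k" for i
      using that Bfin[OF that] \<gamma> yv(2)[OF that]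
      by (simp add: \<mu>_def emeasure_eq_ennreal_measure ennreal_mult'[symmetric] mult_ac)
    ultimately show ?thesis by (simp add: sum_distrib_left)
  qed
  finally have "exp_neg (ennreal \<gamma> * (\<integral>\<^sup>+b. ennreal (1 - exp_neg (h b)) \<partial>lborel)) = exp (- (\<Sum>i<k. \<mu> i * (1 - exp (- v i))))"
    using sum_nonneg[of "{..<k}" "\<lambda>i. \<mu> i * (1 - exp (- v i))"] nn by (simp add: exp_neg_ennreal)
  also have "\<dots> = (\<Prod>i<k. exp (- \<mu> i * (1 - exp (- v i))))"
    by (subst sum_negf[symmetric], subst exp_sum) simp_all
  finally show ?thesis by (simp add: L)
qed

text \<open>
  The general case follows from simple functions of bounded support by monotone convergence.
\<close>

lemma poisson_laplace:
  assumes Q: "prob_space Q" and X: "homogeneous_poisson Q \<gamma> X" and \<gamma>: "0 < \<gamma>"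
    and bij: "\<And>w. w \<in> space Q \<Longrightarrow> bij_betw (\<lambda>n. a n w) UNIV (X w)"
    and a[measurable]: "\<And>n. a n \<in> borel_measurable Q"
    and f[measurable]: "f \<in> borel_measurable borel"
  shows "(\<integral>w. exp_neg (\<Sum>n. f (a n w)) \<partial>Q) = exp_neg (ennreal \<gamma> * (\<integral>\<^sup>+b. ennreal (1 - exp_neg (f b)) \<partial>lborel))"
proof -
  interpret Q: prob_space Q by fact
  obtain s where s: "\<And>i. simple_function borel (s i)" "incseq s" "\<And>i b. s i b < \<top>" "\<And>b. (SUP i. s i b) = f b"
    by (rule borel_measurable_implies_simple_function_sequence'[OF f]) blast
  define h where "h i b = s i b * indicator {- real i..real i} b" for i b
  have sm[measurable]: "s i \<in> borel_measurable borel" for i using borel_measurable_simple_function[OF s(1)] .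
  have hm[measurable]: "h i \<in> borel_measurable borel" for i unfolding h_def by measurable
  have hs: "incseq h"
    using s(2) by (auto simp: incseq_def h_def le_fun_def split: split_indicator)
  have h_lim: "(\<lambda>i. h i b) \<longlonglongrightarrow> f b" for b
  proof -
    have "(\<lambda>i. s i b) \<longlonglongrightarrow> f b"
      unfolding s(4)[symmetric] using s(2) by (intro LIMSEQ_SUP) (auto simp: incseq_def le_fun_def)
    moreover have "\<forall>\<^sub>F i in sequentially. s i b = h i b"
    proof (rule eventually_sequentiallyI[of "nat \<lceil>\<bar>b\<bar>\<rceil>"])
      fix i assume "nat \<lceil>\<bar>b\<bar>\<rceil> \<le> i"
      then have "\<bar>b\<bar> \<le> real i" by linarith
      then have "b \<in> {- real i..real i}" by auto
      then show "s i b = h i b" by (simp add: h_def)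
    qed
    ultimately show ?thesis by (simp add: tendsto_cong)
  qed
  have lap: "(\<integral>w. exp_neg (\<Sum>n. h i (a n w)) \<partial>Q) = exp_neg (ennreal \<gamma> * (\<integral>\<^sup>+b. ennreal (1 - exp_neg (h i b)) \<partial>lborel))" for i
  proof (rule poisson_laplace_simple[OF Q X \<gamma> bij hm, of _ "real i"])
    have "range (h i) \<subseteq> insert 0 (range (s i))" by (auto simp: h_def split: split_indicator)
    moreover have "finite (range (s i))" using s(1)[of i] by (simp add: simple_function_def)
    ultimately show "finite (range (h i))" by (meson finite.insertI finite_subset)
    show "h i b < \<top>" for b using s(3)[of i b] by (simp add: h_def split: split_indicator)
    show "h i b = 0" if "real i < \<bar>b\<bar>" for b using that by (auto simp: h_def split: split_indicator)
  qed
  have "(\<lambda>i. \<integral>w. exp_neg (\<Sum>n. h i (a n w)) \<partial>Q) \<longlonglongrightarrow> (\<integral>w. exp_neg (\<Sum>n. f (a n w)) \<partial>Q)"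
  proof (rule integral_dominated_convergence[where w="\<lambda>_. 1"])
    show "AE w in Q. (\<lambda>i. exp_neg (\<Sum>n. h i (a n w))) \<longlonglongrightarrow> exp_neg (\<Sum>n. f (a n w))"
    proof (intro AE_I2 tendsto_exp_neg)
      fix w
      show "(\<lambda>i. \<Sum>n. h i (a n w)) \<longlonglongrightarrow> (\<Sum>n. f (a n w))"
        unfolding nn_integral_count_space_nat[symmetric]
        using hs h_lim by (intro nn_integral_LIMSEQ) (auto simp: incseq_def le_fun_def)
    qed
  qed auto
  moreover have "(\<lambda>i. exp_neg (ennreal \<gamma> * (\<integral>\<^sup>+b. ennreal (1 - exp_neg (h i b)) \<partial>lborel)))
      \<longlonglongrightarrow> exp_neg (ennreal \<gamma> * (\<integral>\<^sup>+b. ennreal (1 - exp_neg (f b)) \<partial>lborel))"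
  proof (intro tendsto_exp_neg ennreal_tendsto_cmult nn_integral_LIMSEQ)
    show "incseq (\<lambda>i b. ennreal (1 - exp_neg (h i b)))"
      using hs by (auto simp: incseq_def le_fun_def intro!: ennreal_leI diff_left_mono exp_neg_antimono)
    show "(\<lambda>i. ennreal (1 - exp_neg (h i b))) \<longlonglongrightarrow> ennreal (1 - exp_neg (f b))" for b
      by (intro tendsto_ennrealI tendsto_intros tendsto_exp_neg h_lim)
  qed auto
  ultimately show ?thesis unfolding lap by (rule LIMSEQ_unique)
qed

section \<open>Poisson laws by generating functions, and thinning\<close>

text \<open>
  Once the coefficients below \<open>n\<close> agree, dividing the difference by \<open>z ^ n\<close> and letting \<open>z\<close> tend to 0 from
  the right isolates the \<open>n\<close>-th one. Values on \<open>(0, 1)\<close> are all that generating functions provide.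
\<close>

lemma power_series_coeffs_unique:
  fixes p r :: "nat \<Rightarrow> real"
  assumes p: "\<And>z. 0 < z \<Longrightarrow> z < 1 \<Longrightarrow> (\<lambda>n. z ^ n * p n) sums f z"
    and r: "\<And>z. 0 < z \<Longrightarrow> z < 1 \<Longrightarrow> (\<lambda>n. z ^ n * r n) sums f z"
  shows "p n = r n"
proof (induction n rule: less_induct)
  case (less n)
  define c where "c n = p n - r n" for n
  have c: "(\<lambda>n. c n * z ^ n) sums 0" if "0 < z" "z < 1" for z
    using sums_diff[OF p[OF that] r[OF that]] by (simp add: c_def algebra_simps)
  have sh: "(\<lambda>m. c (m + n) * z ^ m) sums 0" if z: "0 < z" "z < 1" for z
  proof -
    have "(\<Sum>i<n. c i * z ^ i) = 0" using less by (intro sum.neutral) (auto simp: c_def)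
    then have "(\<lambda>m. c (m + n) * z ^ (m + n)) sums 0" using c[OF z] sums_iff_shift[of "\<lambda>i. c i * z ^ i" n 0] by simp
    then have "(\<lambda>m. inverse (z ^ n) * (c (m + n) * z ^ (m + n))) sums (inverse (z ^ n) * 0)" by (rule sums_mult)
    moreover have "inverse (z ^ n) * (c (m + n) * z ^ (m + n)) = c (m + n) * z ^ m" for m
      using z(1) by (simp add: power_add field_simps)
    ultimately show ?thesis by simp
  qed
  have "((\<lambda>x. \<Sum>m. c (m + n) * x ^ m) \<longlongrightarrow> c (0 + n)) (at 0)"
  proof (rule powser_limit_0[where s=1])
    fix x :: real assume x: "norm x < 1"
    define z where "z = (\<bar>x\<bar> + 1) / 2"
    have z: "0 < z" "z < 1" "\<bar>x\<bar> < z" using x by (auto simp: z_def)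
    show "(\<lambda>m. c (m + n) * x ^ m) sums (\<Sum>m. c (m + n) * x ^ m)"
      using powser_inside[OF sums_summable[OF sh[OF z(1,2)]], of x] z by (auto intro: summable_sums)
  qed simp
  then have "((\<lambda>x. \<Sum>m. c (m + n) * x ^ m) \<longlongrightarrow> c n) (at_right 0)"
    by (simp add: filterlim_at_split)
  moreover have "((\<lambda>x. \<Sum>m. c (m + n) * x ^ m) \<longlongrightarrow> 0) (at_right 0)"
  proof (rule tendsto_eventually)
    show "\<forall>\<^sub>F x in at_right 0. (\<Sum>m. c (m + n) * x ^ m) = 0"
      unfolding eventually_at_right_field using sh by (intro exI[of _ 1]) (auto simp: sums_iff)
  qed
  ultimately have "c n = 0" by (intro tendsto_unique[OF _ _ _]) auto
  then show ?case by (simp add: c_def)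
qed

text \<open>
  \<open>exp_neg (- ln z * K)\<close> is \<open>z ^ K\<close>, read as 0 where \<open>K\<close> is infinite; its mean is the generating function of
  the finite values of \<open>K\<close>.
\<close>

lemma poisson_law_of_pgf:
  fixes K :: "'q \<Rightarrow> enat"
  assumes Q: "prob_space Q" and K[measurable]: "K \<in> measurable Q (count_space UNIV)" and \<mu>: "0 \<le> \<mu>"
    and pgf: "\<And>z. 0 < z \<Longrightarrow> z < 1 \<Longrightarrow> (\<integral>w. exp_neg (ennreal (- ln z) * ennreal_of_enat (K w)) \<partial>Q) = exp (- \<mu> * (1 - z))"
  shows "measure Q {w\<in>space Q. K w = enat k} = \<mu> ^ k / fact k * exp (- \<mu>)"
proof (rule power_series_coeffs_unique[where f="\<lambda>z. exp (- \<mu> * (1 - z))"])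
  interpret Q: prob_space Q by fact
  fix z :: real assume z: "0 < z" "z < 1"
  have v: "0 < - ln z" using z by simp
  define p where "p m = measure Q {w\<in>space Q. K w = enat m}" for m
  have "ennreal (exp (- \<mu> * (1 - z))) = (\<integral>\<^sup>+w. ennreal (exp_neg (ennreal (- ln z) * ennreal_of_enat (K w))) \<partial>Q)"
    unfolding pgf[OF z, symmetric]
    by (intro nn_integral_eq_integral[symmetric] Q.integrable_const_bound[of _ 1]) auto
  also have "\<dots> = (\<integral>\<^sup>+w. (\<Sum>m. ennreal (z ^ m) * indicator {w\<in>space Q. K w = enat m} w) \<partial>Q)"
  proof (intro nn_integral_cong)
    fix w assume w: "w \<in> space Q"
    show "ennreal (exp_neg (ennreal (- ln z) * ennreal_of_enat (K w))) = (\<Sum>m. ennreal (z ^ m) * indicator {w\<in>space Q. K w = enat m} w)"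
      unfolding exp_neg_enat_series[OF v]
    proof (rule suminf_cong)
      fix m
      have "exp (- (- ln z) * real m) = z ^ m" using z by (simp add: exp_of_nat2_mult)
      then show "ennreal (exp (- (- ln z) * real m)) * indicator {w. w = enat m} (K w) = ennreal (z ^ m) * indicator {w\<in>space Q. K w = enat m} w"
        using w by (auto split: split_indicator)
    qed
  qed
  also have "\<dots> = (\<Sum>m. ennreal (z ^ m * p m))"
    using z by (subst nn_integral_suminf) (auto simp: nn_integral_cmult_indicator Q.emeasure_eq_measure p_def ennreal_mult)
  finally have S: "(\<Sum>m. ennreal (z ^ m * p m)) = ennreal (exp (- \<mu> * (1 - z)))" by simp
  have "summable (\<lambda>m. z ^ m * p m)"
    by (rule summable_comparison_test'[OF summable_geometric[of z], of 0])
       (use z in \<open>auto simp: p_def abs_mult mult_left_le\<close>)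
  then show "(\<lambda>m. z ^ m * p m) sums exp (- \<mu> * (1 - z))"
    using S suminf_ennreal2[of "\<lambda>m. z ^ m * p m"] z
    by (simp add: sums_iff p_def suminf_nonneg)
  show "(\<lambda>m. z ^ m * (\<mu> ^ m / fact m * exp (- \<mu>))) sums exp (- \<mu> * (1 - z))"
    by (rule poisson_pgf_sums)
qed

text \<open>
  Thinning. With \<open>c = 1 - z\<close>, the variable \<open>z ^ #{n. x n \<in> E}\<close> is the product over \<open>n\<close> of
  \<open>1 - c * indicator\<close>. Given the arrivals the marks are independent, so each indicator may be replaced by
  its conditional probability \<open>q (a n)\<close>; the resulting product over the arrivals is the Laplace
  functional of the Poisson process at \<open>- ln (1 - c * q)\<close>.
\<close>

lemma marked_count_pgf:
  assumes cat: "catalog Q \<gamma> P lam \<Gamma> a l x" and \<gamma>: "0 < \<gamma>"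
    and E[measurable]: "E \<in> sets (configurations borel)" and q[measurable]: "q \<in> borel_measurable borel"
    and q01: "\<And>b. 0 \<le> q b" "\<And>b. q b \<le> 1"
    and cond: "\<And>n. AE w in Q. cond_prob_given Q (vimage_algebra (space Q) \<Gamma> (configurations borel)) {w \<in> space Q. x n w \<in> E} w = q (a n w)"
    and z: "0 < z" "z < 1"
  shows "(\<integral>w. exp_neg (ennreal (- ln z) * ennreal_of_enat (ecard {n. x n w \<in> E})) \<partial>Q)
       = exp_neg (ennreal (\<gamma> * (1 - z)) * (\<integral>\<^sup>+b. ennreal (q b) \<partial>lborel))"
proof -
  define F where "F = vimage_algebra (space Q) \<Gamma> (configurations borel)"
  note sub = catalog_subalgebras(1)[OF cat, folded F_def] catalog_subalgebras(4,5,6,7)[OF cat, folded F_def]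
  interpret Q: prob_space Q using cat by (simp add: catalog_def)
  interpret F: finite_measure_subalgebra Q F by (rule sub(1))
  note [measurable] = sub(3,4)
  define c where "c = 1 - z"
  have c: "0 < c" "c < 1" using z by (auto simp: c_def)
  define I where "I n w = indicat_real {w. x n w \<in> E} w" for n w
  have Im[measurable]: "I n \<in> borel_measurable Q" for n
    unfolding I_def indicator_def of_bool_def by measurable
  have I01: "0 \<le> I n w" "I n w \<le> 1" "I n w = 0 \<or> I n w = 1" for n w by (auto simp: I_def split: split_indicator)
  have intI: "integrable Q (\<lambda>w. \<Prod>n\<in>S. I n w)" for S
    by (rule Q.integrable_const_bound[of _ 1]) (auto simp: I01 prod_nonneg abs_of_nonneg intro!: prod_le_1 borel_measurable_prod)
  have intq: "integrable Q (\<lambda>w. \<Prod>n\<in>S. q (a n w))" for S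
    by (rule Q.integrable_const_bound[of _ 1]) (auto simp: q01 prod_nonneg abs_of_nonneg intro!: prod_le_1 borel_measurable_prod)
  \<comment> \<open>conditional independence of finitely many marks\<close>
  have S: "(\<integral>w. (\<Prod>n\<in>S. I n w) \<partial>Q) = (\<integral>w. (\<Prod>n\<in>S. q (a n w)) \<partial>Q)" if fS: "finite S" for S
  proof -
    define D where "D = {w\<in>space Q. \<forall>n\<in>S. x n w \<in> E}"
    have Dm[measurable]: "D \<in> sets Q" unfolding D_def using fS by measurable
    have "(\<integral>w. (\<Prod>n\<in>S. I n w) \<partial>Q) = (\<integral>w. indicat_real D w \<partial>Q)"
    proof (intro Bochner_Integration.integral_cong refl)
      fix w assume "w \<in> space Q"
      then show "(\<Prod>n\<in>S. I n w) = indicat_real D w"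
        using fS by (auto simp: D_def I_def split: split_indicator intro!: prod.neutral)
    qed
    also have "\<dots> = (\<integral>w. real_cond_exp Q F (indicator D) w \<partial>Q)"
      by (intro F.real_cond_exp_int(2)[symmetric] Q.integrable_const_bound[of _ 1]) auto
    also have "\<dots> = (\<integral>w. (\<Prod>n\<in>S. q (a n w)) \<partial>Q)"
    proof (rule integral_cong_AE)
      have E2: "space paths \<times> E \<in> sets (paths \<Otimes>\<^sub>M configurations borel)" by simp
      have ci: "cond_indep_vars Q F (paths \<Otimes>\<^sub>M configurations borel) (\<lambda>n w. (l n w, x n w))"
        using cat by (simp add: catalog_def Let_def F_def)
      have sp: "space paths = UNIV" by (simp add: space_PiM)
      have e: "{w \<in> space Q. \<forall>j\<in>S. (l j w, x j w) \<in> space paths \<times> E} = D"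
        "{w \<in> space Q. (l j w, x j w) \<in> space paths \<times> E} = {w \<in> space Q. x j w \<in> E}" for j
        unfolding D_def sp by auto
      have "AE w in Q. cond_prob_given Q F D w = (\<Prod>j\<in>S. cond_prob_given Q F {w \<in> space Q. x j w \<in> E} w)"
        using ci[unfolded cond_indep_vars_def, THEN conjunct2, rule_format, of S "\<lambda>_. space paths \<times> E"] fS E2
        unfolding e by simp
      moreover have "AE w in Q. \<forall>j\<in>S. cond_prob_given Q F {w \<in> space Q. x j w \<in> E} w = q (a j w)"
        using fS cond by (simp add: AE_finite_all F_def)
      ultimately show "AE w in Q. real_cond_exp Q F (indicator D) w = (\<Prod>n\<in>S. q (a n w))"
        by eventually_elim (simp add: cond_prob_given_def)
    qed auto
    finally show ?thesis .
  qed
  have fin: "(\<integral>w. (\<Prod>n<J. 1 - c * I n w) \<partial>Q) = (\<integral>w. (\<Prod>n<J. 1 - c * q (a n w)) \<partial>Q)" for J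
  proof -
    \<comment> \<open>expanding the product reduces it to products over subsets, for which the replacement is \<open>S\<close>\<close>
    have ex: "(\<Prod>n<J. 1 - c * g n) = (\<Sum>S\<in>Pow {..<J}. (- c) ^ card S * (\<Prod>n\<in>S. g n))" for g :: "nat \<Rightarrow> real"
    proof -
      have pd: "(\<Prod>n\<in>S. - c * g n) = (- c) ^ card S * (\<Prod>n\<in>S. g n)" for S
        by (simp only: prod.distrib prod_constant)
      have "(\<Prod>n<J. 1 - c * g n) = (\<Prod>n<J. - c * g n + 1)" by simp
      also have "\<dots> = (\<Sum>S\<in>Pow {..<J}. (- c) ^ card S * (\<Prod>n\<in>S. g n))"
        by (subst prod_add) (simp_all only: pd finite_lessThan prod.neutral_const mult_1_right)
      finally show ?thesis .
    qed
    show ?thesis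
      unfolding ex
    proof (simp add: intI intq, intro sum.cong refl)
      fix S assume "S \<in> Pow {..<J}"
      then have "finite S" using finite_subset by auto
      then show "(- c) ^ card S * (\<integral>w. (\<Prod>n\<in>S. I n w) \<partial>Q) = (- c) ^ card S * (\<integral>w. (\<Prod>n\<in>S. q (a n w)) \<partial>Q)"
        by (simp add: S)
    qed
  qed
  have lim1: "(\<lambda>J. \<integral>w. (\<Prod>n<J. 1 - c * I n w) \<partial>Q) \<longlonglongrightarrow>
      (\<integral>w. exp_neg (ennreal (- ln z) * ennreal_of_enat (ecard {n. x n w \<in> E})) \<partial>Q)"
  proof (rule integral_dominated_convergence[where w="\<lambda>_. 1"])
    have e: "exp_neg (ennreal (- ln z) * ennreal_of_enat (ecard {n. x n w \<in> E})) = exp_neg (\<Sum>n. ennreal (- ln z * I n w))" for w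
    proof -
      have "(\<Sum>n. ennreal (- ln z * I n w)) = (\<Sum>n. ennreal (- ln z) * indicator {n. x n w \<in> E} n)"
        using z by (intro suminf_cong) (auto simp: I_def split: split_indicator)
      then show ?thesis by (simp add: ennreal_of_enat_ecard)
    qed
    show "(\<lambda>w. exp_neg (ennreal (- ln z) * ennreal_of_enat (ecard {n. x n w \<in> E}))) \<in> borel_measurable Q"
      unfolding e by measurable
    show "AE w in Q. (\<lambda>J. \<Prod>n<J. 1 - c * I n w) \<longlonglongrightarrow> exp_neg (ennreal (- ln z) * ennreal_of_enat (ecard {n. x n w \<in> E}))"
    proof (rule AE_I2)
      fix w
      have "1 - c * I n w = exp (- (- ln z * I n w))" for n using I01(3)[of n w] z by (auto simp: c_def)
      then have pe: "(\<Prod>n<J. 1 - c * I n w) = exp (- (\<Sum>n<J. - ln z * I n w))" for J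
        by (simp only: exp_sum[symmetric] sum_negf finite_lessThan)
      have g0: "0 \<le> - ln z * I n w" for n using z I01(1)[of n w] by (intro mult_nonneg_nonneg) auto
      show "(\<lambda>J. \<Prod>n<J. 1 - c * I n w) \<longlonglongrightarrow> exp_neg (ennreal (- ln z) * ennreal_of_enat (ecard {n. x n w \<in> E}))"
        unfolding e pe by (rule suminf_exp_neg_limit) (rule g0)
    qed
    show "AE w in Q. norm (\<Prod>n<J. 1 - c * I n w) \<le> 1" for J
    proof (rule AE_I2)
      fix w
      have "\<bar>1 - c * I n w\<bar> \<le> 1" for n using I01(3)[of n w] c by auto
      then show "norm (\<Prod>n<J. 1 - c * I n w) \<le> 1" unfolding real_norm_def abs_prod by (intro prod_le_1) auto
    qed
  qed auto
  define f where "f b = - ln (1 - c * q b)" for b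
  have fpos: "0 < 1 - c * q b" "1 - c * q b \<le> 1" for b
  proof -
    have "c * q b \<le> c * 1" using q01[of b] c by (intro mult_left_mono) auto
    moreover have "0 \<le> c * q b" using q01[of b] c by simp
    ultimately show "0 < 1 - c * q b" "1 - c * q b \<le> 1" using c(2) by linarith+
  qed
  have f0: "0 \<le> f b" for b using fpos[of b] by (simp add: f_def)
  have fm[measurable]: "f \<in> borel_measurable borel" unfolding f_def by measurable
  have fe: "exp (- f b) = 1 - c * q b" for b using fpos[of b] by (simp add: f_def)
  have lim2: "(\<lambda>J. \<integral>w. (\<Prod>n<J. 1 - c * q (a n w)) \<partial>Q) \<longlonglongrightarrow> (\<integral>w. exp_neg (\<Sum>n. ennreal (f (a n w))) \<partial>Q)"
  proof (rule integral_dominated_convergence[where w="\<lambda>_. 1"])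
    show "AE w in Q. (\<lambda>J. \<Prod>n<J. 1 - c * q (a n w)) \<longlonglongrightarrow> exp_neg (\<Sum>n. ennreal (f (a n w)))"
    proof (rule AE_I2)
      fix w
      have pe: "(\<Prod>n<J. 1 - c * q (a n w)) = exp (- (\<Sum>n<J. f (a n w)))" for J
        by (simp only: exp_sum fe finite_lessThan sum_negf[symmetric])
      show "(\<lambda>J. \<Prod>n<J. 1 - c * q (a n w)) \<longlonglongrightarrow> exp_neg (\<Sum>n. ennreal (f (a n w)))"
        unfolding pe by (rule suminf_exp_neg_limit) (rule f0)
    qed
    show "AE w in Q. norm (\<Prod>n<J. 1 - c * q (a n w)) \<le> 1" for J
    proof (rule AE_I2)
      fix w
      have "\<bar>1 - c * q b\<bar> \<le> 1" for b using fpos[of b] by auto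
      then show "norm (\<Prod>n<J. 1 - c * q (a n w)) \<le> 1" unfolding real_norm_def abs_prod by (intro prod_le_1) auto
    qed
  qed auto
  have "(\<integral>w. exp_neg (ennreal (- ln z) * ennreal_of_enat (ecard {n. x n w \<in> E})) \<partial>Q) = (\<integral>w. exp_neg (\<Sum>n. ennreal (f (a n w))) \<partial>Q)"
    using LIMSEQ_unique[OF lim1[unfolded fin] lim2] .
  also have "\<dots> = exp_neg (ennreal \<gamma> * (\<integral>\<^sup>+b. ennreal (1 - exp_neg (ennreal (f b))) \<partial>lborel))"
    using cat \<gamma> by (intro poisson_laplace) (auto simp: catalog_def Let_def)
  also have "(\<integral>\<^sup>+b. ennreal (1 - exp_neg (ennreal (f b))) \<partial>lborel) = (\<integral>\<^sup>+b. ennreal c * ennreal (q b) \<partial>lborel)"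
    using f0 c q01 by (intro nn_integral_cong) (simp add: exp_neg_ennreal fe ennreal_mult)
  also have "\<dots> = ennreal c * (\<integral>\<^sup>+b. ennreal (q b) \<partial>lborel)" by (rule nn_integral_cmult) simp
  also have "ennreal \<gamma> * \<dots> = ennreal (\<gamma> * (1 - z)) * (\<integral>\<^sup>+b. ennreal (q b) \<partial>lborel)"
    using \<gamma> c by (simp add: c_def ennreal_mult mult.assoc)
  finally show ?thesis .
qed

section \<open>Grids\<close>

lemma floor_cell:
  fixes \<delta> u :: real
  assumes d: "0 < \<delta>"
  shows "of_int \<lfloor>u / \<delta>\<rfloor> * \<delta> \<le> u" "u < (of_int \<lfloor>u / \<delta>\<rfloor> + 1) * \<delta>"
proof -
  have fl: "of_int \<lfloor>u / \<delta>\<rfloor> \<le> u / \<delta>" "u / \<delta> < of_int \<lfloor>u / \<delta>\<rfloor> + 1" by linarith+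
  show "of_int \<lfloor>u / \<delta>\<rfloor> * \<delta> \<le> u" "u < (of_int \<lfloor>u / \<delta>\<rfloor> + 1) * \<delta>"
    using mult_right_mono[OF fl(1), of \<delta>] mult_strict_right_mono[OF fl(2) d] d by simp_all
qed

text \<open>
  The right end of the cell \<open>[k \<delta>, (k + 1) \<delta>)\<close> that contains \<open>u\<close>.
\<close>

definition cell_end :: "real \<Rightarrow> real \<Rightarrow> real" where
  "cell_end \<delta> u = (real_of_int \<lfloor>u / \<delta>\<rfloor> + 1) * \<delta>"

lemma cell_end_bounds: "0 < \<delta> \<Longrightarrow> u < cell_end \<delta> u" "0 < \<delta> \<Longrightarrow> cell_end \<delta> u \<le> u + \<delta>"
  using floor_cell[of \<delta> u] by (simp_all add: cell_end_def ring_distribs)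

definition mesh :: "nat \<Rightarrow> real" where "mesh n = 1 / (real n + 1)"

lemma mesh_pos[simp]: "0 < mesh n" by (simp add: mesh_def)

lemma mesh_tendsto: "mesh \<longlonglongrightarrow> 0"
  using LIMSEQ_Suc[OF lim_1_over_n] by (simp add: mesh_def[abs_def] add.commute)

lemma mesh_cell_end_tendsto: "(\<lambda>n. cell_end (mesh n) u) \<longlonglongrightarrow> u"
proof (rule tendsto_sandwich[OF _ _ tendsto_const])
  show "\<forall>\<^sub>F n in sequentially. u \<le> cell_end (mesh n) u"
    using cell_end_bounds(1)[of "mesh _" u] by (intro always_eventually) (auto intro!: less_imp_le)
  show "\<forall>\<^sub>F n in sequentially. cell_end (mesh n) u \<le> u + mesh n"
    using cell_end_bounds(2)[of "mesh _" u] by (intro always_eventually) auto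
  show "(\<lambda>n. u + mesh n) \<longlonglongrightarrow> u" using tendsto_add[OF tendsto_const mesh_tendsto, of u] by simp
qed

section \<open>A single intensity path\<close>

lemma decay_shift_measurable:
  fixes f G :: "real \<Rightarrow> real"
  assumes [measurable]: "f \<in> borel_measurable borel" "G \<in> borel_measurable borel"
  shows "(\<lambda>v. ennreal (f v * exp (- (G (v + r) - G v)))) \<in> borel_measurable lborel"
  by measurable

lemma decay_shift_pair_measurable:
  fixes f G :: "real \<Rightarrow> real"
  assumes [measurable]: "f \<in> borel_measurable borel" "G \<in> borel_measurable borel"
  shows "(\<lambda>(r, v). ennreal (f v * exp (- (G (v + r) - G v))) * indicator {0..c} r) \<in> borel_measurable (lborel \<Otimes>\<^sub>M lborel)"
  by measurable

lemma decay_interval_measurable: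
  fixes f G :: "real \<Rightarrow> real"
  assumes [measurable]: "f \<in> borel_measurable borel" "G \<in> borel_measurable borel"
  shows "(\<lambda>v. ennreal (f v * exp (- (c - G v))) * indicator {a..b} v) \<in> borel_measurable lborel"
  by measurable

lemma decay_measurable:
  fixes f G h :: "real \<Rightarrow> real"
  assumes [measurable]: "f \<in> borel_measurable borel" "G \<in> borel_measurable borel" "h \<in> borel_measurable borel"
  shows "(\<lambda>v. ennreal (f v * exp (- (G (h v) - G v)))) \<in> borel_measurable lborel"
  by measurable

locale intensity_path =
  fixes f :: "real \<Rightarrow> real"
  assumes meas[measurable]: "f \<in> borel_measurable borel" and nonneg: "\<And>u. 0 \<le> f u"
    and support: "\<And>u. u < 0 \<Longrightarrow> f u = 0" and integrable: "integrable lborel f"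
begin

abbreviation F :: "real \<Rightarrow> real" where "F \<equiv> cum_intensity f 0"

lemma finite_borel: "finite_borel_measure (density lborel f)"
proof -
  have "finite_measure (density lborel f)"
    using integrable nonneg by (intro finite_measureI) (simp add: emeasure_density nn_integral_eq_integral)
  then show ?thesis
    by (intro finite_borel_measure.intro finite_borel_measure_axioms.intro) simp_all
qed

lemma F_cdf: "F t = cdf (density lborel f) t"
proof -
  have "F t = (\<integral>u. f u * indicator {..t} u \<partial>lborel)"
    unfolding cum_intensity_def set_lebesgue_integral_def
    using support by (intro Bochner_Integration.integral_cong) (auto split: split_indicator)
  also have "\<dots> = enn2real (\<integral>\<^sup>+u. ennreal (f u * indicator {..t} u) \<partial>lborel)"
    using nonneg by (intro integral_eq_nn_integral) auto
  also have "(\<integral>\<^sup>+u. ennreal (f u * indicator {..t} u) \<partial>lborel) = emeasure (density lborel f) {..t}"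
    using nonneg by (simp add: emeasure_density) (auto intro!: nn_integral_cong split: split_indicator)
  finally show ?thesis by (simp add: cdf_def measure_def)
qed

lemma F_mono: "a \<le> b \<Longrightarrow> F a \<le> F b"
  unfolding F_cdf by (rule finite_borel_measure.cdf_nondecreasing[OF finite_borel])

lemma F_cont: "isCont F t"
proof -
  have "emeasure (density lborel f) {t} = 0" by (subst emeasure_density) auto
  then have "isCont (cdf (density lborel f)) t"
    unfolding finite_borel_measure.isCont_cdf[OF finite_borel] by (simp add: measure_def)
  then show ?thesis by (simp add: F_cdf[abs_def])
qed

lemma F_meas[measurable]: "F \<in> borel_measurable borel"
  by (rule borel_measurable_mono) (auto intro!: monoI F_mono)

lemma interval:
  assumes "a \<le> b"
  shows "(\<integral>\<^sup>+u\<in>{a..b}. ennreal (f u) \<partial>lborel) = ennreal (F b - F a)"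
    and "(\<integral>\<^sup>+u\<in>{a..<b}. ennreal (f u) \<partial>lborel) = ennreal (F b - F a)"
proof -
  have "(\<integral>\<^sup>+u\<in>{a<..b}. ennreal (f u) \<partial>lborel) = ennreal (F b - F a)"
    using finite_borel_measure.emeasure_Ioc[OF finite_borel assms]
    by (simp add: F_cdf emeasure_density)
  moreover have "(\<integral>\<^sup>+u\<in>{a..b}. ennreal (f u) \<partial>lborel) = (\<integral>\<^sup>+u\<in>{a<..b}. ennreal (f u) \<partial>lborel)"
    "(\<integral>\<^sup>+u\<in>{a..<b}. ennreal (f u) \<partial>lborel) = (\<integral>\<^sup>+u\<in>{a<..b}. ennreal (f u) \<partial>lborel)"
    using AE_lborel_singleton[of a] AE_lborel_singleton[of b]
    by (intro nn_integral_cong_AE; eventually_elim; auto split: split_indicator)+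
  ultimately show "(\<integral>\<^sup>+u\<in>{a..b}. ennreal (f u) \<partial>lborel) = ennreal (F b - F a)"
    "(\<integral>\<^sup>+u\<in>{a..<b}. ennreal (f u) \<partial>lborel) = ennreal (F b - F a)" by simp_all
qed

lemma avoid_interval: "a \<le> b \<Longrightarrow> avoid f {a..<b} = exp (- (F b - F a))"
  by (simp add: avoid_def interval exp_neg_ennreal F_mono)

lemma avoid_shift:
  assumes "s \<le> t"
  shows "avoid (\<lambda>u. f (u - b)) {s..t} = exp (- (F (t - b) - F (s - b)))"
proof -
  have "(\<integral>\<^sup>+u\<in>{s..t}. ennreal (f (u - b)) \<partial>lborel) = (\<integral>\<^sup>+u\<in>{s - b..t - b}. ennreal (f u) \<partial>lborel)"
    by (subst nn_integral_real_affine[of _ 1 b]) (auto intro!: nn_integral_cong split: split_indicator)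
  then show ?thesis using assms by (simp add: avoid_def interval exp_neg_ennreal F_mono)
qed

lemma exp_identity:
  assumes "c \<le> d"
  shows "(\<integral>\<^sup>+v. ennreal (f v * exp (- (F d - F v))) * indicator {c..d} v \<partial>lborel) = ennreal (1 - exp (- (F d - F c)))"
  using exp_integral_identity[OF meas nonneg integrable assms] by (simp add: F_cdf)

lemma total: "total_intensity f = ennreal (\<integral>u. f u \<partial>lborel)"
proof -
  have "total_intensity f = (\<integral>\<^sup>+u. ennreal (f u) \<partial>lborel)"
    unfolding total_intensity_def using support by (intro nn_integral_cong) (auto split: split_indicator)
  then show ?thesis using integrable nonneg by (simp add: nn_integral_eq_integral)
qed

lemma F_increment_le: "F b - F a \<le> (\<integral>u. f u \<partial>lborel)"
proof -
  have "F b \<le> (\<integral>u. f u \<partial>lborel)"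
    unfolding cum_intensity_def set_lebesgue_integral_def
    using nonneg integrable by (intro integral_mono integrable_mult_indicator) (auto split: split_indicator)
  moreover have "0 \<le> F a" unfolding F_cdf by (rule finite_borel_measure.cdf_nonneg[OF finite_borel])
  ultimately show ?thesis by simp
qed

text \<open>
  For a document arriving at \<open>b\<close>, the probability of a request in \<open>[s, t]\<close> is split by \<open>exp_identity\<close>
  according to the age \<open>v\<close> at the last such request. Integrating over \<open>b\<close> for a fixed age \<open>v\<close> replaces
  \<open>t - b\<close> by \<open>v + r\<close>, where \<open>r\<close> runs through \<open>[0, t - s]\<close>; averaged over the path, the inner integral on the
  right is \<open>m r\<close>.
\<close>

lemma active_identity:
  assumes st: "s \<le> t"
  shows "(\<integral>\<^sup>+b. ennreal (1 - exp (- (F (t - b) - F (s - b)))) \<partial>lborel)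
       = (\<integral>\<^sup>+r. (\<integral>\<^sup>+v. ennreal (f v * exp (- (F (v + r) - F v))) \<partial>lborel) * indicator {0..t - s} r \<partial>lborel)"
proof -
  have "(\<integral>\<^sup>+b. ennreal (1 - exp (- (F (t - b) - F (s - b)))) \<partial>lborel)
      = (\<integral>\<^sup>+b. (\<integral>\<^sup>+v. ennreal (f v * exp (- (F (t - b) - F v))) * indicator {s - b..t - b} v \<partial>lborel) \<partial>lborel)"
    using st by (intro nn_integral_cong exp_identity[symmetric]) simp
  also have "\<dots> = (\<integral>\<^sup>+v. (\<integral>\<^sup>+b. ennreal (f v * exp (- (F (t - b) - F v))) * indicator {s - v..t - v} b \<partial>lborel) \<partial>lborel)"
    (is "_ = (\<integral>\<^sup>+v. ?G v \<partial>lborel)")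
  proof -
    have "(\<integral>\<^sup>+b. (\<integral>\<^sup>+v. ennreal (f v * exp (- (F (t - b) - F v))) * indicator {s - b..t - b} v \<partial>lborel) \<partial>lborel)
      = (\<integral>\<^sup>+b. (\<integral>\<^sup>+v. ennreal (f v * exp (- (F (t - b) - F v))) * indicator {s - v..t - v} b \<partial>lborel) \<partial>lborel)"
      by (intro nn_integral_cong) (auto split: split_indicator)
    also have "\<dots> = (\<integral>\<^sup>+v. ?G v \<partial>lborel)"
    proof (rule lborel_pair.Fubini')
      have "(\<lambda>p. ennreal (f (fst p) * exp (- (F (t - snd p) - F (fst p)))) *
          indicator {p. s - fst p \<le> snd p \<and> snd p \<le> t - fst p} p) \<in> borel_measurable (lborel \<Otimes>\<^sub>M lborel)"
        by measurable
      also have "(\<lambda>p. ennreal (f (fst p) * exp (- (F (t - snd p) - F (fst p)))) *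
          indicator {p. s - fst p \<le> snd p \<and> snd p \<le> t - fst p} p) =
          (\<lambda>(v, b). ennreal (f v * exp (- (F (t - b) - F v))) * indicator {s - v..t - v} b)"
        by (auto simp: fun_eq_iff split: split_indicator)
      finally show "(\<lambda>(v, b). ennreal (f v * exp (- (F (t - b) - F v))) * indicator {s - v..t - v} b)
          \<in> borel_measurable (lborel \<Otimes>\<^sub>M lborel)" .
    qed
    finally show ?thesis .
  qed
  also have "\<dots> = (\<integral>\<^sup>+v. (\<integral>\<^sup>+r. ennreal (f v * exp (- (F (v + r) - F v))) * indicator {0..t - s} r \<partial>lborel) \<partial>lborel)"
  proof (rule nn_integral_cong)
    fix v
    show "?G v = (\<integral>\<^sup>+r. ennreal (f v * exp (- (F (v + r) - F v))) * indicator {0..t - s} r \<partial>lborel)"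
      by (subst nn_integral_real_affine[of _ "-1" "t - v"])
         (auto intro!: nn_integral_cong simp: algebra_simps split: split_indicator)
  qed
  also have "\<dots> = (\<integral>\<^sup>+r. (\<integral>\<^sup>+v. ennreal (f v * exp (- (F (v + r) - F v))) * indicator {0..t - s} r \<partial>lborel) \<partial>lborel)"
    by (rule lborel_pair.Fubini', rule decay_shift_pair_measurable[OF meas F_meas])
  also have "\<dots> = (\<integral>\<^sup>+r. (\<integral>\<^sup>+v. ennreal (f v * exp (- (F (v + r) - F v))) \<partial>lborel) * indicator {0..t - s} r \<partial>lborel)"
    by (intro nn_integral_cong nn_integral_multc decay_shift_measurable[OF meas F_meas])
  finally show ?thesis .
qed

text \<open>
  The \<open>k\<close>-th term is the probability that a Poisson process with intensity \<open>f\<close> has a point in the \<open>k\<close>-th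
  cell and none in the window of length \<open>\<tau>\<close> after it. By \<open>exp_identity\<close> it is an integral over the cell,
  namely over the position \<open>v\<close> of the last point of the cell.
\<close>

lemma cell_sum:
  assumes d: "0 < \<delta>" and \<tau>: "0 \<le> \<tau>"
  shows "(\<Sum>k. ennreal (avoid f {(real k + 1) * \<delta>..<(real k + 1) * \<delta> + \<tau>} - avoid f {real k * \<delta>..<(real k + 1) * \<delta> + \<tau>}))
       = (\<integral>\<^sup>+v. ennreal (f v * exp (- (F (cell_end \<delta> v + \<tau>) - F v))) \<partial>lborel)"
proof -
  have cell: "ennreal (avoid f {(real k + 1) * \<delta>..<(real k + 1) * \<delta> + \<tau>} - avoid f {real k * \<delta>..<(real k + 1) * \<delta> + \<tau>})
    = (\<integral>\<^sup>+v. ennreal (f v * exp (- (F (cell_end \<delta> v + \<tau>) - F v))) * indicator {v. real k * \<delta> \<le> v \<and> v < (real k + 1) * \<delta>} v \<partial>lborel)" for k :: nat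
  proof -
    define e where "e = (real k + 1) * \<delta>"
    have ke: "real k * \<delta> \<le> e" using d by (simp add: e_def)
    have "avoid f {e..<e + \<tau>} - avoid f {real k * \<delta>..<e + \<tau>} = exp (- (F (e + \<tau>) - F e)) * (1 - exp (- (F e - F (real k * \<delta>))))"
      using \<tau> ke by (simp add: avoid_interval right_diff_distrib flip: exp_add)
    then have "ennreal (avoid f {e..<e + \<tau>} - avoid f {real k * \<delta>..<e + \<tau>}) = ennreal (exp (- (F (e + \<tau>) - F e)) * (1 - exp (- (F e - F (real k * \<delta>)))))"
      by (rule arg_cong)
    also have "\<dots> = ennreal (exp (- (F (e + \<tau>) - F e))) * (\<integral>\<^sup>+v. ennreal (f v * exp (- (F e - F v))) * indicator {real k * \<delta>..e} v \<partial>lborel)"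
      unfolding exp_identity[OF ke] by (rule ennreal_mult') simp
    also have "\<dots> = (\<integral>\<^sup>+v. ennreal (exp (- (F (e + \<tau>) - F e))) * (ennreal (f v * exp (- (F e - F v))) * indicator {real k * \<delta>..e} v) \<partial>lborel)"
    proof (rule nn_integral_cmult[symmetric])
      show "(\<lambda>v. ennreal (f v * exp (- (F e - F v))) * indicator {real k * \<delta>..e} v) \<in> borel_measurable lborel"
        by (rule decay_interval_measurable[OF meas F_meas])
    qed
    also have "\<dots> = (\<integral>\<^sup>+v. ennreal (f v * exp (- (F (cell_end \<delta> v + \<tau>) - F v))) * indicator {v. real k * \<delta> \<le> v \<and> v < (real k + 1) * \<delta>} v \<partial>lborel)"
    proof (rule nn_integral_cong_AE)
      show "AE v in lborel. ennreal (exp (- (F (e + \<tau>) - F e))) * (ennreal (f v * exp (- (F e - F v))) * indicator {real k * \<delta>..e} v)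
        = ennreal (f v * exp (- (F (cell_end \<delta> v + \<tau>) - F v))) * indicator {v. real k * \<delta> \<le> v \<and> v < (real k + 1) * \<delta>} v"
        \<comment> \<open>the closed interval of \<open>exp_identity\<close> and the half-open cell differ in the point \<open>e\<close>\<close>
        using AE_lborel_singleton[of e]
      proof eventually_elim
        case (elim v)
        show ?case
        proof (cases "real k * \<delta> \<le> v \<and> v < (real k + 1) * \<delta>")
          case True
          then have "\<lfloor>v / \<delta>\<rfloor> = int k" using d by (intro floor_unique) (auto simp: field_simps)
          then have ce: "cell_end \<delta> v = e" by (simp add: cell_end_def e_def)
          have "exp (- (F (e + \<tau>) - F e)) * (f v * exp (- (F e - F v))) = f v * exp (- (F (e + \<tau>) - F v))"
            by (simp add: mult.left_commute flip: exp_add)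
          then show ?thesis using True ce nonneg by (simp add: e_def ennreal_mult'[symmetric])
        next
          case False
          then show ?thesis using elim by (auto simp: e_def split: split_indicator)
        qed
      qed
    qed
    finally show ?thesis by (simp add: e_def)
  qed
  have "(\<Sum>k. ennreal (avoid f {(real k + 1) * \<delta>..<(real k + 1) * \<delta> + \<tau>} - avoid f {real k * \<delta>..<(real k + 1) * \<delta> + \<tau>}))
    = (\<integral>\<^sup>+v. (\<Sum>k. ennreal (f v * exp (- (F (cell_end \<delta> v + \<tau>) - F v))) * indicator {v. real k * \<delta> \<le> v \<and> v < (real k + 1) * \<delta>} v) \<partial>lborel)"
    unfolding cell
  proof (subst nn_integral_suminf)
    show "(\<lambda>v. ennreal (f v * exp (- (F (cell_end \<delta> v + \<tau>) - F v))) * indicator {v. real k * \<delta> \<le> v \<and> v < (real k + 1) * \<delta>} v)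
      \<in> borel_measurable lborel" for k :: nat
      by (intro borel_measurable_times_ennreal decay_measurable[OF meas F_meas] borel_measurable_indicator)
         (auto simp: cell_end_def)
  qed simp
  also have "\<dots> = (\<integral>\<^sup>+v. ennreal (f v * exp (- (F (cell_end \<delta> v + \<tau>) - F v))) \<partial>lborel)"
  proof (rule nn_integral_cong)
    fix v
    show "(\<Sum>k. ennreal (f v * exp (- (F (cell_end \<delta> v + \<tau>) - F v))) * indicator {v. real k * \<delta> \<le> v \<and> v < (real k + 1) * \<delta>} v)
      = ennreal (f v * exp (- (F (cell_end \<delta> v + \<tau>) - F v)))"
    proof (cases "v < 0")
      case True then show ?thesis by (simp add: support)
    next
      case False
      define k where "k = nat \<lfloor>v / \<delta>\<rfloor>"
      have k: "real k = of_int \<lfloor>v / \<delta>\<rfloor>" using False d by (simp add: k_def)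
      have kin: "real k * \<delta> \<le> v \<and> v < (real k + 1) * \<delta>" using floor_cell[OF d, of v] by (simp only: k)
      have "j = k" if "real j * \<delta> \<le> v" "v < (real j + 1) * \<delta>" for j
      proof -
        have "\<lfloor>v / \<delta>\<rfloor> = int j" using that d by (intro floor_unique) (auto simp: field_simps)
        then show ?thesis by (simp add: k_def)
      qed
      then have "(\<Sum>j. ennreal (f v * exp (- (F (cell_end \<delta> v + \<tau>) - F v))) * indicator {v. real j * \<delta> \<le> v \<and> v < (real j + 1) * \<delta>} v)
        = (\<Sum>j\<in>{k}. ennreal (f v * exp (- (F (cell_end \<delta> v + \<tau>) - F v))) * indicator {v. real j * \<delta> \<le> v \<and> v < (real j + 1) * \<delta>} v)"
        by (intro suminf_finite) (auto split: split_indicator)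
      then show ?thesis using kin by simp
    qed
  qed
  finally show ?thesis .
qed

text \<open>
  As the cells shrink, the window after the cell of \<open>v\<close> becomes the window after \<open>v\<close>, because \<open>F\<close> is
  continuous.
\<close>

lemma cell_kernel_tendsto:
  assumes \<tau>: "0 \<le> \<tau>"
  shows "(\<lambda>n. \<integral>\<^sup>+v. ennreal (f v * exp (- (F (cell_end (mesh n) v + \<tau>) - F v))) \<partial>lborel)
    \<longlonglongrightarrow> (\<integral>\<^sup>+v. ennreal (f v * exp (- (F (v + \<tau>) - F v))) \<partial>lborel)"
proof (rule nn_integral_dominated_convergence[where w="\<lambda>v. ennreal (f v)"])
  show "(\<lambda>v. ennreal (f v * exp (- (F (cell_end (mesh n) v + \<tau>) - F v)))) \<in> borel_measurable lborel" for n
    by (rule decay_measurable[OF meas F_meas]) (simp add: cell_end_def)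
  show "(\<lambda>v. ennreal (f v * exp (- (F (v + \<tau>) - F v)))) \<in> borel_measurable lborel"
    by (rule decay_shift_measurable[OF meas F_meas])
  show "AE v in lborel. ennreal (f v * exp (- (F (cell_end (mesh n) v + \<tau>) - F v))) \<le> ennreal (f v)" for n
  proof (intro AE_I2 ennreal_leI mult_left_le)
    fix v
    have "v \<le> cell_end (mesh n) v + \<tau>" using cell_end_bounds(1)[of "mesh n" v] \<tau> by simp
    from F_mono[OF this] show "exp (- (F (cell_end (mesh n) v + \<tau>) - F v)) \<le> 1" by simp
  qed (rule nonneg)
  show "(\<integral>\<^sup>+v. ennreal (f v) \<partial>lborel) < \<infinity>"
    using integrable nonneg by (simp add: nn_integral_eq_integral)
  show "AE v in lborel. (\<lambda>n. ennreal (f v * exp (- (F (cell_end (mesh n) v + \<tau>) - F v))))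
     \<longlonglongrightarrow> ennreal (f v * exp (- (F (v + \<tau>) - F v)))"
    by (intro AE_I2 tendsto_ennrealI tendsto_intros isCont_tendsto_compose[OF F_cont] mesh_cell_end_tendsto)
qed simp

end

section \<open>The functions m and M\<close>

lemma cum_intensity_measurable:
  assumes "random_intensity P lam"
  shows "(\<lambda>(w, t). cum_intensity (lam w) 0 t) \<in> borel_measurable (P \<Otimes>\<^sub>M borel)"
proof -
  have [measurable]: "(\<lambda>(w, t). lam w t) \<in> borel_measurable (P \<Otimes>\<^sub>M lborel)"
    using assms by (intro random_intensity_measurable) simp_all
  have "(\<lambda>p. indicator {p. 0 \<le> snd p \<and> snd p \<le> snd (fst p)} p *\<^sub>R lam (fst (fst p)) (snd p)) \<in> borel_measurable ((P \<Otimes>\<^sub>M borel) \<Otimes>\<^sub>M lborel)"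
    by measurable
  also have "(\<lambda>p. indicator {p. 0 \<le> snd p \<and> snd p \<le> snd (fst p)} p *\<^sub>R lam (fst (fst p)) (snd p))
      = (\<lambda>((w, t), u). indicator {0..t} u *\<^sub>R lam w u)"
    by (auto simp: fun_eq_iff split: split_indicator)
  finally have K: "(\<lambda>((w, t), u). indicator {0..t} u *\<^sub>R lam w u) \<in> borel_measurable ((P \<Otimes>\<^sub>M borel) \<Otimes>\<^sub>M lborel)" .
  have "(\<lambda>p. \<integral>u. (case p of (w, t) \<Rightarrow> indicator {0..t} u *\<^sub>R lam w u) \<partial>lborel) \<in> borel_measurable (P \<Otimes>\<^sub>M borel)"
    using K by (intro lborel.borel_measurable_lebesgue_integral) (simp add: split_beta')
  then show ?thesis by (simp add: cum_intensity_def set_lebesgue_integral_def split_beta')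
qed

lemma kernel_measurable:
  fixes lam F :: "'p \<Rightarrow> real \<Rightarrow> real"
  assumes l: "(\<lambda>(w, t). lam w t) \<in> borel_measurable (P \<Otimes>\<^sub>M borel)"
    and F: "(\<lambda>(w, t). F w t) \<in> borel_measurable (P \<Otimes>\<^sub>M borel)" and h: "h \<in> borel_measurable (borel \<Otimes>\<^sub>M borel)"
  shows "(\<lambda>((w, r), u). ennreal (lam w u * exp (- (F w (h (r, u)) - F w u)))) \<in> borel_measurable ((P \<Otimes>\<^sub>M lborel) \<Otimes>\<^sub>M lborel)"
proof -
  have hm: "(\<lambda>p. h (snd (fst p), snd p)) \<in> borel_measurable ((P \<Otimes>\<^sub>M lborel) \<Otimes>\<^sub>M lborel)"
    by (rule measurable_compose[OF _ h]) measurable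
  have 1: "(\<lambda>p. lam (fst (fst p)) (snd p)) \<in> borel_measurable ((P \<Otimes>\<^sub>M lborel) \<Otimes>\<^sub>M lborel)"
    using measurable_compose[OF _ l, of "\<lambda>p. (fst (fst p), snd p)" "(P \<Otimes>\<^sub>M lborel) \<Otimes>\<^sub>M lborel"] by simp
  have 2: "(\<lambda>p. F (fst (fst p)) (snd p)) \<in> borel_measurable ((P \<Otimes>\<^sub>M lborel) \<Otimes>\<^sub>M lborel)"
    using measurable_compose[OF _ F, of "\<lambda>p. (fst (fst p), snd p)" "(P \<Otimes>\<^sub>M lborel) \<Otimes>\<^sub>M lborel"] by simp
  have 3: "(\<lambda>p. F (fst (fst p)) (h (snd (fst p), snd p))) \<in> borel_measurable ((P \<Otimes>\<^sub>M lborel) \<Otimes>\<^sub>M lborel)"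
    using measurable_compose[OF _ F, of "\<lambda>p. (fst (fst p), h (snd (fst p), snd p))" "(P \<Otimes>\<^sub>M lborel) \<Otimes>\<^sub>M lborel"] hm by simp
  have "(\<lambda>p. ennreal (lam (fst (fst p)) (snd p) * exp (- (F (fst (fst p)) (h (snd (fst p), snd p)) - F (fst (fst p)) (snd p)))))
      \<in> borel_measurable ((P \<Otimes>\<^sub>M lborel) \<Otimes>\<^sub>M lborel)"
    by (intro measurable_compose[OF _ measurable_ennreal] borel_measurable_times
        measurable_compose[OF _ borel_measurable_exp] borel_measurable_uminus borel_measurable_diff 1 2 3)
  then show ?thesis by (simp add: split_beta')
qed

lemma kernel_section_measurable:
  fixes lam F :: "'p \<Rightarrow> real \<Rightarrow> real"
  assumes l: "(\<lambda>(w, t). lam w t) \<in> borel_measurable (P \<Otimes>\<^sub>M borel)"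
    and F: "(\<lambda>(w, t). F w t) \<in> borel_measurable (P \<Otimes>\<^sub>M borel)" and h: "h \<in> borel_measurable borel"
  shows "(\<lambda>(w, u). ennreal (lam w u * exp (- (F w (h u) - F w u)))) \<in> borel_measurable (P \<Otimes>\<^sub>M lborel)"
proof -
  have "(\<lambda>p. h (snd p)) \<in> borel_measurable (borel \<Otimes>\<^sub>M borel)" using measurable_compose[OF measurable_snd h] .
  note K = kernel_measurable[OF l F this]
  have "(\<lambda>p. ((fst p, 0), snd p)) \<in> measurable (P \<Otimes>\<^sub>M lborel) ((P \<Otimes>\<^sub>M lborel) \<Otimes>\<^sub>M lborel)"
    by measurable
  from measurable_compose[OF this K] show ?thesis by (simp add: split_beta')
qed

locale finite_mean_intensity = prob_space P for P :: "'p measure" +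
  fixes lam :: "'p \<Rightarrow> real \<Rightarrow> real"
  assumes canonical: "canonical_intensity P lam"
    and mean_pos: "0 < (\<integral>\<^sup>+w. total_intensity (lam w) \<partial>P)"
    and mean_finite: "(\<integral>\<^sup>+w. total_intensity (lam w) \<partial>P) < \<infinity>"
begin

abbreviation m :: "real \<Rightarrow> real" where "m \<equiv> m_fun P lam"
abbreviation M :: "real \<Rightarrow> real" where "M \<equiv> M_fun P lam"
abbreviation cum :: "'p \<Rightarrow> real \<Rightarrow> real" where "cum w \<equiv> cum_intensity (lam w) 0"
definition m0 :: real where "m0 = enn2real (\<integral>\<^sup>+w. total_intensity (lam w) \<partial>P)"

lemma lam_intensity: "random_intensity P lam"
  using canonical by (simp add: canonical_intensity_def)

lemma lam_meas: "(\<lambda>(w, t). lam w t) \<in> borel_measurable (P \<Otimes>\<^sub>M borel)"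
  using lam_intensity by (simp add: random_intensity_def)

lemma cum_meas: "(\<lambda>(w, t). cum w t) \<in> borel_measurable (P \<Otimes>\<^sub>M borel)"
  using lam_intensity by (rule cum_intensity_measurable)

lemma total_measurable[measurable]: "(\<lambda>w. total_intensity (lam w)) \<in> borel_measurable P"
proof -
  have [measurable]: "(\<lambda>(w, t). lam w t) \<in> borel_measurable (P \<Otimes>\<^sub>M lborel)"
    using lam_intensity by (intro random_intensity_measurable) simp_all
  show ?thesis unfolding total_intensity_def by measurable
qed

lemma AE_intensity_path: "AE w in P. intensity_path (lam w)"
proof -
  have "AE w in P. total_intensity (lam w) \<noteq> \<infinity>"
    using mean_finite by (intro nn_integral_PInf_AE) auto
  then show ?thesis using AE_space
  proof eventually_elim
    case (elim w)
    have f: "lam w \<in> borel_measurable borel" by (rule random_intensity_section[OF lam_intensity elim(2)])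
    have n: "0 \<le> lam w t" for t using lam_intensity elim(2) by (simp add: random_intensity_def)
    have z: "lam w t = 0" if "t < 0" for t using canonical elim(2) that by (simp add: canonical_intensity_def)
    have "total_intensity (lam w) = (\<integral>\<^sup>+u. ennreal (lam w u) \<partial>lborel)"
      unfolding total_intensity_def using z by (intro nn_integral_cong) (auto split: split_indicator)
    then have "integrable lborel (lam w)"
      using elim(1) f n by (intro integrableI_nonneg) (auto simp: less_top)
    then show ?case using f n z by unfold_locales auto
  qed
qed

lemma m0_eq: "(\<integral>\<^sup>+w. total_intensity (lam w) \<partial>P) = ennreal m0" "0 < m0"
  using mean_finite mean_pos by (auto simp: m0_def enn2real_positive_iff)

lemma kernel_le_total:
  assumes "intensity_path (lam w)" and h: "\<And>u. u \<le> h u"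
  shows "(\<integral>\<^sup>+u. ennreal (lam w u * exp (- (cum w (h u) - cum w u))) \<partial>lborel) \<le> total_intensity (lam w)"
proof -
  interpret intensity_path "lam w" by fact
  have "(\<integral>\<^sup>+u. ennreal (lam w u * exp (- (cum w (h u) - cum w u))) \<partial>lborel) \<le> (\<integral>\<^sup>+u. ennreal (lam w u) \<partial>lborel)"
    using nonneg F_mono[OF h] by (intro nn_integral_mono ennreal_leI mult_left_le) auto
  also have "\<dots> = total_intensity (lam w)"
    using integrable nonneg by (simp add: total nn_integral_eq_integral)
  finally show ?thesis .
qed

text \<open>
  With nonnegative extended integrals over the whole line, Tonelli's theorem and monotonicity apply to \<open>m\<close>
  without integrability conditions.
\<close>

lemma m_eq:
  assumes r: "0 \<le> r"
  shows "ennreal (m r) = (\<integral>\<^sup>+w. (\<integral>\<^sup>+u. ennreal (lam w u * exp (- (cum w (u + r) - cum w u))) \<partial>lborel) \<partial>P)"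
proof -
  define K where "K w u = lam w u * exp (- (cum w (u + r) - cum w u))" for w u
  have Km: "(\<lambda>(w, u). ennreal (K w u)) \<in> borel_measurable (P \<Otimes>\<^sub>M lborel)"
    unfolding K_def by (rule kernel_section_measurable[OF lam_meas cum_meas]) simp
  have Km': "(\<lambda>w. \<integral>\<^sup>+u. ennreal (K w u) \<partial>lborel) \<in> borel_measurable P"
    using lborel.borel_measurable_nn_integral[OF Km] by simp
  define in_m where "in_m w = (LINT u:{0..}|lborel. K w u)" for w
  have inner: "AE w in P. in_m w = enn2real (\<integral>\<^sup>+u. ennreal (K w u) \<partial>lborel) \<and> (\<integral>\<^sup>+u. ennreal (K w u) \<partial>lborel) \<le> total_intensity (lam w) \<and> total_intensity (lam w) < \<infinity>"
    using AE_intensity_path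
  proof eventually_elim
    case (elim w)
    interpret intensity_path "lam w" by fact
    have "in_m w = (\<integral>u. K w u \<partial>lborel)"
      unfolding in_m_def set_lebesgue_integral_def
      by (intro Bochner_Integration.integral_cong) (auto simp: K_def support split: split_indicator)
    also have "\<dots> = enn2real (\<integral>\<^sup>+u. ennreal (K w u) \<partial>lborel)"
      using nonneg by (intro integral_eq_nn_integral) (auto simp: K_def)
    finally show ?case using kernel_le_total[OF elim, of "\<lambda>u. u + r"] r by (simp add: K_def total)
  qed
  have mm: "m r = (\<integral>w. in_m w \<partial>P)" by (simp add: m_fun_def in_m_def K_def)
  have imeas: "in_m \<in> borel_measurable P"
  proof -
    have "(\<lambda>(w, u). indicator {0..} u *\<^sub>R (enn2real (ennreal (K w u)))) \<in> borel_measurable (P \<Otimes>\<^sub>M lborel)"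
      using Km by measurable
    then have "(\<lambda>w. \<integral>u. indicator {0..} u *\<^sub>R (enn2real (ennreal (K w u))) \<partial>lborel) \<in> borel_measurable P"
      by (rule lborel.borel_measurable_lebesgue_integral)
    also have "(\<lambda>w. \<integral>u. indicator {0..} u *\<^sub>R (enn2real (ennreal (K w u))) \<partial>lborel) \<in> borel_measurable P \<longleftrightarrow> in_m \<in> borel_measurable P"
    proof (rule measurable_cong)
      fix w assume "w \<in> space P"
      then have "0 \<le> K w u" for u using lam_intensity by (simp add: K_def random_intensity_def)
      then show "(\<integral>u. indicator {0..} u *\<^sub>R (enn2real (ennreal (K w u))) \<partial>lborel) = in_m w"
        by (simp add: in_m_def set_lebesgue_integral_def)
    qed
    finally show ?thesis .
  qed
  have eq: "(\<integral>\<^sup>+w. ennreal (in_m w) \<partial>P) = (\<integral>\<^sup>+w. (\<integral>\<^sup>+u. ennreal (K w u) \<partial>lborel) \<partial>P)"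
  proof (rule nn_integral_cong_AE)
    show "AE w in P. ennreal (in_m w) = (\<integral>\<^sup>+u. ennreal (K w u) \<partial>lborel)"
      using inner
    proof eventually_elim
      case (elim w)
      then have "(\<integral>\<^sup>+u. ennreal (K w u) \<partial>lborel) < \<top>" by (metis infinity_ennreal_def le_less_trans)
      then show ?case using elim by simp
    qed
  qed
  have "(\<integral>\<^sup>+w. (\<integral>\<^sup>+u. ennreal (K w u) \<partial>lborel) \<partial>P) \<le> ennreal m0"
    unfolding m0_eq(1)[symmetric] using inner by (intro nn_integral_mono_AE) (auto elim!: eventually_mono)
  then have fin: "(\<integral>\<^sup>+w. ennreal (in_m w) \<partial>P) < \<infinity>"
    unfolding eq using le_less_trans[OF _ ennreal_less_top] by simp
  have pos: "AE w in P. 0 \<le> in_m w" using inner by eventually_elim simp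
  have "integrable P in_m" by (rule integrableI_nonneg[OF imeas pos fin])
  then have "ennreal (m r) = (\<integral>\<^sup>+w. ennreal (in_m w) \<partial>P)"
    unfolding mm using pos by (intro nn_integral_eq_integral[symmetric])
  then show ?thesis unfolding eq by (simp add: K_def)
qed

lemma m_le: assumes "0 \<le> r" shows "m r \<le> m0"
proof -
  have "ennreal (m r) \<le> ennreal m0"
    unfolding m_eq[OF assms] m0_eq(1)[symmetric]
  proof (rule nn_integral_mono_AE)
    show "AE w in P. (\<integral>\<^sup>+u. ennreal (lam w u * exp (- (cum w (u + r) - cum w u))) \<partial>lborel) \<le> total_intensity (lam w)"
      using AE_intensity_path
    proof eventually_elim
      case (elim w)
      show ?case using kernel_le_total[OF elim, of "\<lambda>u. u + r"] assms by simp
    qed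
  qed
  then show ?thesis using m0_eq(2) by (simp add: ennreal_le_iff)
qed

text \<open>
  The increments of the cumulative intensity are at most \<open>\<Lambda>(\<infinity>)\<close>, so \<open>m\<close> is bounded below by the mean of
  \<open>\<Lambda>(\<infinity>) exp (- \<Lambda>(\<infinity>))\<close>, which is positive. This makes \<open>M\<close> a bijection of \<open>[0, \<infinity>)\<close> with a Lipschitz
  inverse.
\<close>

lemma m_lower: "\<exists>c>0. \<forall>r\<ge>0. c \<le> m r"
proof -
  define g where "g w = total_intensity (lam w) * ennreal (exp (- enn2real (total_intensity (lam w))))" for w
  have [measurable]: "g \<in> borel_measurable P" unfolding g_def by measurable
  have le: "(\<integral>\<^sup>+w. g w \<partial>P) \<le> ennreal (m r)" if r: "0 \<le> r" for r
    unfolding m_eq[OF r]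
  proof (rule nn_integral_mono_AE)
    show "AE w in P. g w \<le> (\<integral>\<^sup>+u. ennreal (lam w u * exp (- (cum w (u + r) - cum w u))) \<partial>lborel)"
      using AE_intensity_path
    proof eventually_elim
      case (elim w)
      interpret intensity_path "lam w" by fact
      have i0: "0 \<le> (\<integral>u. lam w u \<partial>lborel)" using nonneg by (intro integral_nonneg_AE) auto
      have "g w = (\<integral>\<^sup>+u. ennreal (lam w u) \<partial>lborel) * ennreal (exp (- (\<integral>u. lam w u \<partial>lborel)))"
        using integrable nonneg i0 by (simp add: g_def total nn_integral_eq_integral)
      also have "\<dots> = (\<integral>\<^sup>+u. ennreal (lam w u) * ennreal (exp (- (\<integral>u. lam w u \<partial>lborel))) \<partial>lborel)"
        by (simp add: nn_integral_multc)
      also have "\<dots> \<le> (\<integral>\<^sup>+u. ennreal (lam w u * exp (- (cum w (u + r) - cum w u))) \<partial>lborel)"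
      proof (rule nn_integral_mono)
        fix u
        have "exp (- (\<integral>u. lam w u \<partial>lborel)) \<le> exp (- (cum w (u + r) - cum w u))" using F_increment_le[of "u + r" u] by simp
        then show "ennreal (lam w u) * ennreal (exp (- (\<integral>u. lam w u \<partial>lborel))) \<le> ennreal (lam w u * exp (- (cum w (u + r) - cum w u)))"
          using nonneg[of u] by (simp only: ennreal_mult[symmetric] exp_ge_zero) (intro ennreal_leI mult_left_mono)
      qed
      finally show ?case .
    qed
  qed
  have "(\<integral>\<^sup>+w. g w \<partial>P) \<noteq> 0"
  proof
    assume "(\<integral>\<^sup>+w. g w \<partial>P) = 0"
    then have "AE w in P. g w = 0" by (simp add: nn_integral_0_iff_AE)
    then have "AE w in P. total_intensity (lam w) = 0"
      by eventually_elim (auto simp: g_def ennreal_eq_0_iff not_le)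
    then have "(\<integral>\<^sup>+w. total_intensity (lam w) \<partial>P) = 0" by (simp add: nn_integral_0_iff_AE)
    then show False using mean_pos by simp
  qed
  moreover have "(\<integral>\<^sup>+w. g w \<partial>P) < \<top>" using le_less_trans[OF le[OF order_refl] ennreal_less_top] .
  ultimately have "0 < enn2real (\<integral>\<^sup>+w. g w \<partial>P)" by (simp add: enn2real_positive_iff zero_less_iff_neq_zero)
  moreover have "enn2real (\<integral>\<^sup>+w. g w \<partial>P) \<le> m r" if "0 \<le> r" for r
  proof -
    have a: "ennreal (enn2real (\<integral>\<^sup>+w. g w \<partial>P)) \<le> ennreal (m r)"
      using le[OF that] \<open>(\<integral>\<^sup>+w. g w \<partial>P) < \<top>\<close> by simp
    then show ?thesis
      using \<open>0 < enn2real (\<integral>\<^sup>+w. g w \<partial>P)\<close> by (metis ennreal_eq_0_iff ennreal_le_iff2 leD le_cases not_le)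
  qed
  ultimately show ?thesis by blast
qed

lemma m_pos: "0 \<le> r \<Longrightarrow> 0 < m r"
  using m_lower by (meson less_le_trans)

lemma m_antimono:
  assumes "0 \<le> r" "r \<le> r'"
  shows "m r' \<le> m r"
proof -
  have "ennreal (m r') \<le> ennreal (m r)"
    unfolding m_eq[OF assms(1)] m_eq[OF order_trans[OF assms(1,2)]]
  proof (rule nn_integral_mono_AE)
    show "AE w in P. (\<integral>\<^sup>+u. ennreal (lam w u * exp (- (cum w (u + r') - cum w u))) \<partial>lborel)
        \<le> (\<integral>\<^sup>+u. ennreal (lam w u * exp (- (cum w (u + r) - cum w u))) \<partial>lborel)"
      using AE_intensity_path
    proof eventually_elim
      case (elim w)
      interpret intensity_path "lam w" by fact
      show ?case using F_mono[of "_ + r" "_ + r'"] assms(2) nonneg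
        by (intro nn_integral_mono ennreal_leI mult_left_mono) auto
    qed
  qed
  then show ?thesis using m_pos[OF assms(1)] by (simp add: ennreal_le_iff)
qed

lemma m_max_measurable[measurable]: "(\<lambda>r. m (max r 0)) \<in> borel_measurable borel"
proof -
  have "(\<lambda>r. - m (max r 0)) \<in> borel_measurable borel"
    by (rule borel_measurable_mono) (auto intro!: monoI m_antimono)
  then show ?thesis by simp
qed

lemma m_set_integrable: assumes "0 \<le> a" shows "set_integrable lborel {a..b} m"
proof -
  have e: "(\<lambda>r. indicator {a..b} r *\<^sub>R m r) = (\<lambda>r. indicator {a..b} r * m (max r 0))"
  proof
    fix r
    have "max r 0 = r" if "r \<in> {a..b}" using assms that by auto
    then show "indicator {a..b} r *\<^sub>R m r = indicator {a..b} r * m (max r 0)" by (auto split: split_indicator)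
  qed
  have "integrable lborel (\<lambda>r. indicator {a..b} r * m0)"
    using m0_eq by (intro integrable_mult_left integrable_real_indicator) (auto simp: emeasure_lborel_Icc_eq)
  then show ?thesis unfolding set_integrable_def e
    by (rule Bochner_Integration.integrable_bound)
       (auto split: split_indicator simp: abs_of_nonneg m_pos less_imp_le intro!: AE_I2 order_trans[OF m_le])
qed

lemma M_diff:
  assumes "0 \<le> s" "s \<le> t"
  shows "M t - M s = integral {s..t} m" "m integrable_on {s..t}"
proof -
  have M: "M x = integral {0..x} m" for x
    unfolding M_fun_def using set_borel_integral_eq_integral(2)[OF m_set_integrable[OF order_refl]] .
  have i: "m integrable_on {0..t}" using set_borel_integral_eq_integral(1)[OF m_set_integrable[OF order_refl]] .
  show "M t - M s = integral {s..t} m"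
    using Henstock_Kurzweil_Integration.integral_combine[OF assms i] by (simp add: M)
  show "m integrable_on {s..t}" using set_borel_integral_eq_integral(1)[OF m_set_integrable[OF assms(1)]] .
qed

lemma M_diff_le: assumes "0 \<le> s" "s \<le> t" shows "M t - M s \<le> m0 * (t - s)"
proof -
  have "integral {s..t} m \<le> integral {s..t} (\<lambda>_. m0)"
    using M_diff(2)[OF assms] m_le assms by (intro integral_le) auto
  then show ?thesis using assms by (simp add: M_diff mult.commute)
qed

lemma M_diff_ge:
  assumes "\<And>r. 0 \<le> r \<Longrightarrow> c \<le> m r" "0 \<le> s" "s \<le> t"
  shows "c * (t - s) \<le> M t - M s"
proof -
  have "integral {s..t} (\<lambda>_. c) \<le> integral {s..t} m"
    using M_diff(2)[OF assms(2,3)] assms by (intro integral_le) auto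
  then show ?thesis using assms by (simp add: M_diff mult.commute)
qed

lemma M_0: "M 0 = 0"
  unfolding M_fun_def using set_borel_integral_eq_integral(2)[OF m_set_integrable[OF order_refl, of 0]] by simp

lemma M_strict_mono: assumes "0 \<le> s" "s < t" shows "M s < M t"
proof -
  obtain c where c: "0 < c" "\<And>r. 0 \<le> r \<Longrightarrow> c \<le> m r" using m_lower by auto
  have "0 < c * (t - s)" using c assms by simp
  also have "\<dots> \<le> M t - M s" using c assms by (intro M_diff_ge) auto
  finally show ?thesis by simp
qed

lemma M_mono: "0 \<le> s \<Longrightarrow> s \<le> t \<Longrightarrow> M s \<le> M t"
  using M_strict_mono[of s t] by (cases "s = t") auto

lemma M_nonneg: "0 \<le> t \<Longrightarrow> 0 \<le> M t"
  using M_mono[of 0 t] by (simp add: M_0)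

lemma M_continuous: "continuous_on {0..} M"
proof (rule continuous_onI)
  fix x e :: real assume x: "x \<in> {0..}" and e: "0 < e"
  show "\<exists>d>0. \<forall>x'\<in>{0..}. dist x' x < d \<longrightarrow> dist (M x') (M x) \<le> e"
  proof (intro exI[of _ "e / m0"] conjI ballI impI)
    show "0 < e / m0" using e m0_eq by simp
    fix y :: real assume y: "y \<in> {0..}" "dist y x < e / m0"
    have "\<bar>M y - M x\<bar> \<le> m0 * \<bar>y - x\<bar>"
      using M_diff_le[of x y] M_diff_le[of y x] M_mono[of x y] M_mono[of y x] x y
      by (cases "x \<le> y") (auto simp: abs_if)
    also have "\<dots> \<le> m0 * (e / m0)" using y(2) m0_eq(2) by (intro mult_left_mono) (auto simp: dist_real_def)
    finally show "dist (M y) (M x) \<le> e" using m0_eq(2) by (simp add: dist_real_def)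
  qed
qed

lemma M_surj: assumes "0 \<le> z" shows "\<exists>t\<ge>0. M t = z"
proof -
  obtain c where c: "0 < c" "\<And>r. 0 \<le> r \<Longrightarrow> c \<le> m r" using m_lower by auto
  have "z \<le> M (z / c)" using M_diff_ge[of c 0 "z / c"] c assms by (simp add: M_0)
  moreover have "continuous_on {0..z / c} M" by (rule continuous_on_subset[OF M_continuous]) auto
  ultimately have "\<exists>t\<ge>0. t \<le> z / c \<and> M t = z"
    using c assms by (intro IVT') (auto simp: M_0)
  then show ?thesis by auto
qed

lemma M_ennreal: "ennreal (M t) = (\<integral>\<^sup>+r. ennreal (m r) * indicator {0..t} r \<partial>lborel)"
proof -
  have "(\<integral>\<^sup>+r. ennreal (m r) * indicator {0..t} r \<partial>lborel) = (\<integral>\<^sup>+r. ennreal (indicator {0..t} r *\<^sub>R m r) \<partial>lborel)"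
    by (intro nn_integral_cong) (auto split: split_indicator)
  also have "\<dots> = ennreal (M t)"
    unfolding M_fun_def set_lebesgue_integral_def using m_set_integrable[of 0 t]
    by (intro nn_integral_eq_integral) (auto simp: set_integrable_def m_pos less_imp_le split: split_indicator)
  finally show ?thesis ..
qed

text \<open>
  The integral over all arrival times of the probability of being requested in \<open>[s, t]\<close>: \<open>active_identity\<close>
  averaged over the intensity.
\<close>

lemma active_mean:
  assumes st: "s \<le> t"
  shows "(\<integral>\<^sup>+b. ennreal (1 - void_prob P lam {s..t} b) \<partial>lborel) = ennreal (M (t - s))"
proof -
  interpret PL: pair_sigma_finite P lborel ..
  interpret LP: pair_sigma_finite lborel P ..
  have av: "(\<lambda>(b, w). avoid (\<lambda>u. lam w (u - b)) {s..t}) \<in> borel_measurable (lborel \<Otimes>\<^sub>M P)"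
    using random_intensity_avoid[OF random_intensity_shift[OF lam_intensity, of "\<lambda>b. b" lborel], of "{s..t}"]
    by (simp add: split_beta')
  have ia: "integrable P (\<lambda>w. avoid (\<lambda>u. lam w (u - b)) {s..t})" for b
    by (intro integrable_avoid random_intensity_shift_const lam_intensity finite_measure_axioms) simp
  have "(\<integral>\<^sup>+b. ennreal (1 - void_prob P lam {s..t} b) \<partial>lborel)
      = (\<integral>\<^sup>+b. (\<integral>\<^sup>+w. ennreal (1 - avoid (\<lambda>u. lam w (u - b)) {s..t}) \<partial>P) \<partial>lborel)"
  proof (rule nn_integral_cong)
    fix b
    have "1 - void_prob P lam {s..t} b = (\<integral>w. 1 - avoid (\<lambda>u. lam w (u - b)) {s..t} \<partial>P)"
      unfolding void_prob_def using ia by (simp add: prob_space)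
    then show "ennreal (1 - void_prob P lam {s..t} b) = (\<integral>\<^sup>+w. ennreal (1 - avoid (\<lambda>u. lam w (u - b)) {s..t}) \<partial>P)"
      using ia by (simp add: nn_integral_eq_integral)
  qed
  also have "\<dots> = (\<integral>\<^sup>+w. (\<integral>\<^sup>+b. ennreal (1 - avoid (\<lambda>u. lam w (u - b)) {s..t}) \<partial>lborel) \<partial>P)"
  proof (rule PL.Fubini')
    have "(\<lambda>p. (\<lambda>(b, w). avoid (\<lambda>u. lam w (u - b)) {s..t}) (snd p, fst p)) \<in> borel_measurable (P \<Otimes>\<^sub>M lborel)"
      using av by measurable
    then show "(\<lambda>(w, b). ennreal (1 - avoid (\<lambda>u. lam w (u - b)) {s..t})) \<in> borel_measurable (P \<Otimes>\<^sub>M lborel)"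
      by (simp add: split_beta')
  qed
  also have "\<dots> = (\<integral>\<^sup>+w. (\<integral>\<^sup>+r. (\<integral>\<^sup>+v. ennreal (lam w v * exp (- (cum w (v + r) - cum w v))) \<partial>lborel) * indicator {0..t - s} r \<partial>lborel) \<partial>P)"
  proof (rule nn_integral_cong_AE)
    show "AE w in P. (\<integral>\<^sup>+b. ennreal (1 - avoid (\<lambda>u. lam w (u - b)) {s..t}) \<partial>lborel)
       = (\<integral>\<^sup>+r. (\<integral>\<^sup>+v. ennreal (lam w v * exp (- (cum w (v + r) - cum w v))) \<partial>lborel) * indicator {0..t - s} r \<partial>lborel)"
      using AE_intensity_path
    proof eventually_elim
      case (elim w)
      interpret intensity_path "lam w" by fact
      show ?case unfolding avoid_shift[OF st] by (rule active_identity[OF st])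
    qed
  qed
  also have "\<dots> = (\<integral>\<^sup>+r. (\<integral>\<^sup>+w. (\<integral>\<^sup>+v. ennreal (lam w v * exp (- (cum w (v + r) - cum w v))) \<partial>lborel) * indicator {0..t - s} r \<partial>P) \<partial>lborel)"
  proof (rule LP.Fubini')
    have "(\<lambda>((w, r), v). ennreal (lam w v * exp (- (cum w ((\<lambda>(r, v). v + r) (r, v)) - cum w v)))) \<in> borel_measurable ((P \<Otimes>\<^sub>M lborel) \<Otimes>\<^sub>M lborel)"
      by (rule kernel_measurable[OF lam_meas cum_meas]) simp
    then have "(\<lambda>(p, v). ennreal (lam (fst p) v * exp (- (cum (fst p) (v + snd p) - cum (fst p) v)))) \<in> borel_measurable ((P \<Otimes>\<^sub>M lborel) \<Otimes>\<^sub>M lborel)"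
      by (simp add: split_beta')
    from lborel.borel_measurable_nn_integral[OF this]
    have 1: "(\<lambda>p. \<integral>\<^sup>+v. ennreal (lam (fst p) v * exp (- (cum (fst p) (v + snd p) - cum (fst p) v))) \<partial>lborel) \<in> borel_measurable (P \<Otimes>\<^sub>M lborel)" .
    have "(\<lambda>p. (\<integral>\<^sup>+v. ennreal (lam (snd p) v * exp (- (cum (snd p) (v + fst p) - cum (snd p) v))) \<partial>lborel)) \<in> borel_measurable (lborel \<Otimes>\<^sub>M P)"
      using measurable_compose[OF measurable_Pair[OF measurable_snd measurable_fst] 1] by simp
    then show "(\<lambda>(r, w). (\<integral>\<^sup>+v. ennreal (lam w v * exp (- (cum w (v + r) - cum w v))) \<partial>lborel) * indicator {0..t - s} r) \<in> borel_measurable (lborel \<Otimes>\<^sub>M P)"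
      unfolding split_beta' by (intro borel_measurable_times_ennreal) auto
  qed
  also have "\<dots> = (\<integral>\<^sup>+r. ennreal (m r) * indicator {0..t - s} r \<partial>lborel)"
  proof (rule nn_integral_cong)
    fix r :: real
    show "(\<integral>\<^sup>+w. (\<integral>\<^sup>+v. ennreal (lam w v * exp (- (cum w (v + r) - cum w v))) \<partial>lborel) * indicator {0..t - s} r \<partial>P) = ennreal (m r) * indicator {0..t - s} r"
      by (cases "r \<in> {0..t - s}") (auto simp: m_eq)
  qed
  finally show ?thesis by (simp add: M_ennreal)
qed

text \<open>
  The expected number of cells that contain a request and are not followed by another one within \<open>\<tau>\<close>,
  written with void probabilities, tends to the expected number \<open>m \<tau>\<close> of requests with this property.
\<close>

lemma cells_expectation_tendsto:
  assumes \<tau>: "0 \<le> \<tau>"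
  shows "(\<lambda>n. \<Sum>k. ennreal ((\<integral>w. avoid (lam w) {(real k + 1) * mesh n..<(real k + 1) * mesh n + \<tau>} \<partial>P)
        - (\<integral>w. avoid (lam w) {real k * mesh n..<(real k + 1) * mesh n + \<tau>} \<partial>P)))
     \<longlonglongrightarrow> ennreal (m \<tau>)"
proof -
  define K where "K n w = (\<integral>\<^sup>+v. ennreal (lam w v * exp (- (cum w (cell_end (mesh n) v + \<tau>) - cum w v))) \<partial>lborel)" for n w
  have sum: "(\<Sum>k. ennreal ((\<integral>w. avoid (lam w) {(real k + 1) * mesh n..<(real k + 1) * mesh n + \<tau>} \<partial>P)
        - (\<integral>w. avoid (lam w) {real k * mesh n..<(real k + 1) * mesh n + \<tau>} \<partial>P))) = (\<integral>\<^sup>+w. K n w \<partial>P)" for n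
  proof -
    define \<delta> where "\<delta> = mesh n"
    have d: "0 < \<delta>" by (simp add: \<delta>_def)
    define J where "J k = {(real k + 1) * \<delta>..<(real k + 1) * \<delta> + \<tau>}" for k :: nat
    define U where "U k = {real k * \<delta>..<(real k + 1) * \<delta> + \<tau>}" for k :: nat
    have JU: "J k \<subseteq> U k" for k using d by (auto simp: J_def U_def ring_distribs)
    have iv: "integrable P (\<lambda>w. avoid (lam w) B)" if "B \<in> sets borel" for B
      by (rule integrable_avoid[OF finite_measure_axioms lam_intensity that])
    have "(\<Sum>k. ennreal ((\<integral>w. avoid (lam w) (J k) \<partial>P) - (\<integral>w. avoid (lam w) (U k) \<partial>P)))
       = (\<Sum>k. \<integral>\<^sup>+w. ennreal (avoid (lam w) (J k) - avoid (lam w) (U k)) \<partial>P)"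
      using iv[of "J _"] iv[of "U _"] avoid_antimono[OF JU]
      by (intro suminf_cong) (simp add: nn_integral_eq_integral J_def U_def)
    also have "\<dots> = (\<integral>\<^sup>+w. (\<Sum>k. ennreal (avoid (lam w) (J k) - avoid (lam w) (U k))) \<partial>P)"
      using random_intensity_avoid[OF lam_intensity]
      by (intro nn_integral_suminf[symmetric] measurable_compose[OF _ measurable_ennreal] borel_measurable_diff) (auto simp: J_def U_def)
    also have "\<dots> = (\<integral>\<^sup>+w. K n w \<partial>P)"
    proof (rule nn_integral_cong_AE)
      show "AE w in P. (\<Sum>k. ennreal (avoid (lam w) (J k) - avoid (lam w) (U k))) = K n w"
        using AE_intensity_path
      proof eventually_elim
        case (elim w)
        show ?case unfolding J_def U_def K_def \<delta>_def[symmetric]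
          by (rule intensity_path.cell_sum[OF elim d \<tau>])
      qed
    qed
    finally show ?thesis by (simp add: J_def U_def \<delta>_def)
  qed
  have "(\<lambda>n. \<integral>\<^sup>+w. K n w \<partial>P) \<longlonglongrightarrow> (\<integral>\<^sup>+w. (\<integral>\<^sup>+u. ennreal (lam w u * exp (- (cum w (u + \<tau>) - cum w u))) \<partial>lborel) \<partial>P)"
  proof (rule nn_integral_dominated_convergence[where w="\<lambda>w. total_intensity (lam w)"])
    show "K n \<in> borel_measurable P" for n
      unfolding K_def[abs_def]
      by (intro lborel.borel_measurable_nn_integral[OF kernel_section_measurable[OF lam_meas cum_meas, of "\<lambda>v. cell_end (mesh n) v + \<tau>"]])
         (simp add: cell_end_def)
    show "(\<lambda>w. \<integral>\<^sup>+u. ennreal (lam w u * exp (- (cum w (u + \<tau>) - cum w u))) \<partial>lborel) \<in> borel_measurable P"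
      using lborel.borel_measurable_nn_integral[OF kernel_section_measurable[OF lam_meas cum_meas, of "\<lambda>v. v + \<tau>"]] by simp
    show "AE w in P. K n w \<le> total_intensity (lam w)" for n
      using AE_intensity_path
    proof eventually_elim
      case (elim w)
      have "v \<le> cell_end (mesh n) v + \<tau>" for v
        using cell_end_bounds(1)[of "mesh n" v] \<tau> by simp
      then show ?case unfolding K_def by (rule kernel_le_total[OF elim])
    qed
    show "AE w in P. (\<lambda>n. K n w) \<longlonglongrightarrow> (\<integral>\<^sup>+u. ennreal (lam w u * exp (- (cum w (u + \<tau>) - cum w u))) \<partial>lborel)"
      using AE_intensity_path
    proof eventually_elim
      case (elim w)
      show ?case unfolding K_def by (rule intensity_path.cell_kernel_tendsto[OF elim \<tau>])
    qed
  qed (use mean_finite in auto)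
  then show ?thesis unfolding sum m_eq[OF \<tau>] .
qed

end

section \<open>Counting documents and bounding exit times\<close>

text \<open>
  With \<open>B = {}\<close> these are the documents active in \<open>B'\<close>; with \<open>B \<subseteq> B'\<close> they are the increment of the number of
  active documents as the window grows from \<open>B\<close> to \<open>B'\<close>.
\<close>

definition new_docs :: "(real \<times> real set) set \<Rightarrow> real set \<Rightarrow> real set \<Rightarrow> enat" where
  "new_docs R B B' = ecard {(a, y) \<in> R. y \<inter> B = {} \<and> y \<inter> B' \<noteq> {}}"

definition hitting :: "real set \<Rightarrow> real set \<Rightarrow> real set set" where
  "hitting B B' = {y. y \<inter> B = {} \<and> y \<inter> B' \<noteq> {}}"

lemma new_docs_Int: "new_docs R B B' = ecard (R \<inter> (UNIV \<times> hitting B B'))"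
  by (auto simp: new_docs_def hitting_def intro!: arg_cong[of _ _ ecard])

lemma active_docs_new: "active_docs R s t = new_docs R {} {s..t}"
  by (simp add: active_docs_def new_docs_def)

lemma hitting_measurable[measurable]:
  assumes [measurable]: "B \<in> sets borel" "B' \<in> sets borel"
  shows "hitting B B' \<in> sets (configurations borel)"
proof -
  have "{y \<in> space (configurations borel). y \<inter> B = {} \<and> \<not> y \<inter> B' = {}} \<in> sets (configurations borel)"
    by measurable
  then show ?thesis by (simp add: hitting_def)
qed

lemma new_docs_measurable[measurable]:
  assumes [measurable]: "B \<in> sets borel" "B' \<in> sets borel"
  shows "(\<lambda>R. new_docs R B B') \<in> measurable marked_configurations (count_space UNIV)"
  unfolding new_docs_Int by (intro configuration_count_measurable pair_measureI) auto

lemma ecard_Un_le: "ecard (A \<union> B) \<le> ecard A + ecard B"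
  by (auto simp: ecard_def card_Un_le)

lemma new_docs_mono: "B' \<subseteq> B'' \<Longrightarrow> new_docs R B B' \<le> new_docs R B B''"
  unfolding new_docs_def by (intro ecard_mono) auto

text \<open>
  The number of active documents grows with the window, so \<open>[s, t]\<close> may be enlarged to end on a grid.
\<close>

lemma exit_time_less_imp:
  assumes "exit_time C R s < ereal t" "s0 \<le> s" "t \<le> u"
  shows "enat C \<le> new_docs R {} {s0..u}"
proof -
  obtain t' where t': "s \<le> t'" "t' < t" "active_docs R s t' = enat C"
    using assms(1) unfolding exit_time_def Inf_less_iff by auto
  have "enat C = new_docs R {} {s..t'}" using t' by (simp add: active_docs_new)
  also have "\<dots> \<le> new_docs R {} {s0..u}" using assms t' by (intro new_docs_mono) auto
  finally show ?thesis .
qed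

text \<open>
  An event, described by finitely many counts on the grid \<open>s + i \<delta>\<close>, that forces the exit time started
  anywhere in the first cell to be at most \<open>s + j \<delta>\<close>. The condition on increments excludes a jump over the
  value \<open>C\<close>, and the condition on the first cell makes the count independent of the starting point there.
  For a small mesh both conditions fail with small probability.
\<close>

definition steady_fill :: "nat \<Rightarrow> real \<Rightarrow> real \<Rightarrow> nat \<Rightarrow> (real \<times> real set) set \<Rightarrow> bool" where
  "steady_fill C \<delta> s j R \<longleftrightarrow> \<not> 1 \<le> new_docs R {} {s..s + \<delta>} \<and>
     (\<forall>i\<in>{1..<j}. \<not> 2 \<le> new_docs R {s..s + real i * \<delta>} {s..s + (real i + 1) * \<delta>}) \<and>
     enat C \<le> new_docs R {} {s..s + real j * \<delta>}"

lemma not_le_2_enat: "\<not> 2 \<le> (x::enat) \<longleftrightarrow> x \<le> 1"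
  by (cases x) (auto simp: numeral_eq_enat one_enat_def)

lemma not_le_1_enat: "\<not> 1 \<le> (x::enat) \<longleftrightarrow> x = 0"
  by (cases x) (auto simp: zero_enat_def one_enat_def)

lemma not_le_enat_iff: "\<not> enat C \<le> x \<longleftrightarrow> (\<exists>k<C. x = enat k)"
  by (cases x) auto

text \<open>
  The count starts at 0 in the first cell and increases by at most 1 per step, so at the first grid
  point where it is at least \<open>C\<close> it is equal to \<open>C\<close>, which is what the definition of the exit time asks
  for.
\<close>

lemma exit_before:
  assumes C: "1 \<le> C" and fill: "steady_fill C \<delta> s0 j R" and d: "0 < \<delta>"
    and s: "s0 \<le> s" "s \<le> s0 + \<delta>" and t: "s0 + real j * \<delta> < t"
  shows "exit_time C R s < ereal t"
proof -
  define N where "N i = new_docs R {} {s0..s0 + real i * \<delta>}" for i :: nat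
  have z: "new_docs R {} {s0..s0 + \<delta>} = 0"
    using fill unfolding steady_fill_def not_le_1_enat by blast
  have N1: "N 1 = 0" using z by (simp add: N_def)
  have "N 0 \<le> N 1" unfolding N_def using d by (intro new_docs_mono) auto
  then have N0: "N 0 = 0" using N1 by simp
  have Nstep: "N (Suc i) \<le> N i + 1" if "1 \<le> i" "i < j" for i
  proof -
    have "N (Suc i) \<le> N i + new_docs R {s0..s0 + real i * \<delta>} {s0..s0 + (real i + 1) * \<delta>}"
      unfolding N_def new_docs_def by (rule order_trans[OF ecard_mono ecard_Un_le]) (auto simp: add.commute)
    also have "\<dots> \<le> N i + 1"
      using fill that by (intro add_left_mono) (auto simp: steady_fill_def not_le_2_enat)
    finally show ?thesis .
  qed
  have Nj: "enat C \<le> N j" using fill by (simp add: steady_fill_def N_def)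
  define i where "i = (LEAST i. enat C \<le> N i)"
  have i: "enat C \<le> N i" "i \<le> j" and least: "\<And>k. k < i \<Longrightarrow> \<not> enat C \<le> N k"
    unfolding i_def using Nj by (auto intro: LeastI Least_le dest: not_less_Least)
  have C0: "\<not> enat C \<le> 0" using C by (simp add: zero_enat_def)
  have "i \<noteq> 0" "i \<noteq> 1" using i(1) N0 N1 C0 by metis+
  then obtain k where k: "i = Suc k" "1 \<le> k" by (cases i) auto
  have "N k < enat C" using least[of k] k by (simp add: not_le)
  then have "N k + 1 \<le> enat C" by (simp add: ileI1 plus_1_eSuc)
  then have Ni: "N i = enat C" using Nstep[of k] i k by (auto intro: antisym order_trans)
  have "{(a, y) \<in> R. y \<inter> {} = {} \<and> y \<inter> {s0..s0 + \<delta>} \<noteq> {}} = {}" using z unfolding new_docs_def ecard_eq_0_iff .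
  then have dis: "y \<inter> {s0..s0 + \<delta>} = {}" if "(a, y) \<in> R" for a y using that by auto
  have "active_docs R s (s0 + real i * \<delta>) = N i"
    unfolding N_def active_docs_new new_docs_def
  proof (intro arg_cong[of _ _ ecard] Collect_cong, clarsimp, intro conj_cong refl)
    fix a y assume "(a, y) \<in> R"
    from dis[OF this] s have "y \<inter> {s..s0 + real i * \<delta>} = y \<inter> {s0..s0 + real i * \<delta>}" by fastforce
    then show "(y \<inter> {s..s0 + real i * \<delta>} \<noteq> {}) = (y \<inter> {s0..s0 + real i * \<delta>} \<noteq> {})" by simp
  qed
  moreover have "1 * \<delta> \<le> real i * \<delta>" using k d by (intro mult_right_mono) auto
  ultimately have "exit_time C R s \<le> ereal (s0 + real i * \<delta>)"
    unfolding exit_time_def using s Ni by (intro Inf_lower) auto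
  also have "s0 + real i * \<delta> \<le> s0 + real j * \<delta>" using i d by simp
  then have "ereal (s0 + real i * \<delta>) < ereal t" using t by simp
  finally show ?thesis .
qed

section \<open>Poisson laws of the counts\<close>

text \<open>
  The probability that a Poisson variable of mean \<open>\<nu>\<close> is at least \<open>C\<close>.
\<close>

definition poisson_tail :: "nat \<Rightarrow> real \<Rightarrow> real" where
  "poisson_tail C \<nu> = 1 - (\<Sum>k<C. \<nu> ^ k / fact k * exp (- \<nu>))"

text \<open>
  At least \<open>C\<close> points of a unit-rate Poisson process lie in \<open>[0, \<nu>]\<close> iff its \<open>C\<close>-th arrival is at most \<open>\<nu>\<close>.
\<close>

lemma poisson_tail_erlang: "1 \<le> C \<Longrightarrow> 0 \<le> \<nu> \<Longrightarrow> poisson_tail C \<nu> = erlang_CDF (C - 1) 1 \<nu>"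
  by (cases C) (auto simp: poisson_tail_def erlang_CDF_def lessThan_Suc_atMost)

lemma poisson_tail_1_le: "poisson_tail 1 \<nu> \<le> \<nu>"
  using exp_ge_add_one_self[of "- \<nu>"] by (simp add: poisson_tail_def)

lemma poisson_tail_2_le: assumes "0 \<le> \<nu>" shows "poisson_tail 2 \<nu> \<le> \<nu>\<^sup>2"
proof -
  have "(1 - \<nu>) * (1 + \<nu>) \<le> exp (- \<nu>) * (1 + \<nu>)"
    using exp_ge_add_one_self[of "- \<nu>"] assms by (intro mult_right_mono) auto
  then show ?thesis by (simp add: poisson_tail_def numeral_2_eq_2 power2_eq_square algebra_simps)
qed

lemma poisson_count_tail:
  fixes K :: "'q \<Rightarrow> enat"
  assumes "prob_space Q" and K[measurable]: "K \<in> measurable Q (count_space UNIV)"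
    and p: "\<And>k. measure Q {w\<in>space Q. K w = enat k} = \<nu> ^ k / fact k * exp (- \<nu>)"
  shows "measure Q {w\<in>space Q. enat C \<le> K w} = poisson_tail C \<nu>"
proof -
  interpret Q: prob_space Q by fact
  have "{w\<in>space Q. enat C \<le> K w} = space Q - (\<Union>k<C. {w\<in>space Q. K w = enat k})"
    using not_le_enat_iff by blast
  moreover have "measure Q (space Q - (\<Union>k<C. {w\<in>space Q. K w = enat k})) = 1 - measure Q (\<Union>k<C. {w\<in>space Q. K w = enat k})"
    by (rule Q.prob_compl) measurable
  moreover have "measure Q (\<Union>k<C. {w\<in>space Q. K w = enat k}) = (\<Sum>k<C. measure Q {w\<in>space Q. K w = enat k})"
    by (rule Q.finite_measure_finite_Union) (auto simp: disjoint_family_on_def)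
  ultimately show ?thesis by (simp add: p poisson_tail_def)
qed

lemma ecard_measurable:
  assumes [measurable]: "\<And>n. Measurable.pred Q (p n)"
  shows "(\<lambda>w. ecard {n::nat. p n w}) \<in> measurable Q (count_space UNIV)"
proof (subst measurable_count_space_eq2_countable)
  have "{w \<in> space Q. ecard {n. p n w} = k} \<in> sets Q" for k
  proof -
    have "{w \<in> space Q. ecard {n. p n w} = k} = {w \<in> space Q. (\<Sum>n. indicator {n. p n w} n) = ennreal_of_enat k}"
      unfolding ennreal_of_enat_ecard[symmetric] by simp
    also have "(\<lambda>w. (\<Sum>n. indicator {n. p n w} n) :: ennreal) = (\<lambda>w. (\<Sum>n. indicator {w. p n w} w))"
      by (auto simp: indicator_def)
    also have "{w \<in> space Q. (\<Sum>n. indicator {w. p n w} w) = ennreal_of_enat k} \<in> sets Q"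
      unfolding indicator_def of_bool_def by measurable
    finally show ?thesis .
  qed
  moreover have "(\<lambda>w. ecard {n::nat. p n w}) -` {k} \<inter> space Q = {w \<in> space Q. ecard {n. p n w} = k}" for k by auto
  ultimately show "(\<lambda>w. ecard {n::nat. p n w}) \<in> space Q \<rightarrow> UNIV \<and> (\<forall>k\<in>UNIV. (\<lambda>w. ecard {n. p n w}) -` {k} \<inter> space Q \<in> sets Q)" by simp
qed

text \<open>
  Counting the points of the marked process amounts to counting indices, because distinct documents
  have distinct arrival times.
\<close>

lemma marked_process_measurable:
  assumes cat: "catalog Q \<gamma> P lam \<Gamma> a l x"
  shows "marked_process a x \<in> measurable Q marked_configurations"
    and "w \<in> space Q \<Longrightarrow> ecard (marked_process a x w \<inter> B) = ecard {n. (a n w, x n w) \<in> B}"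
proof -
  have card: "ecard (marked_process a x w \<inter> B) = ecard {n. (a n w, x n w) \<in> B}" if "w \<in> space Q" for w B
  proof -
    have "inj (\<lambda>n. a n w)" using cat that by (auto simp: catalog_def Let_def bij_betw_def)
    then have "inj_on (\<lambda>n. (a n w, x n w)) {n. (a n w, x n w) \<in> B}" by (auto simp: inj_on_def)
    moreover have "marked_process a x w \<inter> B = (\<lambda>n. (a n w, x n w)) ` {n. (a n w, x n w) \<in> B}"
      by (auto simp: marked_process_def)
    ultimately show ?thesis by (simp add: ecard_inj_image)
  qed
  show "marked_process a x \<in> measurable Q marked_configurations"
  proof (rule measurable_configurationsI)
    fix B assume [measurable]: "B \<in> sets (borel \<Otimes>\<^sub>M configurations borel :: (real \<times> real set) measure)"
    have [measurable]: "a n \<in> borel_measurable Q" "x n \<in> measurable Q (configurations borel)" for n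
      using catalog_subalgebras(5,6)[OF cat] by auto
    have "(\<lambda>w. ecard {n. (a n w, x n w) \<in> B}) \<in> measurable Q (count_space UNIV)"
      by (rule ecard_measurable) measurable
    then show "(\<lambda>w. ecard (marked_process a x w \<inter> B)) \<in> measurable Q (count_space UNIV)"
      by (rule measurable_cong[THEN iffD1, rotated]) (simp add: card)
  qed (simp add: space_pair_measure)
  show "w \<in> space Q \<Longrightarrow> ecard (marked_process a x w \<inter> B) = ecard {n. (a n w, x n w) \<in> B}" by (rule card)
qed

context finite_mean_intensity begin

text \<open>
  A document arriving at \<open>b\<close> avoids \<open>B\<close> and meets \<open>B'\<close> with probability
  \<open>void_prob P lam B b - void_prob P lam B' b\<close>, so by thinning the number of such documents is Poisson.
\<close>

lemma catalog_count:
  assumes cat: "catalog Q \<gamma> P lam \<Gamma> a l x" and \<gamma>: "0 < \<gamma>"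
    and B[measurable]: "B \<in> sets borel" and B'[measurable]: "B' \<in> sets borel" and BB: "B \<subseteq> B'"
    and fin: "emeasure lborel B' < \<infinity>" and \<mu>: "0 \<le> \<mu>"
    and mean: "(\<integral>\<^sup>+b. ennreal (void_prob P lam B b - void_prob P lam B' b) \<partial>lborel) = ennreal \<mu>"
  shows "measure (distr Q marked_configurations (marked_process a x))
      {R \<in> space marked_configurations. new_docs R B B' = enat k} = (\<gamma> * \<mu>) ^ k / fact k * exp (- (\<gamma> * \<mu>))"
proof -
  define F where "F = vimage_algebra (space Q) \<Gamma> (configurations borel)"
  interpret Q: prob_space Q using cat by (simp add: catalog_def)
  interpret F: finite_measure_subalgebra Q F using catalog_subalgebras(1)[OF cat] by (simp add: F_def)
  have [measurable]: "x n \<in> measurable Q (configurations borel)" for n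
    using catalog_subalgebras(6)[OF cat] .
  have [measurable]: "void_prob P lam B \<in> borel_measurable borel" "void_prob P lam B' \<in> borel_measurable borel"
    using void_prob_measurable[OF canonical] B B' by auto
  define E where "E = hitting B B'"
  have E[measurable]: "E \<in> sets (configurations borel)" unfolding E_def by measurable
  have finB: "emeasure lborel B < \<infinity>"
    using emeasure_mono[OF BB, of lborel] fin by (simp add: le_less_trans)
  have cond: "AE w in Q. cond_prob_given Q F {w \<in> space Q. x n w \<in> E} w = void_prob P lam B (a n w) - void_prob P lam B' (a n w)" for n
  proof -
    define D where "D = {w \<in> space Q. x n w \<inter> B = {}}"
    define D' where "D' = {w \<in> space Q. x n w \<inter> B' = {}}"
    have [measurable]: "D \<in> sets Q" "D' \<in> sets Q" unfolding D_def D'_def by measurable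
    have iD: "integrable Q (indicat_real D)" "integrable Q (indicat_real D')"
      by (auto intro!: Q.integrable_const_bound[of _ 1] split: split_indicator)
    have e: "indicat_real {w \<in> space Q. x n w \<in> E} = (\<lambda>w. indicator D w - indicator D' w)"
      using BB by (auto simp: fun_eq_iff E_def hitting_def D_def D'_def split: split_indicator)
    have "AE w in Q. real_cond_exp Q F (\<lambda>w. indicator D w - indicator D' w) w = real_cond_exp Q F (indicator D) w - real_cond_exp Q F (indicator D') w"
      by (rule F.real_cond_exp_diff[OF iD])
    moreover have "AE w in Q. cond_prob_given Q F D w = void_prob P lam B (a n w)"
      unfolding D_def F_def by (rule catalog_void_prob[OF cat canonical B finB])
    moreover have "AE w in Q. cond_prob_given Q F D' w = void_prob P lam B' (a n w)"
      unfolding D'_def F_def by (rule catalog_void_prob[OF cat canonical B' fin])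
    ultimately show ?thesis unfolding cond_prob_given_def e by eventually_elim simp
  qed
  have q01: "0 \<le> void_prob P lam B b - void_prob P lam B' b" "void_prob P lam B b - void_prob P lam B' b \<le> 1" for b
    using void_prob_antimono[OF canonical B B' BB, of b] void_prob_antimono[OF canonical _ B, of "{}" b] void_prob_nonneg[of P lam B' b]
    by (simp_all add: void_prob_empty[OF canonical])
  have Km: "(\<lambda>w. ecard {n. x n w \<in> E}) \<in> measurable Q (count_space UNIV)"
    by (rule ecard_measurable) measurable
  have law: "measure Q {w\<in>space Q. ecard {n. x n w \<in> E} = enat k} = (\<gamma> * \<mu>) ^ k / fact k * exp (- (\<gamma> * \<mu>))"
  proof (rule poisson_law_of_pgf[OF Q.prob_space_axioms Km])
    show "0 \<le> \<gamma> * \<mu>" using \<gamma> \<mu> by simp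
    fix z :: real assume z: "0 < z" "z < 1"
    have "(\<integral>w. exp_neg (ennreal (- ln z) * ennreal_of_enat (ecard {n. x n w \<in> E})) \<partial>Q)
      = exp_neg (ennreal (\<gamma> * (1 - z)) * (\<integral>\<^sup>+b. ennreal (void_prob P lam B b - void_prob P lam B' b) \<partial>lborel))"
      using cond unfolding F_def by (intro marked_count_pgf[OF cat \<gamma> E _ q01 _ z]) auto
    also have "\<dots> = exp_neg (ennreal (\<gamma> * (1 - z) * \<mu>))"
      unfolding mean using \<gamma> z \<mu> by (simp add: ennreal_mult)
    also have "\<dots> = exp (- (\<gamma> * \<mu>) * (1 - z))"
      using \<gamma> z \<mu> by (simp add: exp_neg_ennreal mult_ac)
    finally show "(\<integral>w. exp_neg (ennreal (- ln z) * ennreal_of_enat (ecard {n. x n w \<in> E})) \<partial>Q) = exp (- (\<gamma> * \<mu>) * (1 - z))" .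
  qed
  have S: "{R \<in> space marked_configurations. new_docs R B B' = enat k} \<in> sets marked_configurations" by measurable
  have "marked_process a x -` {R \<in> space marked_configurations. new_docs R B B' = enat k} \<inter> space Q = {w\<in>space Q. ecard {n. x n w \<in> E} = enat k}"
    using marked_process_measurable(2)[OF cat, of _ "UNIV \<times> E"] measurable_space[OF marked_process_measurable(1)[OF cat]]
    by (auto simp: new_docs_Int E_def)
  then show ?thesis using law measure_distr[OF marked_process_measurable(1)[OF cat] S] by simp
qed

lemma new_docs_mean:
  assumes "s \<le> t" "t \<le> t'"
  shows "(\<integral>\<^sup>+b. ennreal (void_prob P lam {s..t} b - void_prob P lam {s..t'} b) \<partial>lborel)
    = ennreal (M (t' - s) - M (t - s))"
proof -
  have [measurable]: "void_prob P lam {s..t} \<in> borel_measurable borel" "void_prob P lam {s..t'} \<in> borel_measurable borel"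
    using void_prob_measurable[OF canonical] by auto
  have le: "void_prob P lam {s..t'} b \<le> void_prob P lam {s..t} b" "void_prob P lam {s..t} b \<le> 1" for b
    using void_prob_antimono[OF canonical, of "{s..t}" "{s..t'}" b] void_prob_antimono[OF canonical, of "{}" "{s..t}" b] assms
    by (simp_all add: void_prob_empty[OF canonical])
  have "(\<integral>\<^sup>+b. ennreal (void_prob P lam {s..t} b - void_prob P lam {s..t'} b) \<partial>lborel)
    = (\<integral>\<^sup>+b. ennreal (1 - void_prob P lam {s..t'} b) - ennreal (1 - void_prob P lam {s..t} b) \<partial>lborel)"
    using le by (intro nn_integral_cong) (simp add: ennreal_minus)
  also have "\<dots> = (\<integral>\<^sup>+b. ennreal (1 - void_prob P lam {s..t'} b) \<partial>lborel) - (\<integral>\<^sup>+b. ennreal (1 - void_prob P lam {s..t} b) \<partial>lborel)"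
    using le assms by (intro nn_integral_diff) (auto simp: active_mean intro!: AE_I2 ennreal_leI)
  also have "\<dots> = ennreal (M (t' - s) - M (t - s))"
    using assms M_nonneg[of "t - s"] by (simp add: active_mean ennreal_minus)
  finally show ?thesis .
qed

lemma rest_probabilities:
  assumes cat: "catalog Q \<gamma> P lam \<Gamma> a l x" and \<gamma>: "0 < \<gamma>"
  defines "\<rho> \<equiv> distr Q marked_configurations (marked_process a x)"
  shows "s \<le> t \<Longrightarrow> measure \<rho> {R \<in> space \<rho>. enat k \<le> new_docs R {} {s..t}} = poisson_tail k (\<gamma> * M (t - s))"
    and "s \<le> t \<Longrightarrow> t \<le> t' \<Longrightarrow> measure \<rho> {R \<in> space \<rho>. enat k \<le> new_docs R {s..t} {s..t'}}
      = poisson_tail k (\<gamma> * (M (t' - s) - M (t - s)))"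
proof -
  interpret Q: prob_space Q using cat by (simp add: catalog_def)
  have \<rho>: "prob_space \<rho>" unfolding \<rho>_def by (rule Q.prob_space_distr[OF marked_process_measurable(1)[OF cat]])
  have sp: "space \<rho> = space marked_configurations" by (simp add: \<rho>_def)
  have ms: "measurable \<rho> (count_space UNIV) = measurable marked_configurations (count_space UNIV)"
    by (rule measurable_cong_sets) (simp_all add: \<rho>_def)
  show "measure \<rho> {R \<in> space \<rho>. enat k \<le> new_docs R {} {s..t}} = poisson_tail k (\<gamma> * M (t - s))" if "s \<le> t"
  proof (rule poisson_count_tail[OF \<rho>])
    show "(\<lambda>R. new_docs R {} {s..t}) \<in> measurable \<rho> (count_space UNIV)" unfolding ms by measurable
    show "measure \<rho> {R \<in> space \<rho>. new_docs R {} {s..t} = enat k} =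
      (\<gamma> * M (t - s)) ^ k / fact k * exp (- (\<gamma> * M (t - s)))" for k
      unfolding sp unfolding \<rho>_def
      using active_mean[OF that] M_nonneg[of "t - s"] that
      by (intro catalog_count[OF cat \<gamma>]) (auto simp: void_prob_empty[OF canonical] emeasure_lborel_Icc_eq)
  qed
  show "measure \<rho> {R \<in> space \<rho>. enat k \<le> new_docs R {s..t} {s..t'}}
      = poisson_tail k (\<gamma> * (M (t' - s) - M (t - s)))" if "s \<le> t" "t \<le> t'"
  proof (rule poisson_count_tail[OF \<rho>])
    show "(\<lambda>R. new_docs R {s..t} {s..t'}) \<in> measurable \<rho> (count_space UNIV)" unfolding ms by measurable
    show "measure \<rho> {R \<in> space \<rho>. new_docs R {s..t} {s..t'} = enat k} =
      (\<gamma> * (M (t' - s) - M (t - s))) ^ k / fact k * exp (- (\<gamma> * (M (t' - s) - M (t - s))))" for k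
      unfolding sp unfolding \<rho>_def
      using new_docs_mean[OF that] M_mono[of "t - s" "t' - s"] that
      by (intro catalog_count[OF cat \<gamma>]) (auto simp: emeasure_lborel_Icc_eq)
  qed
qed

end

section \<open>Request times and long gaps\<close>

lemma request_time_le_iff:
  assumes fin: "finite y" and r: "1 \<le> r" "r \<le> card y"
  shows "request_time y r \<le> t \<longleftrightarrow> r \<le> card (y \<inter> {..t})"
proof -
  define xs where "xs = sorted_list_of_set y"
  have xs: "sorted_wrt (<) xs" "set xs = y" "length xs = card y" using fin by (auto simp: xs_def)
  have dist: "distinct xs" using fin by (simp add: xs_def)
  have mono: "xs ! i \<le> xs ! j" if "i \<le> j" "j < length xs" for i j
    using that sorted_wrt_nth_less[OF xs(1), of i j] by (cases "i = j") auto
  define i where "i = r - 1"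
  have i: "i < length xs" "r = Suc i" using r xs(3) by (auto simp: i_def)
  have inj: "inj_on (\<lambda>k. xs ! k) A" if "A \<subseteq> {..<length xs}" for A
    using dist that by (auto simp: inj_on_def nth_eq_iff_index_eq subset_eq)
  show ?thesis
  proof
    assume le: "request_time y r \<le> t"
    have "(\<lambda>k. xs ! k) ` {..i} \<subseteq> y \<inter> {..t}"
    proof
      fix u assume "u \<in> (\<lambda>k. xs ! k) ` {..i}"
      then obtain k where k: "k \<le> i" "u = xs ! k" by auto
      have "xs ! i \<le> t" using le by (simp add: request_time_def xs_def i_def)
      then have "u \<le> t" using mono[OF k(1) i(1)] k(2) by simp
      moreover have "u \<in> y" using k i(1) xs(2) by (metis le_less_trans nth_mem)
      ultimately show "u \<in> y \<inter> {..t}" by simp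
    qed
    then have "card ((\<lambda>k. xs ! k) ` {..i}) \<le> card (y \<inter> {..t})" using fin by (intro card_mono) auto
    moreover have "card ((\<lambda>k. xs ! k) ` {..i}) = Suc i" using i by (subst card_image[OF inj]) auto
    ultimately show "r \<le> card (y \<inter> {..t})" using i by simp
  next
    assume le: "r \<le> card (y \<inter> {..t})"
    show "request_time y r \<le> t"
    proof (rule ccontr)
      assume "\<not> request_time y r \<le> t"
      then have gt: "t < xs ! i" by (simp add: request_time_def xs_def i_def)
      have "y \<inter> {..t} \<subseteq> (\<lambda>k. xs ! k) ` {..<i}"
      proof
        fix u assume u: "u \<in> y \<inter> {..t}"
        then obtain k where k: "k < length xs" "u = xs ! k" using xs(2) by (auto simp: in_set_conv_nth)
        have "k < i"
        proof (rule ccontr)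
          assume "\<not> k < i"
          then show False using mono[of i k] k u gt by auto
        qed
        then show "u \<in> (\<lambda>k. xs ! k) ` {..<i}" using k by auto
      qed
      then have "card (y \<inter> {..t}) \<le> card ((\<lambda>k. xs ! k) ` {..<i})" by (intro card_mono) auto
      also have "\<dots> \<le> i" using card_image_le[of "{..<i}" "\<lambda>k. xs ! k"] by simp
      finally show False using le i by simp
    qed
  qed
qed

lemma card_the_enat: "card X = the_enat (if ecard X = \<infinity> then 0 else ecard X)"
  by (auto simp: ecard_def zero_enat_def)

lemma configuration_card_measurable[measurable]:
  assumes "B \<in> sets S"
  shows "(\<lambda>X. card (X \<inter> B)) \<in> measurable (configurations S) (count_space UNIV)"
  unfolding card_the_enat
  by (rule measurable_compose[OF configuration_count_measurable[OF assms], of "\<lambda>k. the_enat (if k = \<infinity> then 0 else k)"]) simp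

lemma card_measurable[measurable]: "card \<in> measurable (configurations (borel :: real measure)) (count_space UNIV)"
  using configuration_card_measurable[of UNIV "borel :: real measure"] by simp

lemma finite_iff_ecard: "finite X \<longleftrightarrow> ecard X \<noteq> \<infinity>" by (simp add: ecard_def)

lemma finite_pred_measurable[measurable]: "Measurable.pred (configurations (borel :: real measure)) finite"
proof -
  have [measurable]: "ecard \<in> measurable (configurations (borel :: real measure)) (count_space UNIV)"
    using configuration_count_measurable[of UNIV "borel :: real measure"] by simp
  show ?thesis unfolding finite_iff_ecard[abs_def] by measurable
qed

text \<open>
  The value 0 for indices that name no request makes this a measurable function of the configuration.
\<close>

definition nth_request :: "nat \<Rightarrow> real set \<Rightarrow> real" where
  "nth_request r y = (if finite y \<and> 1 \<le> r \<and> r \<le> card y then request_time y r else 0)"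

lemma nth_request_measurable[measurable]: "nth_request r \<in> borel_measurable (configurations borel)"
proof (subst borel_measurable_iff_le, rule allI)
  fix t :: real
  have "{y \<in> space (configurations borel). nth_request r y \<le> t} =
    {y \<in> space (configurations borel). if finite y \<and> 1 \<le> r \<and> r \<le> card y then r \<le> card (y \<inter> {..t}) else 0 \<le> t}"
    by (intro Collect_cong) (auto simp: nth_request_def request_time_le_iff)
  also have "\<dots> \<in> sets (configurations borel)" by measurable
  finally show "{y \<in> space (configurations borel). nth_request r y \<le> t} \<in> sets (configurations borel)" .
qed

lemma request_time_nth_request: "r \<in> {2..card y} \<Longrightarrow> request_time y r = nth_request r y \<and> request_time y (r - 1) = nth_request (r - 1) y"
  by (auto simp: nth_request_def)

lemma request_time_less: assumes "r \<in> {2..card y}" shows "request_time y (r - 1) < request_time y r"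
proof -
  have fin: "finite y" using assms by (metis atLeastatMost_empty_iff2 card.infinite empty_iff not_numeral_le_zero)
  have "sorted_wrt (<) (sorted_list_of_set y)" by simp
  then show ?thesis unfolding request_time_def
    by (rule sorted_wrt_nth_less) (use assms fin in auto)
qed

text \<open>
  The number of misses with \<open>p s t\<close> in place of the indicator that a request at \<open>t\<close> misses when the
  preceding one was at \<open>s\<close>; the first request counts 1.
\<close>

definition request_sum :: "(real \<Rightarrow> real \<Rightarrow> real) \<Rightarrow> real set \<Rightarrow> real" where
  "request_sum p y = of_bool (1 \<le> card y) + (\<Sum>r = 2..card y. p (nth_request (r - 1) y) (nth_request r y))"

lemma nth_request_less: "r \<in> {2..card y} \<Longrightarrow> nth_request (r - 1) y < nth_request r y"
  using request_time_less request_time_nth_request by simp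

lemma request_sum_mono:
  assumes "\<And>s t. s < t \<Longrightarrow> p s t \<le> q s t"
  shows "request_sum p y \<le> request_sum q y"
  unfolding request_sum_def by (intro add_left_mono sum_mono assms nth_request_less)

lemma request_sum_bounds:
  assumes "\<And>s t. 0 \<le> p s t" "\<And>s t. p s t \<le> 1"
  shows "0 \<le> request_sum p y" "request_sum p y \<le> real (card y)"
proof -
  show "0 \<le> request_sum p y" unfolding request_sum_def by (intro add_nonneg_nonneg sum_nonneg assms) simp
  have "(\<Sum>r = 2..card y. p (nth_request (r - 1) y) (nth_request r y)) \<le> (\<Sum>r = 2..card y. 1)"
    by (intro sum_mono assms)
  then show "request_sum p y \<le> real (card y)" unfolding request_sum_def by (cases "card y") auto
qed

text \<open>
  The number of misses if documents left the cache exactly \<open>\<tau>\<close> after their last request.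
\<close>

definition long_gaps :: "real \<Rightarrow> real set \<Rightarrow> real" where
  "long_gaps \<tau> = request_sum (\<lambda>s t. of_bool (\<tau> < t - s))"

lemma long_gaps_bounds: "0 \<le> long_gaps \<tau> y" "long_gaps \<tau> y \<le> real (card y)"
  unfolding long_gaps_def by (auto intro: request_sum_bounds)

text \<open>
  Every request either is followed by another one within \<open>\<tau>\<close> or ends a cluster of requests; the first
  request and the requests after a long gap begin the clusters. There are as many ends as beginnings.
\<close>

lemma long_gaps_eq_card:
  assumes fin: "finite y" and \<tau>: "0 \<le> \<tau>"
  shows "long_gaps \<tau> y = real (card {u \<in> y. y \<inter> {u<..u + \<tau>} = {}})"
proof -
  define xs where "xs = sorted_list_of_set y"
  define N where "N = card y"
  have xs: "sorted_wrt (<) xs" "set xs = y" "length xs = N" "distinct xs" using fin by (auto simp: xs_def N_def)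
  have less: "xs ! i < xs ! j" if "i < j" "j < N" for i j using sorted_wrt_nth_less[OF xs(1)] that xs(3) by auto
  have le: "xs ! i \<le> xs ! j" if "i \<le> j" "j < N" for i j using less[of i j] that by (cases "i = j") auto
  define I where "I = {i. i < N \<and> (Suc i < N \<longrightarrow> \<tau> < xs ! Suc i - xs ! i)}"
  have "{u \<in> y. y \<inter> {u<..u + \<tau>} = {}} = (\<lambda>i. xs ! i) ` I"
  proof (intro set_eqI iffI)
    fix u assume u: "u \<in> {u \<in> y. y \<inter> {u<..u + \<tau>} = {}}"
    then obtain i where i: "i < N" "u = xs ! i" using xs by (auto simp: in_set_conv_nth)
    have "\<tau> < xs ! Suc i - xs ! i" if "Suc i < N"
    proof -
      have "xs ! Suc i \<in> y" using that xs by (auto simp: in_set_conv_nth)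
      then have "xs ! Suc i \<notin> {u<..u + \<tau>}" using u by auto
      then show ?thesis using less[of i "Suc i"] that i by auto
    qed
    then show "u \<in> (\<lambda>i. xs ! i) ` I" using i by (auto simp: I_def)
  next
    fix u assume "u \<in> (\<lambda>i. xs ! i) ` I"
    then obtain i where i: "i < N" "u = xs ! i" "Suc i < N \<Longrightarrow> \<tau> < xs ! Suc i - xs ! i" by (auto simp: I_def)
    have disj: "v \<notin> {u<..u + \<tau>}" if v: "v \<in> y" for v
    proof
      assume v2: "v \<in> {u<..u + \<tau>}"
      obtain j where j: "j < N" "v = xs ! j" using v xs by (auto simp: in_set_conv_nth)
      have "i < j"
      proof (rule ccontr)
        assume "\<not> i < j"
        then show False using le[of j i] i j v2 by auto
      qed
      then have "xs ! Suc i \<le> v" "Suc i < N" using le[of "Suc i" j] j by auto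
      then show False using i v2 by auto
    qed
    have "u \<in> y" using i(1,2) xs(2,3) by (metis nth_mem)
    then show "u \<in> {u \<in> y. y \<inter> {u<..u + \<tau>} = {}}" using disj by blast
  qed
  moreover have "inj_on (\<lambda>i. xs ! i) I" using xs by (auto simp: inj_on_def I_def nth_eq_iff_index_eq)
  ultimately have "card {u \<in> y. y \<inter> {u<..u + \<tau>} = {}} = card I" by (simp add: card_image)
  also have "real (card I) = (\<Sum>i<N. of_bool (Suc i < N \<longrightarrow> \<tau> < xs ! Suc i - xs ! i))"
  proof -
    have "I = {i \<in> {..<N}. Suc i < N \<longrightarrow> \<tau> < xs ! Suc i - xs ! i}" by (auto simp: I_def)
    then show ?thesis by (simp add: of_bool_def sum.If_cases Int_def)
  qed
  also have "\<dots> = of_bool (1 \<le> N) + (\<Sum>i<N - 1. of_bool (\<tau> < xs ! Suc i - xs ! i))"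
    by (cases N) (auto intro!: sum.cong)
  also have "(\<Sum>i<N - 1. of_bool (\<tau> < xs ! Suc i - xs ! i) :: real) = (\<Sum>r = 2..N. of_bool (\<tau> < nth_request r y - nth_request (r - 1) y))"
  proof (rule sum.reindex_bij_witness[of _ "\<lambda>r. r - 2" "\<lambda>i. i + 2"])
    fix i assume "i \<in> {..<N - 1}"
    then have "i + 2 \<in> {2..card y}" by (auto simp: N_def)
    from request_time_nth_request[OF this]
    show "of_bool (\<tau> < nth_request (i + 2) y - nth_request (i + 2 - 1) y) = (of_bool (\<tau> < xs ! Suc i - xs ! i) :: real)"
      by (simp add: request_time_def xs_def)
  qed auto
  finally show ?thesis by (simp add: long_gaps_def request_sum_def N_def)
qed

section \<open>Resolving long gaps by cells\<close>

text \<open>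
  The requests that none follows within \<open>\<tau>\<close>, seen on the grid of mesh \<open>\<delta>\<close>. The window starts at the end
  of the cell, so that the event for one cell is a difference of two void events.
\<close>

definition cells :: "real \<Rightarrow> real \<Rightarrow> real set \<Rightarrow> nat set" where
  "cells \<delta> \<tau> y = {k. y \<inter> {real k * \<delta>..<(real k + 1) * \<delta>} \<noteq> {} \<and> y \<inter> {(real k + 1) * \<delta>..<(real k + 1) * \<delta> + \<tau>} = {}}"

definition cell_index :: "real \<Rightarrow> real \<Rightarrow> nat" where "cell_index \<delta> u = nat \<lfloor>u / \<delta>\<rfloor>"

lemma cell_index:
  assumes d: "0 < \<delta>" and u: "0 \<le> u"
  shows "(real (cell_index \<delta> u) + 1) * \<delta> = cell_end \<delta> u" "u \<in> {real k * \<delta>..<(real k + 1) * \<delta>} \<longleftrightarrow> k = cell_index \<delta> u"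
proof -
  have k: "real (cell_index \<delta> u) = of_int \<lfloor>u / \<delta>\<rfloor>" using d u by (simp add: cell_index_def)
  show "(real (cell_index \<delta> u) + 1) * \<delta> = cell_end \<delta> u" by (simp add: cell_end_def k)
  show "u \<in> {real k * \<delta>..<(real k + 1) * \<delta>} \<longleftrightarrow> k = cell_index \<delta> u"
  proof
    assume "u \<in> {real k * \<delta>..<(real k + 1) * \<delta>}"
    then have "\<lfloor>u / \<delta>\<rfloor> = int k" using d by (intro floor_unique) (auto simp: field_simps)
    then show "k = cell_index \<delta> u" by (simp add: cell_index_def)
  next
    assume "k = cell_index \<delta> u"
    then show "u \<in> {real k * \<delta>..<(real k + 1) * \<delta>}" using floor_cell[OF d, of u] k by simp
  qed
qed

lemma cells_eq_image:
  assumes d: "0 < \<delta>" and y: "\<And>u. u \<in> y \<Longrightarrow> 0 \<le> u"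
  shows "cells \<delta> \<tau> y = cell_index \<delta> ` {u \<in> y. y \<inter> {cell_end \<delta> u..<cell_end \<delta> u + \<tau>} = {}}"
proof (intro set_eqI iffI)
  fix k assume k: "k \<in> cells \<delta> \<tau> y"
  then have "y \<inter> {real k * \<delta>..<(real k + 1) * \<delta>} \<noteq> {}" by (simp add: cells_def)
  then obtain u where u: "u \<in> y" "u \<in> {real k * \<delta>..<(real k + 1) * \<delta>}" by blast
  then have "k = cell_index \<delta> u" using cell_index(2)[OF d y[OF u(1)]] by blast
  then show "k \<in> cell_index \<delta> ` {u \<in> y. y \<inter> {cell_end \<delta> u..<cell_end \<delta> u + \<tau>} = {}}"
    using k u cell_index(1)[OF d y[OF u(1)]] by (auto simp: cells_def)
next
  fix k assume "k \<in> cell_index \<delta> ` {u \<in> y. y \<inter> {cell_end \<delta> u..<cell_end \<delta> u + \<tau>} = {}}"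
  then obtain u where u: "u \<in> y" "y \<inter> {cell_end \<delta> u..<cell_end \<delta> u + \<tau>} = {}" "k = cell_index \<delta> u" by auto
  have "u \<in> {real k * \<delta>..<(real k + 1) * \<delta>}" using cell_index(2)[OF d y[OF u(1)], of k] u(3) by blast
  then show "k \<in> cells \<delta> \<tau> y" using u cell_index(1)[OF d y[OF u(1)]] by (auto simp: cells_def)
qed

lemma eventually_cells_separate:
  assumes "finite y0"
  shows "\<forall>\<^sub>F n in sequentially. \<forall>u\<in>y0. \<forall>v\<in>y0. (u < v \<longrightarrow> cell_end (mesh n) u < v) \<and> (u + \<tau> < v \<longrightarrow> cell_end (mesh n) u + \<tau> < v)"
proof -
  have "\<forall>\<^sub>F n in sequentially. (u < v \<longrightarrow> cell_end (mesh n) u < v) \<and> (u + \<tau> < v \<longrightarrow> cell_end (mesh n) u + \<tau> < v)" for u v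
  proof -
    have "\<forall>\<^sub>F n in sequentially. u < v \<longrightarrow> cell_end (mesh n) u < v"
      using order_tendstoD(2)[OF mesh_cell_end_tendsto, of u v] by (cases "u < v") auto
    moreover have "\<forall>\<^sub>F n in sequentially. u + \<tau> < v \<longrightarrow> cell_end (mesh n) u + \<tau> < v"
      using order_tendstoD(2)[OF mesh_cell_end_tendsto, of u "v - \<tau>"]
      by (cases "u + \<tau> < v") (auto simp: less_diff_eq elim!: eventually_mono)
    ultimately show ?thesis by eventually_elim simp
  qed
  then show ?thesis using assms by (intro eventually_ball_finite) (auto intro!: eventually_ball_finite)
qed

lemma cell_index_inj:
  assumes y: "\<And>u. u \<in> y0 \<Longrightarrow> 0 \<le> u"
    and sep: "\<forall>u\<in>y0. \<forall>v\<in>y0. u < v \<longrightarrow> cell_end (mesh n) u < v"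
  shows "inj_on (cell_index (mesh n)) y0"
proof (rule inj_onI)
  have *: "cell_index (mesh n) u \<noteq> cell_index (mesh n) v" if "u \<in> y0" "v \<in> y0" "u < v" for u v
  proof
    assume "cell_index (mesh n) u = cell_index (mesh n) v"
    then have "cell_end (mesh n) u = cell_end (mesh n) v"
      using cell_index(1)[OF mesh_pos y[OF that(1)], of n] cell_index(1)[OF mesh_pos y[OF that(2)], of n] by simp
    then show False using sep that cell_end_bounds(1)[OF mesh_pos, of v n] by fastforce
  qed
  fix u v assume "u \<in> y0" "v \<in> y0" "cell_index (mesh n) u = cell_index (mesh n) v"
  then show "u = v" using *[of u v] *[of v u] by (cases u v rule: linorder_cases) auto
qed

text \<open>
  Once the mesh separates the requests, and separates \<open>u + \<tau>\<close> from the later ones, cells and requests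
  that none follows within \<open>\<tau>\<close> correspond to each other.
\<close>

lemma cells_card_eventually:
  assumes fin: "finite y" and y: "\<And>u. u \<in> y \<Longrightarrow> 0 \<le> u" and \<tau>: "0 \<le> \<tau>"
  shows "\<forall>\<^sub>F n in sequentially. ennreal_of_enat (ecard (cells (mesh n) \<tau> y)) = ennreal (long_gaps \<tau> y)"
  using eventually_cells_separate[OF fin, of \<tau>]
proof eventually_elim
  case (elim n)
  have inj: "inj_on (cell_index (mesh n)) y" using elim by (intro cell_index_inj y) auto
  note ce = cells_eq_image[of "mesh n" y \<tau>, OF mesh_pos y, simplified]
  have e: "{u \<in> y. y \<inter> {cell_end (mesh n) u..<cell_end (mesh n) u + \<tau>} = {}} = {u \<in> y. y \<inter> {u<..u + \<tau>} = {}}"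
  proof (intro Collect_cong conj_cong refl)
    fix u assume u: "u \<in> y"
    have "v \<in> {cell_end (mesh n) u..<cell_end (mesh n) u + \<tau>} \<longleftrightarrow> v \<in> {u<..u + \<tau>}" if v: "v \<in> y" for v
      using elim u v cell_end_bounds(1)[OF mesh_pos, of u n] by (auto simp: not_less) (metis less_le_not_le not_less)+
    then show "(y \<inter> {cell_end (mesh n) u..<cell_end (mesh n) u + \<tau>} = {}) = (y \<inter> {u<..u + \<tau>} = {})" by blast
  qed
  have "ecard (cells (mesh n) \<tau> y) = ecard {u \<in> y. y \<inter> {u<..u + \<tau>} = {}}"
    unfolding ce e by (rule ecard_inj_image) (auto intro: inj_on_subset[OF inj])
  then show ?case using fin long_gaps_eq_card[OF fin \<tau>] by (simp add: ecard_def ennreal_of_nat_eq_real_of_nat)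
qed

lemma cells_le_ecard:
  assumes y: "\<And>u. u \<in> y \<Longrightarrow> 0 \<le> u"
  shows "ecard (cells (mesh n) \<tau> y) \<le> ecard y"
proof (cases "finite y")
  case True
  note ce = cells_eq_image[of "mesh n" y \<tau>, OF mesh_pos y, simplified]
  have "card (cells (mesh n) \<tau> y) \<le> card y" unfolding ce
    by (rule order_trans[OF card_image_le card_mono]) (use True in auto)
  moreover have "finite (cells (mesh n) \<tau> y)" unfolding ce using True by simp
  ultimately show ?thesis using True by (simp add: ecard_def)
qed (simp add: ecard_def)

text \<open>
  Any finite set of requests is separated by a fine mesh. The bound covers infinite configurations, so
  with Fatou's lemma it shows that the expected number of requests is finite.
\<close>

lemma ecard_le_liminf_cells:
  assumes y: "\<And>u. u \<in> y \<Longrightarrow> 0 \<le> u"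
  shows "ennreal_of_enat (ecard y) \<le> liminf (\<lambda>n. ennreal_of_enat (ecard (cells (mesh n) 0 y)))"
  unfolding le_Liminf_iff
proof (intro allI impI)
  fix b assume b: "b < ennreal_of_enat (ecard y)"
  obtain y0 where y0: "finite y0" "y0 \<subseteq> y" "b < of_nat (card y0)"
  proof (cases "finite y")
    case True then show ?thesis using b by (intro that[of y]) (auto simp: ecard_def)
  next
    case False
    then have "b < \<top>" using b by (simp add: ecard_def)
    then obtain k where "b < of_nat k" using ennreal_Ex_less_of_nat[of b] by auto
    moreover obtain y0 where "finite y0" "card y0 = k" "y0 \<subseteq> y" using infinite_arbitrarily_large[OF False] by blast
    ultimately show ?thesis by (intro that[of y0]) auto
  qed
  show "\<forall>\<^sub>F n in sequentially. b < ennreal_of_enat (ecard (cells (mesh n) 0 y))"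
    using eventually_cells_separate[OF y0(1), of 0]
  proof eventually_elim
    case (elim n)
    have inj: "inj_on (cell_index (mesh n)) y0" using elim y0 by (intro cell_index_inj y) auto
    have "b < of_nat (card y0)" by fact
    also have "of_nat (card y0) = ennreal_of_enat (ecard (cell_index (mesh n) ` y0))"
      using y0(1) by (simp add: ecard_inj_image[OF inj]) (simp add: ecard_def)
    also have "\<dots> \<le> ennreal_of_enat (ecard (cells (mesh n) 0 y))"
      unfolding cells_eq_image[of "mesh n" y 0, OF mesh_pos y, simplified] using y0(2)
      by (simp, intro ecard_mono) auto
    finally show ?case .
  qed
qed

section \<open>The tagged document\<close>

lemma cox_void_probability:
  assumes can: "canonical_intensity Om tlam" and cox: "cox_process Om tlam \<xi>" and B[measurable]: "B \<in> sets borel"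
  shows "measure Om {w \<in> space Om. \<xi> w \<inter> B = {}} = (\<integral>w. avoid (tlam w) B \<partial>Om)"
proof -
  interpret prob_space Om using can by (simp add: canonical_intensity_def)
  define F where "F = vimage_algebra (space Om) tlam paths"
  have tlam: "random_intensity Om tlam" using can by (simp add: canonical_intensity_def)
  have cp: "cond_poisson Om F tlam \<xi>" using cox by (simp add: cox_process_def F_def)
  have [measurable]: "\<xi> \<in> measurable Om (configurations borel)" using cp by (simp add: cond_poisson_def)
  have "sets F \<subseteq> sets Om" unfolding F_def using random_intensity_paths[OF tlam] by (intro sets_image_in_sets) auto
  then interpret F: finite_measure_subalgebra Om F
    by unfold_locales (simp add: subalgebra_def F_def)
  define D where "D = {w \<in> space Om. \<xi> w \<inter> B = {}}"
  have D[measurable]: "D \<in> sets Om" unfolding D_def by measurable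
  have dis: "disjoint_borel 1 (\<lambda>_. B)" by (simp add: disjoint_borel_def disjoint_family_on_def)
  have cD: "counts_event Om \<xi> 1 (\<lambda>_. B) (\<lambda>_. 0) = D" by (auto simp: counts_event_def D_def enat_0)
  have AE: "AE w in Om. real_cond_exp Om F (indicator D) w = avoid (tlam w) B"
    using cp[unfolded cond_poisson_def, THEN conjunct2, rule_format, of 1 "\<lambda>_. B" "\<lambda>_. 0", OF dis] AE_space
  proof eventually_elim
    case (elim w)
    have [measurable]: "tlam w \<in> borel_measurable borel" by (rule random_intensity_section[OF tlam elim(2)])
    show ?case using elim(1) by (simp add: cD[simplified] cond_prob_given_def emeasure_density avoid_def exp_neg_def)
  qed
  have "measure Om D = (\<integral>w. indicat_real D w \<partial>Om)" by simp
  also have "\<dots> = (\<integral>w. real_cond_exp Om F (indicator D) w \<partial>Om)"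
    by (intro F.real_cond_exp_int(2)[symmetric] integrable_const_bound[of _ 1]) auto
  also have "\<dots> = (\<integral>w. avoid (tlam w) B \<partial>Om)"
    using AE random_intensity_avoid[OF tlam B] by (intro integral_cong_AE) auto
  finally show ?thesis by (simp add: D_def)
qed

text \<open>
  \<open>\<eta>\<close> is the law of the tagged request process. It enters through its void probabilities on intervals,
  which are determined by the law of \<open>lam\<close>.
\<close>

locale tagged_document = finite_mean_intensity P lam + doc: prob_space \<eta>
  for P :: "'p measure" and lam and \<eta> :: "real set measure" +
  assumes sets_doc[measurable_cong]: "sets \<eta> = sets (configurations borel)"
    and void: "\<And>a b. a \<le> b \<Longrightarrow> measure \<eta> {y \<in> space \<eta>. y \<inter> {a..<b} = {}} = (\<integral>w. avoid (lam w) {a..<b} \<partial>P)"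
    and requests_nonneg: "AE y in \<eta>. y \<inter> {..<0} = {}"
begin

lemma cells_measurable[measurable]: "(\<lambda>y. ennreal_of_enat (ecard (cells \<delta> \<tau> y))) \<in> borel_measurable \<eta>"
proof -
  have "(\<lambda>y. ecard (cells \<delta> \<tau> y)) \<in> measurable \<eta> (count_space UNIV)"
    unfolding cells_def by (rule ecard_measurable) measurable
  then show ?thesis by measurable
qed

lemma cells_mean:
  assumes \<tau>: "0 \<le> \<tau>"
  shows "(\<lambda>n. \<integral>\<^sup>+y. ennreal_of_enat (ecard (cells (mesh n) \<tau> y)) \<partial>\<eta>) \<longlonglongrightarrow> ennreal (m \<tau>)"
proof -
  have "(\<integral>\<^sup>+y. ennreal_of_enat (ecard (cells (mesh n) \<tau> y)) \<partial>\<eta>) =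
    (\<Sum>k. ennreal ((\<integral>w. avoid (lam w) {(real k + 1) * mesh n..<(real k + 1) * mesh n + \<tau>} \<partial>P)
        - (\<integral>w. avoid (lam w) {real k * mesh n..<(real k + 1) * mesh n + \<tau>} \<partial>P)))" for n
  proof -
    define I where "I k = {real k * mesh n..<(real k + 1) * mesh n}" for k :: nat
    define J where "J k = {(real k + 1) * mesh n..<(real k + 1) * mesh n + \<tau>}" for k :: nat
    define U where "U k = {real k * mesh n..<(real k + 1) * mesh n + \<tau>}" for k :: nat
    have le: "real k * mesh n \<le> (real k + 1) * mesh n" for k using mesh_pos[of n] by (simp add: ring_distribs less_imp_le)
    have U: "U k = I k \<union> J k" for k
      using ivl_disj_un_two(3)[OF le[of k], of "(real k + 1) * mesh n + \<tau>"] \<tau> by (simp add: U_def I_def J_def)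
    have [measurable]: "I k \<in> sets borel" "J k \<in> sets borel" "U k \<in> sets borel" for k by (auto simp: I_def J_def U_def)
    define S where "S k = {y \<in> space \<eta>. y \<inter> I k \<noteq> {} \<and> y \<inter> J k = {}}" for k
    have Sm: "S k \<in> sets \<eta>" for k unfolding S_def by measurable
    have "(\<integral>\<^sup>+y. ennreal_of_enat (ecard (cells (mesh n) \<tau> y)) \<partial>\<eta>) = (\<integral>\<^sup>+y. (\<Sum>k. indicator (S k) y) \<partial>\<eta>)"
      unfolding cells_def ennreal_of_enat_ecard
      by (intro nn_integral_cong suminf_cong) (auto simp: S_def I_def J_def split: split_indicator)
    also have "\<dots> = (\<Sum>k. emeasure \<eta> (S k))" using Sm by (subst nn_integral_suminf) auto
    also have "\<dots> = (\<Sum>k. ennreal ((\<integral>w. avoid (lam w) (J k) \<partial>P) - (\<integral>w. avoid (lam w) (U k) \<partial>P)))"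
    proof (rule suminf_cong)
      fix k
      have "S k = {y \<in> space \<eta>. y \<inter> J k = {}} - {y \<in> space \<eta>. y \<inter> U k = {}}" by (auto simp: S_def U)
      moreover have "measure \<eta> ({y \<in> space \<eta>. y \<inter> J k = {}} - {y \<in> space \<eta>. y \<inter> U k = {}})
        = measure \<eta> {y \<in> space \<eta>. y \<inter> J k = {}} - measure \<eta> {y \<in> space \<eta>. y \<inter> U k = {}}"
      proof (rule doc.finite_measure_Diff)
        show "{y \<in> space \<eta>. y \<inter> J k = {}} \<in> sets \<eta>" by measurable
        show "{y \<in> space \<eta>. y \<inter> U k = {}} \<in> sets \<eta>" by measurable
        show "{y \<in> space \<eta>. y \<inter> U k = {}} \<subseteq> {y \<in> space \<eta>. y \<inter> J k = {}}" by (auto simp: U)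
      qed
      moreover have "real k * mesh n \<le> (real k + 1) * mesh n + \<tau>" using le[of k] \<tau> by linarith
      ultimately show "emeasure \<eta> (S k) = ennreal ((\<integral>w. avoid (lam w) (J k) \<partial>P) - (\<integral>w. avoid (lam w) (U k) \<partial>P))"
        using \<tau> by (simp add: doc.emeasure_eq_measure J_def U_def void)
    qed
    finally show ?thesis by (simp add: J_def U_def)
  qed
  then show ?thesis using cells_expectation_tendsto[OF \<tau>] by simp
qed

lemma nonneg_AE: "AE y in \<eta>. \<forall>u\<in>y. 0 \<le> u"
  using requests_nonneg by eventually_elim (auto simp: not_le[symmetric] disjoint_iff)

lemma ecard_doc_measurable[measurable]: "ecard \<in> measurable \<eta> (count_space UNIV)"
  using configuration_count_measurable[of UNIV "borel :: real measure"] by (simp add: measurable_cong_sets[OF sets_doc refl])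

text \<open>
  Fatou's lemma for the cells with \<open>\<tau> = 0\<close>, whose expected number tends to \<open>m 0\<close>.
\<close>

lemma ecard_mean: "(\<integral>\<^sup>+y. ennreal_of_enat (ecard y) \<partial>\<eta>) < \<infinity>"
proof -
  have "(\<integral>\<^sup>+y. ennreal_of_enat (ecard y) \<partial>\<eta>) \<le> (\<integral>\<^sup>+y. liminf (\<lambda>n. ennreal_of_enat (ecard (cells (mesh n) 0 y))) \<partial>\<eta>)"
    using nonneg_AE by (intro nn_integral_mono_AE) (auto elim!: eventually_mono intro!: ecard_le_liminf_cells)
  also have "\<dots> \<le> liminf (\<lambda>n. \<integral>\<^sup>+y. ennreal_of_enat (ecard (cells (mesh n) 0 y)) \<partial>\<eta>)"
    by (rule nn_integral_liminf) (rule cells_measurable)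
  also have "\<dots> = ennreal (m 0)" using lim_imp_Liminf[OF _ cells_mean[OF order_refl]] by simp
  also have "\<dots> < \<infinity>" by simp
  finally show ?thesis .
qed

lemma finite_AE: "AE y in \<eta>. finite y"
proof -
  have "AE y in \<eta>. ennreal_of_enat (ecard y) \<noteq> \<infinity>"
    using ecard_mean by (intro nn_integral_PInf_AE) auto
  then show ?thesis unfolding finite_iff_ecard by eventually_elim (metis ennreal_of_enat_infty)
qed

lemma card_doc_measurable[measurable]: "(\<lambda>y. real (card y)) \<in> borel_measurable \<eta>"
  unfolding measurable_cong_sets[OF sets_doc refl] by measurable

lemma card_integrable: "integrable \<eta> (\<lambda>y. real (card y))"
proof (rule integrableI_nonneg)
  have "(\<integral>\<^sup>+y. ennreal (real (card y)) \<partial>\<eta>) \<le> (\<integral>\<^sup>+y. ennreal_of_enat (ecard y) \<partial>\<eta>)"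
    by (intro nn_integral_mono) (auto simp: ecard_def ennreal_of_nat_eq_real_of_nat)
  then show "(\<integral>\<^sup>+y. ennreal (real (card y)) \<partial>\<eta>) < \<infinity>" using ecard_mean by (rule le_less_trans)
qed auto

lemma request_sum_measurable:
  fixes p :: "'n \<Rightarrow> real \<Rightarrow> real \<Rightarrow> real"
  assumes "\<And>r. (\<lambda>x. p (fst x) (nth_request (r - 1) (snd x)) (nth_request r (snd x))) \<in> borel_measurable (N \<Otimes>\<^sub>M \<eta>)"
  shows "(\<lambda>x. request_sum (p (fst x)) (snd x)) \<in> borel_measurable (N \<Otimes>\<^sub>M \<eta>)"
  unfolding request_sum_def
proof (rule measurable_compose_countable[where g="\<lambda>x. card (snd x)"
      and f="\<lambda>k x. of_bool (1 \<le> k) + (\<Sum>r = 2..k. p (fst x) (nth_request (r - 1) (snd x)) (nth_request r (snd x)))"])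
  show "(\<lambda>x. of_bool (1 \<le> k) + (\<Sum>r = 2..k. p (fst x) (nth_request (r - 1) (snd x)) (nth_request r (snd x))))
      \<in> borel_measurable (N \<Otimes>\<^sub>M \<eta>)" for k
    by (intro borel_measurable_add borel_measurable_sum assms) auto
  have "card \<in> measurable \<eta> (count_space UNIV)" unfolding measurable_cong_sets[OF sets_doc refl] by measurable
  from measurable_compose[OF measurable_snd this] show "(\<lambda>x. card (snd x)) \<in> measurable (N \<Otimes>\<^sub>M \<eta>) (count_space UNIV)" .
qed

lemma nth_request_doc_measurable[measurable]: "nth_request r \<in> borel_measurable \<eta>"
  unfolding measurable_cong_sets[OF sets_doc refl] by measurable

lemma long_gaps_pair_measurable:
  assumes [measurable]: "T \<in> borel_measurable N"
  shows "(\<lambda>x. long_gaps (T (fst x)) (snd x)) \<in> borel_measurable (N \<Otimes>\<^sub>M \<eta>)"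
  unfolding long_gaps_def by (rule request_sum_measurable[of "\<lambda>x s t. of_bool (T x < t - s)"]) measurable

lemma long_gaps_measurable[measurable]: "long_gaps \<tau> \<in> borel_measurable \<eta>"
proof -
  have "(\<lambda>y. ((0::real), y)) \<in> measurable \<eta> (borel \<Otimes>\<^sub>M \<eta>)" by measurable
  from measurable_compose[OF this long_gaps_pair_measurable[of "\<lambda>_. \<tau>" borel]] show ?thesis by simp
qed

text \<open>
  Dominated convergence from cells to requests, with the number of requests as the dominating function.
\<close>

lemma long_gaps_mean:
  assumes \<tau>: "0 \<le> \<tau>"
  shows "(\<integral>y. long_gaps \<tau> y \<partial>\<eta>) = m \<tau>"
proof -
  have "(\<lambda>n. \<integral>\<^sup>+y. ennreal_of_enat (ecard (cells (mesh n) \<tau> y)) \<partial>\<eta>) \<longlonglongrightarrow> (\<integral>\<^sup>+y. ennreal (long_gaps \<tau> y) \<partial>\<eta>)"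
  proof (rule nn_integral_dominated_convergence[where w="\<lambda>y. ennreal_of_enat (ecard y)"])
    show "AE y in \<eta>. ennreal_of_enat (ecard (cells (mesh n) \<tau> y)) \<le> ennreal_of_enat (ecard y)" for n
      using nonneg_AE by eventually_elim (simp add: cells_le_ecard)
    show "AE y in \<eta>. (\<lambda>n. ennreal_of_enat (ecard (cells (mesh n) \<tau> y))) \<longlonglongrightarrow> ennreal (long_gaps \<tau> y)"
      using nonneg_AE finite_AE by eventually_elim (auto intro!: tendsto_eventually cells_card_eventually \<tau>)
  qed (use ecard_mean in auto)
  then have "(\<integral>\<^sup>+y. ennreal (long_gaps \<tau> y) \<partial>\<eta>) = ennreal (m \<tau>)"
    using cells_mean[OF \<tau>] by (rule LIMSEQ_unique)
  then show ?thesis using m_pos[OF \<tau>] by (subst integral_eq_nn_integral) (auto simp: long_gaps_bounds(1))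
qed

end

section \<open>The inverse of M and the expansion of the gamma mean\<close>

context finite_mean_intensity begin

text \<open>
  The inverse of \<open>M\<close>, continued by 0 to negative arguments so that it is monotone on the whole line.
\<close>

definition fill_time :: "real \<Rightarrow> real" where "fill_time z = char_time P lam (max z 0)"

lemma M_fill_time: "M (fill_time z) = max z 0" and fill_time_nonneg: "0 \<le> fill_time z"
proof -
  obtain t where "0 \<le> t" "M t = max z 0" using M_surj[of "max z 0"] by auto
  then have "max z 0 \<in> M ` {0..}" by (metis atLeast_iff imageI)
  from f_inv_into_f[OF this] inv_into_into[OF this]
  show "M (fill_time z) = max z 0" "0 \<le> fill_time z" by (auto simp: fill_time_def char_time_def)
qed

lemma fill_time_less_iff: assumes "0 \<le> t" shows "fill_time z < t \<longleftrightarrow> max z 0 < M t"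
  using M_strict_mono[of "fill_time z" t] M_mono[of t "fill_time z"] fill_time_nonneg[of z] assms
  unfolding M_fill_time by (auto simp: not_less[symmetric])

lemma fill_time_mono: assumes "x \<le> y" shows "fill_time x \<le> fill_time y"
proof (rule ccontr)
  assume "\<not> fill_time x \<le> fill_time y"
  then have "fill_time y < fill_time x" by simp
  then have "max y 0 < max x 0" using fill_time_less_iff[OF fill_time_nonneg, of y x] by (simp add: M_fill_time)
  then show False using assms by auto
qed

lemma fill_time_measurable[measurable]: "fill_time \<in> borel_measurable borel"
  by (rule borel_measurable_mono) (auto intro!: monoI fill_time_mono)

lemma fill_time_pos: "0 < z \<Longrightarrow> 0 < fill_time z"
  using M_fill_time[of z] M_0 fill_time_nonneg[of z] by (cases "fill_time z = 0") auto

lemma m_fill_time_measurable[measurable]: "(\<lambda>z. m (fill_time z)) \<in> borel_measurable borel"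
  using measurable_compose[OF fill_time_measurable m_max_measurable] fill_time_nonneg by (simp add: max_absorb1)

lemma m_fill_time_le: "\<bar>m (fill_time z)\<bar> \<le> m0"
  using m_le[OF fill_time_nonneg] m_pos[OF fill_time_nonneg, of z] by simp

text \<open>
  The law of the exit delay: at rate \<open>C / \<theta>\<close>, at least \<open>C\<close> documents are requested within \<open>t\<close> with the
  probability that the \<open>C\<close>-th arrival of a Poisson process of this rate precedes \<open>M t\<close>.
\<close>

lemma fill_law:
  assumes C: "1 \<le> C" and \<theta>: "0 < \<theta>" and t: "0 < t"
  shows "measure (gamma_law C \<theta>) {z. fill_time z < t} = poisson_tail C (real C / \<theta> * M t)"
proof -
  have Mt: "0 < M t" using M_strict_mono[of 0 t] t by (simp add: M_0)
  have l: "0 < real C / \<theta>" using C \<theta> by simp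
  have e: "{z. fill_time z < t} = {..<M t}"
    using t Mt by (auto simp: fill_time_less_iff)
  have "emeasure (gamma_law C \<theta>) {..<M t} = emeasure (gamma_law C \<theta>) {..M t}"
  proof (rule emeasure_eq_AE)
    have "AE z in lborel. z \<noteq> M t" by (rule AE_lborel_singleton)
    then show "AE z in gamma_law C \<theta>. z \<in> {..<M t} \<longleftrightarrow> z \<in> {..M t}"
      unfolding gamma_law_def by (subst AE_density) (auto elim!: eventually_mono)
  qed auto
  also have "\<dots> = ennreal (erlang_CDF (C - 1) (real C / \<theta>) (M t))"
    unfolding gamma_law_def using l by (rule emeasure_erlang_density)
  also have "erlang_CDF (C - 1) (real C / \<theta>) (M t) = poisson_tail C (real C / \<theta> * M t)"
    using mult_nonneg_nonneg[OF less_imp_le[OF l] less_imp_le[OF Mt]]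
    by (subst erlang_CDF_transform[OF l], subst poisson_tail_erlang[OF C]) auto
  finally have "emeasure (gamma_law C \<theta>) {..<M t} = ennreal (poisson_tail C (real C / \<theta> * M t))" .
  moreover have "0 \<le> poisson_tail C (real C / \<theta> * M t)"
    using mult_nonneg_nonneg[OF less_imp_le[OF l] less_imp_le[OF Mt]] by (simp add: poisson_tail_erlang[OF C])
  ultimately show ?thesis unfolding e measure_def by simp
qed

lemma M_has_derivative:
  assumes cont: "\<And>t. 0 < t \<Longrightarrow> isCont m t" and t: "0 < t"
  shows "(M has_real_derivative m t) (at t)"
proof -
  \<comment> \<open>the base point \<open>t / 2\<close> keeps away from 0, where \<open>m\<close> need not be continuous\<close>
  have "((\<lambda>x. integral {t / 2..x} m) has_real_derivative m t) (at t within {t / 2..2 * t})"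
    using t cont by (intro integral_has_real_derivative continuous_at_imp_continuous_on) auto
  then have "((\<lambda>x. integral {t / 2..x} m) has_real_derivative m t) (at t)"
    using t by (simp add: at_within_interior[of t "{t / 2..2 * t}"])
  then have "((\<lambda>x. integral {t / 2..x} m + M (t / 2)) has_real_derivative m t) (at t)"
    by (auto intro!: derivative_eq_intros)
  then show ?thesis
  proof (rule has_field_derivative_transform_within[of _ _ _ _ "t / 2"])
    fix x assume "dist x t < t / 2"
    then have "t / 2 \<le> x" using t by (auto simp: dist_real_def abs_if split: if_splits)
    then show "integral {t / 2..x} m + M (t / 2) = M x"
      using M_diff(1)[of "t / 2" x] t by simp
  qed (use t in auto)
qed

text \<open>
  \<open>M\<close> has slope at least \<open>c > 0\<close>, so its inverse is Lipschitz with constant \<open>1 / c\<close>.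
\<close>

lemma fill_time_isCont: "isCont fill_time z"
proof -
  obtain c where c: "0 < c" "\<And>r. 0 \<le> r \<Longrightarrow> c \<le> m r" using m_lower by auto
  have le: "c * (fill_time y - fill_time x) \<le> y - x" if "x \<le> y" for x y
    using M_diff_ge[OF c(2) fill_time_nonneg fill_time_mono[OF that]] that unfolding M_fill_time by (auto simp: max_def split: if_splits)
  have "\<bar>fill_time y - fill_time x\<bar> \<le> \<bar>y - x\<bar> / c" for x y
    using le[of x y] le[of y x] fill_time_mono[of x y] fill_time_mono[of y x] c(1)
    by (cases "x \<le> y") (auto simp: field_simps abs_if)
  then have "(fill_time \<longlongrightarrow> fill_time z) (at z)"
    by (intro Lim_transform_bound[of "\<lambda>y. fill_time y - fill_time z" "\<lambda>y. (y - z) / c", THEN LIM_zero_cancel])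
       (auto intro!: tendsto_eq_intros simp: c(1) less_imp_neq[OF c(1), symmetric] abs_of_pos[OF c(1)])
  then show ?thesis by (simp add: isCont_def)
qed

lemma fill_time_derivative:
  assumes cont: "\<And>t. 0 < t \<Longrightarrow> isCont m t" and z: "0 < z"
  shows "(fill_time has_real_derivative inverse (m (fill_time z))) (at z)"
proof (rule DERIV_inverse_function[of "M" _ _ _ 0 "z + 1"])
  show "(M has_real_derivative m (fill_time z)) (at (fill_time z))"
    by (rule M_has_derivative[OF cont fill_time_pos[OF z]])
  show "m (fill_time z) \<noteq> 0" using m_pos[OF fill_time_nonneg, of z] by simp
qed (use z fill_time_isCont in \<open>auto simp: M_fill_time\<close>)

text \<open>
  The function \<open>m \<circ> M^{-1}\<close> is bounded and has derivative \<open>(m' / m) \<circ> M^{-1}\<close>. Its second derivative at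
  \<open>\<theta>\<close>, denoted \<open>D\<close>, is \<open>(m'' - m'^2 / m) / m^2\<close> at \<open>t\<^sub>\<theta>\<close>, so that \<open>e(t\<^sub>\<theta>) = \<theta>^2 D / 2\<close>.
\<close>

lemma gamma_mean_expansion:
  assumes \<theta>: "0 < \<theta>"
    and m1: "\<And>t. 0 < t \<Longrightarrow> m differentiable (at t)"
    and m2: "\<And>t. 0 < t \<Longrightarrow> deriv m differentiable (at t)"
  shows "(\<lambda>C. (\<integral>z. m (fill_time z) \<partial>gamma_law C \<theta>) - (m (char_time P lam \<theta>) + e_fun P lam \<theta> / real C)) \<in> o(\<lambda>C. 1 / real C)"
proof -
  define f where "f z = m (fill_time z)" for z
  define f' where "f' z = deriv m (fill_time z) * inverse (m (fill_time z))" for z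
  define t where "t = fill_time \<theta>"
  have t: "t = char_time P lam \<theta>" "0 < t" using \<theta> fill_time_pos[OF \<theta>] by (auto simp: t_def fill_time_def)
  define D where "D = (deriv (deriv m) t - (deriv m t)\<^sup>2 / m t) / (m t)\<^sup>2"
  have dm: "(m has_real_derivative deriv m s) (at s)" if "0 < s" for s
    using m1[OF that] by (simp add: DERIV_deriv_iff_real_differentiable)
  have d2m: "(deriv m has_real_derivative deriv (deriv m) s) (at s)" if "0 < s" for s
    using m2[OF that] by (simp add: DERIV_deriv_iff_real_differentiable)
  have cont: "isCont m s" if "0 < s" for s using dm[OF that] by (rule DERIV_isCont)
  have df: "(f has_real_derivative f' z) (at z)" if "\<bar>z - \<theta>\<bar> < \<theta>" for z
  proof -
    have z: "0 < z" using that by linarith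
    show ?thesis unfolding f_def f'_def
      by (rule DERIV_chain2[OF dm[OF fill_time_pos[OF z]] fill_time_derivative[OF cont z]])
  qed
  have mt: "0 < m t" using m_pos t by simp
  have df': "(f' has_real_derivative D) (at \<theta>)"
  proof -
    note dT = fill_time_derivative[OF cont \<theta>]
    have 1: "((\<lambda>z. deriv m (fill_time z)) has_real_derivative deriv (deriv m) t * inverse (m t)) (at \<theta>)"
      unfolding t_def by (rule DERIV_chain2[OF d2m[OF fill_time_pos[OF \<theta>]] dT])
    have 2: "((\<lambda>z. m (fill_time z)) has_real_derivative deriv m t * inverse (m t)) (at \<theta>)"
      unfolding t_def by (rule DERIV_chain2[OF dm[OF fill_time_pos[OF \<theta>]] dT])
    have "((\<lambda>z. deriv m (fill_time z) / m (fill_time z)) has_real_derivative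
        (deriv (deriv m) t * inverse (m t) * m (fill_time \<theta>) - deriv m (fill_time \<theta>) * (deriv m t * inverse (m t))) / (m (fill_time \<theta>) * m (fill_time \<theta>))) (at \<theta>)"
      by (rule DERIV_divide[OF 1 2]) (use mt in \<open>simp add: t_def\<close>)
    also have "(deriv (deriv m) t * inverse (m t) * m (fill_time \<theta>) - deriv m (fill_time \<theta>) * (deriv m t * inverse (m t))) / (m (fill_time \<theta>) * m (fill_time \<theta>)) = D"
      using mt unfolding D_def t_def[symmetric] by (simp add: field_simps power2_eq_square)
    finally show ?thesis unfolding f'_def[abs_def] divide_inverse .
  qed
  have "(\<lambda>n. (\<integral>z. f z \<partial>gamma_law n \<theta>) - (f \<theta> + \<theta>\<^sup>2 / 2 * D / real n)) \<in> o(\<lambda>n. 1 / real n)"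
  proof (rule gamma_law_expansion[OF \<theta>, where K=m0 and ?f1.0="f' \<theta>"])
    show "f \<in> borel_measurable borel" unfolding f_def by measurable
    show "\<bar>f z\<bar> \<le> m0" for z unfolding f_def by (rule m_fill_time_le)
    show "\<exists>d>0. \<forall>z. \<bar>z - \<theta>\<bar> < d \<longrightarrow> \<bar>f z - f \<theta> - f' \<theta> * (z - \<theta>) - D / 2 * (z - \<theta>)\<^sup>2\<bar> \<le> \<epsilon> * (z - \<theta>)\<^sup>2" if "0 < \<epsilon>" for \<epsilon>
      by (rule second_order_remainder[OF \<theta> df df' that])
  qed
  moreover have "\<theta>\<^sup>2 / 2 * D = e_fun P lam \<theta>"
    unfolding e_fun_def D_def t(1) by (simp add: Let_def)
  moreover have "f \<theta> = m (char_time P lam \<theta>)" by (simp add: f_def t_def[symmetric] t(1))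
  ultimately show ?thesis by (simp add: f_def)
qed

end

section \<open>The expected number of misses as a gamma mean\<close>

lemma poisson_tail_continuous: "continuous_on UNIV (poisson_tail C)"
  unfolding poisson_tail_def by (intro continuous_intros) auto

text \<open>
  \<open>\<rho>\<close> is the law of the rest; the two count assumptions are the Poisson laws of \<open>rest_probabilities\<close>.
\<close>

locale lru_model = tagged_document P lam \<eta> + rest: prob_space \<rho>
  for P :: "'p measure" and lam and \<eta> and \<rho> :: "(real \<times> real set) set measure" +
  fixes \<gamma> :: real and C :: nat
  assumes sets_rest[measurable_cong]: "sets \<rho> = sets marked_configurations"
    and \<gamma>: "0 < \<gamma>" and C: "1 \<le> C"
    and active: "\<And>s t k. s \<le> t \<Longrightarrow> measure \<rho> {R \<in> space \<rho>. enat k \<le> new_docs R {} {s..t}} = poisson_tail k (\<gamma> * M (t - s))"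
    and increment: "\<And>s t t' k. s \<le> t \<Longrightarrow> t \<le> t' \<Longrightarrow> measure \<rho> {R \<in> space \<rho>. enat k \<le> new_docs R {s..t} {s..t'}}
      = poisson_tail k (\<gamma> * (M (t' - s) - M (t - s)))"
begin

lemma new_docs_rest_measurable[measurable]:
  assumes [measurable]: "B \<in> sets borel" "B' \<in> sets borel"
  shows "(\<lambda>R. new_docs R B B') \<in> measurable \<rho> (count_space UNIV)"
  unfolding measurable_cong_sets[OF sets_rest refl] by measurable

lemma steady_fill_measurable[measurable]: "Measurable.pred \<rho> (steady_fill C \<delta> s j)"
  unfolding steady_fill_def[abs_def] by measurable

text \<open>
  The count \<open>C\<close> is reached in the window with probability \<open>poisson_tail C\<close>. Of this, a request in the
  first cell costs \<open>O(\<delta>)\<close>, and a double jump in one of the \<open>j\<close> steps costs \<open>j O(\<delta>^2)\<close>, which is \<open>O(\<delta>)\<close> as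
  long as the window \<open>j \<delta>\<close> stays bounded.
\<close>

lemma steady_fill_prob:
  assumes d: "0 < \<delta>"
  shows "measure \<rho> {R \<in> space \<rho>. steady_fill C \<delta> s j R} \<le> poisson_tail C (\<gamma> * M (real j * \<delta>))"
    and "poisson_tail C (\<gamma> * M (real j * \<delta>)) - \<gamma> * m0 * \<delta> - real j * \<delta> * (\<gamma> * m0)\<^sup>2 * \<delta>
      \<le> measure \<rho> {R \<in> space \<rho>. steady_fill C \<delta> s j R}"
proof -
  define S where "S = {R \<in> space \<rho>. enat C \<le> new_docs R {} {s..s + real j * \<delta>}}"
  define G where "G = {R \<in> space \<rho>. steady_fill C \<delta> s j R}"
  define A0 where "A0 = {R \<in> space \<rho>. enat 1 \<le> new_docs R {} {s..s + \<delta>}}"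
  define A where "A i = {R \<in> space \<rho>. enat 2 \<le> new_docs R {s..s + real i * \<delta>} {s..s + (real i + 1) * \<delta>}}" for i :: nat
  have [measurable]: "S \<in> sets \<rho>" "G \<in> sets \<rho>" "A0 \<in> sets \<rho>" "A i \<in> sets \<rho>" for i
    unfolding S_def G_def A0_def A_def by measurable
  have jd: "s \<le> s + real j * \<delta>" using d by simp
  have S: "measure \<rho> S = poisson_tail C (\<gamma> * M (real j * \<delta>))"
    unfolding S_def active[OF jd] by simp
  have "G \<subseteq> S" by (auto simp: G_def S_def steady_fill_def)
  then have "measure \<rho> G \<le> measure \<rho> S" by (intro rest.finite_measure_mono) auto
  then show "measure \<rho> {R \<in> space \<rho>. steady_fill C \<delta> s j R} \<le> poisson_tail C (\<gamma> * M (real j * \<delta>))"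
    unfolding S G_def .
  have A0: "measure \<rho> A0 \<le> \<gamma> * m0 * \<delta>"
  proof -
    have "measure \<rho> A0 = poisson_tail 1 (\<gamma> * M \<delta>)" unfolding A0_def using active[of s "s + \<delta>" 1] d by simp
    also have "\<dots> \<le> \<gamma> * M \<delta>" by (rule poisson_tail_1_le)
    also have "\<dots> \<le> \<gamma> * (m0 * \<delta>)" using M_diff_le[of 0 \<delta>] d \<gamma> by (intro mult_left_mono) (auto simp: M_0)
    finally show ?thesis by (simp add: mult.assoc)
  qed
  have A: "measure \<rho> (A i) \<le> (\<gamma> * m0 * \<delta>)\<^sup>2" for i
  proof -
    define \<nu> where "\<nu> = \<gamma> * (M ((real i + 1) * \<delta>) - M (real i * \<delta>))"
    have o: "0 \<le> real i * \<delta>" "real i * \<delta> \<le> (real i + 1) * \<delta>" using d by (auto simp: ring_distribs)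
    have "measure \<rho> (A i) = poisson_tail 2 \<nu>"
      unfolding A_def \<nu>_def using increment[of s "s + real i * \<delta>" "s + (real i + 1) * \<delta>" 2] o by simp
    also have "\<dots> \<le> \<nu>\<^sup>2" using \<gamma> M_mono[OF o] by (intro poisson_tail_2_le) (auto simp: \<nu>_def)
    also have "\<dots> \<le> (\<gamma> * m0 * \<delta>)\<^sup>2"
    proof (rule power_mono)
      have "M ((real i + 1) * \<delta>) - M (real i * \<delta>) \<le> m0 * \<delta>"
        using M_diff_le[OF o] by (simp add: algebra_simps)
      then show "\<nu> \<le> \<gamma> * m0 * \<delta>" unfolding \<nu>_def mult.assoc using \<gamma> by (intro mult_left_mono) auto
      show "0 \<le> \<nu>" using \<gamma> M_mono[OF o] by (auto simp: \<nu>_def)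
    qed
    finally show ?thesis .
  qed
  have "S \<subseteq> G \<union> (A0 \<union> (\<Union>i\<in>{1..<j}. A i))"
    by (auto simp: S_def G_def A0_def A_def steady_fill_def one_enat_def numeral_eq_enat)
  then have "measure \<rho> S \<le> measure \<rho> (G \<union> (A0 \<union> (\<Union>i\<in>{1..<j}. A i)))"
    by (intro rest.finite_measure_mono) auto
  also have "\<dots> \<le> measure \<rho> G + measure \<rho> (A0 \<union> (\<Union>i\<in>{1..<j}. A i))"
    by (rule measure_Un_le) auto
  also have "measure \<rho> (A0 \<union> (\<Union>i\<in>{1..<j}. A i)) \<le> measure \<rho> A0 + measure \<rho> (\<Union>i\<in>{1..<j}. A i)"
    by (rule measure_Un_le) auto
  also have "measure \<rho> (\<Union>i\<in>{1..<j}. A i) \<le> (\<Sum>i\<in>{1..<j}. measure \<rho> (A i))"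
    by (rule measure_UNION_le) auto
  also have "\<dots> \<le> (\<Sum>i\<in>{1..<j}. (\<gamma> * m0 * \<delta>)\<^sup>2)" by (rule sum_mono) (rule A)
  also have "\<dots> \<le> real j * (\<gamma> * m0 * \<delta>)\<^sup>2" by (simp add: mult_right_mono)
  finally have "measure \<rho> S \<le> measure \<rho> G + (measure \<rho> A0 + real j * (\<gamma> * m0 * \<delta>)\<^sup>2)" by simp
  then show "poisson_tail C (\<gamma> * M (real j * \<delta>)) - \<gamma> * m0 * \<delta> - real j * \<delta> * (\<gamma> * m0)\<^sup>2 * \<delta>
      \<le> measure \<rho> {R \<in> space \<rho>. steady_fill C \<delta> s j R}"
    using A0 unfolding S G_def[symmetric] by (simp add: power_mult_distrib power2_eq_square mult_ac)
qed

text \<open>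
  The number of misses with the miss event replaced by an event \<open>E i j\<close> of the rest, where the indices \<open>i\<close>
  and \<open>j\<close> are grid roundings of the request times.
\<close>

definition grid_sum :: "(int \<Rightarrow> nat \<Rightarrow> (real \<times> real set) set \<Rightarrow> bool) \<Rightarrow> (real \<Rightarrow> int) \<Rightarrow> (real \<Rightarrow> real \<Rightarrow> nat)
    \<Rightarrow> real set \<Rightarrow> (real \<times> real set) set \<Rightarrow> real" where
  "grid_sum E i j y R = request_sum (\<lambda>s t. of_bool (E (i s) (j s t) R)) y"

text \<open>
  As the indices take countably many values, the sum is jointly measurable in the two independent
  objects, and Fubini's theorem integrates out the rest at fixed request times. The hypothesis \<open>joint\<close>
  expresses the independence.
\<close>

lemma grid_sum_mean:
  assumes O: "prob_space Om" and X: "X \<in> measurable Om (configurations borel)" and R: "R \<in> measurable Om marked_configurations"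
    and joint: "distr Om (\<eta> \<Otimes>\<^sub>M \<rho>) (\<lambda>w. (X w, R w)) = \<eta> \<Otimes>\<^sub>M \<rho>"
    and E: "\<And>i j. Measurable.pred \<rho> (E i j)"
    and i[measurable]: "i \<in> measurable borel (count_space UNIV)"
    and j[measurable]: "(\<lambda>(s, t). j s t) \<in> measurable (borel \<Otimes>\<^sub>M borel) (count_space UNIV)"
  shows "integrable Om (\<lambda>w. grid_sum E i j (X w) (R w))"
    and "(\<integral>w. grid_sum E i j (X w) (R w) \<partial>Om) =
      (\<integral>y. request_sum (\<lambda>s t. measure \<rho> {R \<in> space \<rho>. E (i s) (j s t) R}) y \<partial>\<eta>)"
    and "(\<lambda>y. request_sum (\<lambda>s t. measure \<rho> {R \<in> space \<rho>. E (i s) (j s t) R}) y)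
      \<in> borel_measurable \<eta>"
proof -
  interpret O: prob_space Om by fact
  interpret PP: pair_prob_space \<eta> \<rho> ..
  have Hm: "(\<lambda>p. grid_sum E i j (fst p) (snd p)) \<in> borel_measurable (\<eta> \<Otimes>\<^sub>M \<rho>)"
  proof -
    have Er: "(\<lambda>p. of_bool (E (i (nth_request (r - 1) (snd p))) (j (nth_request (r - 1) (snd p)) (nth_request r (snd p))) (fst p)) :: real) \<in> borel_measurable (\<rho> \<Otimes>\<^sub>M \<eta>)" for r
    proof -
      have 1: "(\<lambda>p. i (nth_request (r - 1) (snd p))) \<in> measurable (\<rho> \<Otimes>\<^sub>M \<eta>) (count_space UNIV)" by measurable
      have "(\<lambda>p. (nth_request (r - 1) (snd p), nth_request r (snd p))) \<in> measurable (\<rho> \<Otimes>\<^sub>M \<eta>) (borel \<Otimes>\<^sub>M borel)" by measurable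
      from measurable_compose[OF this j] have 2: "(\<lambda>p. j (nth_request (r - 1) (snd p)) (nth_request r (snd p))) \<in> measurable (\<rho> \<Otimes>\<^sub>M \<eta>) (count_space UNIV)" by simp
      have idx: "(\<lambda>p. (i (nth_request (r - 1) (snd p)), j (nth_request (r - 1) (snd p)) (nth_request r (snd p)))) \<in> measurable (\<rho> \<Otimes>\<^sub>M \<eta>) (count_space UNIV)"
        using measurable_Pair[OF 1 2] by (simp add: pair_measure_countable)
      have Em: "(\<lambda>p. of_bool (E (fst q) (snd q) (fst p)) :: real) \<in> borel_measurable (\<rho> \<Otimes>\<^sub>M \<eta>)" for q
        using measurable_compose[OF measurable_fst E[of "fst q" "snd q"], of \<eta>] by measurable
      show ?thesis
        using measurable_compose_countable[where f="\<lambda>q p. of_bool (E (fst q) (snd q) (fst p)) :: real", OF Em idx] by simp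
    qed
    have "(\<lambda>p. grid_sum E i j (snd p) (fst p)) \<in> borel_measurable (\<rho> \<Otimes>\<^sub>M \<eta>)"
      unfolding grid_sum_def by (rule request_sum_measurable[of "\<lambda>R s t. of_bool (E (i s) (j s t) R)", OF Er])
    from measurable_compose[OF measurable_Pair[OF measurable_snd measurable_fst] this] show ?thesis by simp
  qed
  have bound: "0 \<le> grid_sum E i j y R" "grid_sum E i j y R \<le> real (card y)" for y R
    unfolding grid_sum_def by (auto intro: request_sum_bounds)
  have Hint: "integrable (\<eta> \<Otimes>\<^sub>M \<rho>) (\<lambda>p. grid_sum E i j (fst p) (snd p))"
  proof (rule Bochner_Integration.integrable_bound[OF _ Hm])
    show "integrable (\<eta> \<Otimes>\<^sub>M \<rho>) (\<lambda>p. real (card (fst p)))"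
    proof (rule integrable_distr[OF measurable_fst])
      show "integrable (distr (\<eta> \<Otimes>\<^sub>M \<rho>) \<eta> fst) (\<lambda>y. real (card y))"
        using card_integrable by (simp add: rest.distr_pair_fst)
    qed
    show "AE p in \<eta> \<Otimes>\<^sub>M \<rho>. norm (grid_sum E i j (fst p) (snd p)) \<le> norm (real (card (fst p)))"
      using bound by auto
  qed
  have XR: "(\<lambda>w. (X w, R w)) \<in> measurable Om (\<eta> \<Otimes>\<^sub>M \<rho>)"
    using X R by (intro measurable_Pair) (simp_all add: measurable_cong_sets[OF refl sets_doc] measurable_cong_sets[OF refl sets_rest])
  show "integrable Om (\<lambda>w. grid_sum E i j (X w) (R w))"
  proof -
    have "integrable (distr Om (\<eta> \<Otimes>\<^sub>M \<rho>) (\<lambda>w. (X w, R w))) (\<lambda>p. grid_sum E i j (fst p) (snd p))"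
      unfolding joint by (rule Hint)
    from integrable_distr[OF XR this] show ?thesis by simp
  qed
  have "(\<integral>w. grid_sum E i j (X w) (R w) \<partial>Om) = (\<integral>p. grid_sum E i j (fst p) (snd p) \<partial>(\<eta> \<Otimes>\<^sub>M \<rho>))"
    using integral_distr[OF XR Hm] unfolding joint by simp
  also have "\<dots> = (\<integral>y. (\<integral>R. grid_sum E i j y R \<partial>\<rho>) \<partial>\<eta>)"
    using PP.integral_fst'[OF Hint] by simp
  finally have I: "(\<integral>w. grid_sum E i j (X w) (R w) \<partial>Om) = (\<integral>y. (\<integral>R. grid_sum E i j y R \<partial>\<rho>) \<partial>\<eta>)" .
  have inner: "(\<integral>R. grid_sum E i j y R \<partial>\<rho>) = request_sum (\<lambda>s t. measure \<rho> {R \<in> space \<rho>. E (i s) (j s t) R}) y" for y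
  proof -
    have ie: "integrable \<rho> (\<lambda>R. of_bool (E a b R) :: real)" for a b
      using E[of a b] by (intro rest.integrable_const_bound[of _ 1]) auto
    have "(\<integral>R. (of_bool (E a b R) :: real) \<partial>\<rho>) = measure \<rho> {R \<in> space \<rho>. E a b R}" for a b
    proof -
      have "(\<integral>R. (of_bool (E a b R) :: real) \<partial>\<rho>) = (\<integral>R. indicat_real {R \<in> space \<rho>. E a b R} R \<partial>\<rho>)"
        by (intro Bochner_Integration.integral_cong) (auto split: split_indicator)
      then show ?thesis using E[of a b] by simp
    qed
    then show ?thesis unfolding grid_sum_def request_sum_def using ie rest.prob_space
      by (subst Bochner_Integration.integral_add) (simp_all add: Bochner_Integration.integral_sum del: sum_of_bool_eq)
  qed
  show "(\<integral>w. grid_sum E i j (X w) (R w) \<partial>Om) =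
      (\<integral>y. request_sum (\<lambda>s t. measure \<rho> {R \<in> space \<rho>. E (i s) (j s t) R}) y \<partial>\<eta>)"
    unfolding I inner ..
  have "(\<lambda>y. \<integral>R. grid_sum E i j y R \<partial>\<rho>) \<in> borel_measurable \<eta>"
    using Hm by (intro rest.borel_measurable_lebesgue_integral) (simp add: split_beta')
  then show "(\<lambda>y. request_sum (\<lambda>s t. measure \<rho> {R \<in> space \<rho>. E (i s) (j s t) R}) y)
      \<in> borel_measurable \<eta>" unfolding inner .
qed

definition start_cell :: "nat \<Rightarrow> real \<Rightarrow> int" where "start_cell n s = \<lfloor>s / mesh n\<rfloor>"
text \<open>
  Grid steps from the cell of \<open>s\<close>: the inner window ends strictly before \<open>t\<close> (whence the ceiling minus
  1), the outer window contains \<open>[s, t]\<close>.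
\<close>

definition inner_steps :: "nat \<Rightarrow> real \<Rightarrow> real \<Rightarrow> nat" where
  "inner_steps n s t = nat (\<lceil>t / mesh n\<rceil> - 1 - \<lfloor>s / mesh n\<rfloor>)"
definition outer_steps :: "nat \<Rightarrow> real \<Rightarrow> real \<Rightarrow> nat" where
  "outer_steps n s t = nat (\<lfloor>t / mesh n\<rfloor> + 1 - \<lfloor>s / mesh n\<rfloor>)"
definition inner_event :: "nat \<Rightarrow> int \<Rightarrow> nat \<Rightarrow> (real \<times> real set) set \<Rightarrow> bool" where
  "inner_event n i j = steady_fill C (mesh n) (real_of_int i * mesh n) j"
definition outer_event :: "nat \<Rightarrow> int \<Rightarrow> nat \<Rightarrow> (real \<times> real set) set \<Rightarrow> bool" where
  "outer_event n i j R \<longleftrightarrow> enat C \<le> new_docs R {} {real_of_int i * mesh n..real_of_int i * mesh n + real j * mesh n}"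

lemma steps_bounds:
  assumes "s < t"
  shows "real_of_int (start_cell n s) * mesh n \<le> s" "s \<le> real_of_int (start_cell n s) * mesh n + mesh n"
    and "real_of_int (start_cell n s) * mesh n + real (inner_steps n s t) * mesh n < t"
    and "t \<le> real_of_int (start_cell n s) * mesh n + real (outer_steps n s t) * mesh n"
    and "\<bar>real (inner_steps n s t) * mesh n - (t - s)\<bar> \<le> 2 * mesh n"
    and "\<bar>real (outer_steps n s t) * mesh n - (t - s)\<bar> \<le> 2 * mesh n"
proof -
  define d where "d = mesh n"
  have d: "0 < d" by (simp add: d_def)
  define x where "x = s / d"
  define z where "z = t / d"
  have st: "s = x * d" "t = z * d" using d by (simp_all add: x_def z_def)
  have xz: "x < z" using assms d by (simp add: x_def z_def divide_strict_right_mono)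
  have fx: "of_int \<lfloor>x\<rfloor> \<le> x" "x < of_int \<lfloor>x\<rfloor> + 1" and fz: "of_int \<lfloor>z\<rfloor> \<le> z" "z < of_int \<lfloor>z\<rfloor> + 1"
    and cz: "z \<le> of_int \<lceil>z\<rceil>" "of_int \<lceil>z\<rceil> < z + 1" by linarith+
  have "real_of_int \<lfloor>x\<rfloor> < of_int \<lceil>z\<rceil>" "\<lfloor>x\<rfloor> \<le> \<lfloor>z\<rfloor>" using fx cz xz by (linarith, simp add: floor_mono)
  then have nn: "0 \<le> \<lceil>z\<rceil> - 1 - \<lfloor>x\<rfloor>" "0 \<le> \<lfloor>z\<rfloor> + 1 - \<lfloor>x\<rfloor>" by linarith+
  have i: "real (inner_steps n s t) = of_int \<lceil>z\<rceil> - 1 - of_int \<lfloor>x\<rfloor>"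
    unfolding inner_steps_def d_def[symmetric] x_def[symmetric] z_def[symmetric] using nn(1) by simp
  have o: "real (outer_steps n s t) = of_int \<lfloor>z\<rfloor> + 1 - of_int \<lfloor>x\<rfloor>"
    unfolding outer_steps_def d_def[symmetric] x_def[symmetric] z_def[symmetric] using nn(2) by simp
  have sc: "real_of_int (start_cell n s) = of_int \<lfloor>x\<rfloor>" by (simp add: start_cell_def x_def d_def)
  note mult = mult_right_mono[OF _ less_imp_le[OF d]]
  show "real_of_int (start_cell n s) * mesh n \<le> s"
    unfolding sc d_def[symmetric] using mult[OF fx(1)] by (simp only: st)
  have "x * d \<le> of_int \<lfloor>x\<rfloor> * d + d" using mult[OF less_imp_le[OF fx(2)]] by (simp only: ring_distribs mult_1_left)
  then show "s \<le> real_of_int (start_cell n s) * mesh n + mesh n"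
    unfolding sc d_def[symmetric] by (simp only: st)
  have "(of_int \<lfloor>x\<rfloor> + real (inner_steps n s t)) * d < z * d" using cz d by (intro mult_strict_right_mono) (simp_all add: i)
  then show "real_of_int (start_cell n s) * mesh n + real (inner_steps n s t) * mesh n < t"
    unfolding sc d_def[symmetric] by (simp only: st(2) ring_distribs)
  have "z * d \<le> (of_int \<lfloor>x\<rfloor> + real (outer_steps n s t)) * d" using fz by (intro mult) (simp add: o)
  then show "t \<le> real_of_int (start_cell n s) * mesh n + real (outer_steps n s t) * mesh n"
    unfolding sc d_def[symmetric] by (simp only: st(2) ring_distribs)
  have ab: "\<bar>r * d - (t - s)\<bar> \<le> 2 * d" if "\<bar>r - (z - x)\<bar> \<le> 2" for r
  proof -
    have "\<bar>r * d - (t - s)\<bar> = \<bar>(r - (z - x)) * d\<bar>" by (simp add: st algebra_simps)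
    also have "\<dots> = \<bar>r - (z - x)\<bar> * d" using d by (simp add: abs_mult)
    finally show ?thesis using mult[OF that] by simp
  qed
  show "\<bar>real (inner_steps n s t) * mesh n - (t - s)\<bar> \<le> 2 * mesh n"
    using ab[of "real (inner_steps n s t)"] fx cz i by (simp add: d_def abs_le_iff)
  show "\<bar>real (outer_steps n s t) * mesh n - (t - s)\<bar> \<le> 2 * mesh n"
    using ab[of "real (outer_steps n s t)"] fx fz o by (simp add: d_def abs_le_iff)
qed

text \<open>
  Pathwise and for every configuration of the rest: a steady filling in the inner window forces a miss,
  and a miss forces \<open>C\<close> active documents in the outer window.
\<close>

lemma misses_bounds:
  shows "grid_sum (inner_event n) (start_cell n) (inner_steps n) y R \<le> misses C y R"
    and "misses C y R \<le> grid_sum (outer_event n) (start_cell n) (outer_steps n) y R"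
proof -
  have mi: "misses C y R = request_sum (\<lambda>s t. of_bool (exit_time C R s < ereal t)) y"
    unfolding misses_def request_sum_def using request_time_nth_request[of _ y] by (auto intro!: sum.cong)
  show "grid_sum (inner_event n) (start_cell n) (inner_steps n) y R \<le> misses C y R"
    unfolding mi grid_sum_def
  proof (rule request_sum_mono)
    fix s t :: real assume "s < t"
    note b = steps_bounds[OF this, of n]
    show "of_bool (inner_event n (start_cell n s) (inner_steps n s t) R) \<le> (of_bool (exit_time C R s < ereal t) :: real)"
      using exit_before[OF C _ mesh_pos b(1,2,3), of R] by (auto simp: inner_event_def)
  qed
  show "misses C y R \<le> grid_sum (outer_event n) (start_cell n) (outer_steps n) y R"
    unfolding mi grid_sum_def
  proof (rule request_sum_mono)
    fix s t :: real assume "s < t"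
    note b = steps_bounds[OF this, of n]
    show "(of_bool (exit_time C R s < ereal t) :: real) \<le> of_bool (outer_event n (start_cell n s) (outer_steps n s t) R)"
      using exit_time_less_imp[OF _ b(1,4), of C R] by (auto simp: outer_event_def)
  qed
qed

lemma tail_tendsto:
  assumes st: "s < t" and x: "\<And>n. 0 \<le> x n" "\<And>n. \<bar>x n - (t - s)\<bar> \<le> 2 * mesh n"
  shows "(\<lambda>n. poisson_tail C (\<gamma> * M (x n))) \<longlonglongrightarrow> poisson_tail C (\<gamma> * M (t - s))"
    and "x \<longlonglongrightarrow> t - s"
proof -
  have "(\<lambda>n. 2 * mesh n) \<longlonglongrightarrow> 0" using tendsto_mult_right_zero[OF mesh_tendsto] .
  then have "(\<lambda>n. x n - (t - s)) \<longlonglongrightarrow> 0" by (rule Lim_null_comparison[rotated]) (use x in auto)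
  then show xl: "x \<longlonglongrightarrow> t - s" by (rule LIM_zero_cancel)
  have "(\<lambda>n. M (x n)) \<longlonglongrightarrow> M (t - s)"
    using st x by (intro continuous_on_tendsto_compose[OF M_continuous xl]) auto
  then show "(\<lambda>n. poisson_tail C (\<gamma> * M (x n))) \<longlonglongrightarrow> poisson_tail C (\<gamma> * M (t - s))"
    by (intro continuous_on_tendsto_compose[OF poisson_tail_continuous] tendsto_mult_left) auto
qed

text \<open>
  Both windows have length \<open>t - s\<close> up to two mesh widths, and asking for a steady filling costs \<open>O(\<delta>)\<close> by
  \<open>steady_fill_prob\<close>.
\<close>

lemma event_tendsto:
  assumes st: "s < t"
  shows "(\<lambda>n. measure \<rho> {R \<in> space \<rho>. outer_event n (start_cell n s) (outer_steps n s t) R}) \<longlonglongrightarrow> poisson_tail C (\<gamma> * M (t - s))"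
    and "(\<lambda>n. measure \<rho> {R \<in> space \<rho>. inner_event n (start_cell n s) (inner_steps n s t) R}) \<longlonglongrightarrow> poisson_tail C (\<gamma> * M (t - s))"
proof -
  have "measure \<rho> {R \<in> space \<rho>. outer_event n (start_cell n s) (outer_steps n s t) R} = poisson_tail C (\<gamma> * M (real (outer_steps n s t) * mesh n))" for n
    unfolding outer_event_def by (subst active) (auto simp: less_imp_le)
  then show "(\<lambda>n. measure \<rho> {R \<in> space \<rho>. outer_event n (start_cell n s) (outer_steps n s t) R}) \<longlonglongrightarrow> poisson_tail C (\<gamma> * M (t - s))"
    using tail_tendsto(1)[OF st _ steps_bounds(6)[OF st]] by (simp add: less_imp_le)
  define x where "x n = real (inner_steps n s t) * mesh n" for n
  have x: "0 \<le> x n" "\<bar>x n - (t - s)\<bar> \<le> 2 * mesh n" for n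
    using steps_bounds(5)[OF st, of n] by (auto simp: x_def less_imp_le)
  note lim = tail_tendsto[OF st x]
  show "(\<lambda>n. measure \<rho> {R \<in> space \<rho>. inner_event n (start_cell n s) (inner_steps n s t) R}) \<longlonglongrightarrow> poisson_tail C (\<gamma> * M (t - s))"
    unfolding inner_event_def
  proof (rule tendsto_sandwich[OF _ _ _ lim(1)])
    show "\<forall>\<^sub>F n in sequentially. poisson_tail C (\<gamma> * M (x n)) - \<gamma> * m0 * mesh n - x n * (\<gamma> * m0)\<^sup>2 * mesh n
      \<le> measure \<rho> {R \<in> space \<rho>. steady_fill C (mesh n) (real_of_int (start_cell n s) * mesh n) (inner_steps n s t) R}"
      unfolding x_def by (intro always_eventually allI steady_fill_prob(2)) simp
    show "\<forall>\<^sub>F n in sequentially. measure \<rho> {R \<in> space \<rho>. steady_fill C (mesh n) (real_of_int (start_cell n s) * mesh n) (inner_steps n s t) R}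
      \<le> poisson_tail C (\<gamma> * M (x n))"
      unfolding x_def by (intro always_eventually allI steady_fill_prob(1)) simp
    have "(\<lambda>n. poisson_tail C (\<gamma> * M (x n)) - \<gamma> * m0 * mesh n - x n * (\<gamma> * m0)\<^sup>2 * mesh n)
      \<longlonglongrightarrow> poisson_tail C (\<gamma> * M (t - s)) - \<gamma> * m0 * 0 - (t - s) * (\<gamma> * m0)\<^sup>2 * 0"
      by (intro tendsto_intros lim mesh_tendsto)
    then show "(\<lambda>n. poisson_tail C (\<gamma> * M (x n)) - \<gamma> * m0 * mesh n - x n * (\<gamma> * m0)\<^sup>2 * mesh n)
      \<longlonglongrightarrow> poisson_tail C (\<gamma> * M (t - s))" by simp
  qed
qed

text \<open>
  A gap of length \<open>t\<close> exceeds the exit delay with probability \<open>\<phi> t\<close>. The mean of a sum over gaps does not depend on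
  the joint law of the delays, so one delay \<open>fill_time z\<close>, with \<open>z\<close> of gamma law, may serve for all gaps.
  Exchanging the integrals over \<open>z\<close> and over the requests brings in \<open>long_gaps_mean\<close>.
\<close>

lemma gap_mean:
  assumes \<theta>: "0 < \<theta>" and \<gamma>\<theta>: "\<gamma> = real C / \<theta>"
  defines "\<phi> \<equiv> \<lambda>t. measure (gamma_law C \<theta>) {z. fill_time z < t}"
  shows "(\<integral>y. request_sum (\<lambda>s t. \<phi> (t - s)) y \<partial>\<eta>) = (\<integral>z. m (fill_time z) \<partial>gamma_law C \<theta>)"
    and "(\<lambda>y. request_sum (\<lambda>s t. \<phi> (t - s)) y) \<in> borel_measurable \<eta>"
proof -
  define \<nu> where "\<nu> = gamma_law C \<theta>"
  interpret \<nu>: prob_space \<nu> unfolding \<nu>_def by (rule prob_space_gamma_law[OF \<theta> C])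
  interpret PP: pair_prob_space \<nu> \<eta> ..
  have s\<nu>[measurable_cong]: "sets \<nu> = sets borel" and sp: "space \<nu> = UNIV" by (simp_all add: \<nu>_def)
  have Lm: "(\<lambda>p. long_gaps (fill_time (fst p)) (snd p)) \<in> borel_measurable (\<nu> \<Otimes>\<^sub>M \<eta>)"
    by (rule long_gaps_pair_measurable) measurable
  have Lint: "integrable (\<nu> \<Otimes>\<^sub>M \<eta>) (\<lambda>p. long_gaps (fill_time (fst p)) (snd p))"
  proof (rule Bochner_Integration.integrable_bound[OF _ Lm])
    have "(\<integral>\<^sup>+p. ennreal (real (card (snd p))) \<partial>(\<nu> \<Otimes>\<^sub>M \<eta>)) = (\<integral>\<^sup>+z. (\<integral>\<^sup>+y. ennreal (real (card y)) \<partial>\<eta>) \<partial>\<nu>)"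
      using measurable_compose[OF measurable_snd card_doc_measurable, of \<nu>] by (subst doc.nn_integral_fst[symmetric]) auto
    also have "\<dots> = (\<integral>\<^sup>+y. ennreal (real (card y)) \<partial>\<eta>)" by (simp add: \<nu>.emeasure_space_1)
    also have "\<dots> < \<infinity>" using card_integrable by (simp add: integrable_iff_bounded)
    finally show "integrable (\<nu> \<Otimes>\<^sub>M \<eta>) (\<lambda>p. real (card (snd p)))"
      using measurable_compose[OF measurable_snd card_doc_measurable, of \<nu>] by (intro integrableI_nonneg) auto
    show "AE p in \<nu> \<Otimes>\<^sub>M \<eta>. norm (long_gaps (fill_time (fst p)) (snd p)) \<le> norm (real (card (snd p)))"
      using long_gaps_bounds by auto
  qed
  have inner: "(\<integral>z. long_gaps (fill_time z) y \<partial>\<nu>) = request_sum (\<lambda>s t. \<phi> (t - s)) y" for y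
  proof -
    have S[measurable]: "{z. fill_time z < t} \<in> sets \<nu>" for t unfolding s\<nu> by measurable
    have e: "(\<lambda>z. of_bool (fill_time z < t) :: real) = indicat_real {z. fill_time z < t}" for t
      by (auto simp: fun_eq_iff)
    have ii: "integrable \<nu> (\<lambda>z. of_bool (fill_time z < t) :: real)" "(\<integral>z. of_bool (fill_time z < t) \<partial>\<nu>) = \<phi> t" for t
      unfolding e using S[of t] by (auto intro!: \<nu>.integrable_const_bound[of _ 1] simp: \<phi>_def \<nu>_def[symmetric] sp split: split_indicator)
    show ?thesis unfolding long_gaps_def request_sum_def using \<nu>.prob_space
      by (subst Bochner_Integration.integral_add) (simp_all add: ii Bochner_Integration.integral_sum del: sum_of_bool_eq)
  qed
  have "(\<integral>y. (\<integral>z. long_gaps (fill_time z) y \<partial>\<nu>) \<partial>\<eta>) = (\<integral>z. (\<integral>y. long_gaps (fill_time z) y \<partial>\<eta>) \<partial>\<nu>)"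
    using Lint by (intro PP.Fubini_integral) (simp add: split_beta')
  then show "(\<integral>y. request_sum (\<lambda>s t. \<phi> (t - s)) y \<partial>\<eta>) = (\<integral>z. m (fill_time z) \<partial>gamma_law C \<theta>)"
    unfolding inner by (simp add: long_gaps_mean fill_time_nonneg \<nu>_def)
  have "(\<lambda>p. long_gaps (fill_time (snd p)) (fst p)) \<in> borel_measurable (\<eta> \<Otimes>\<^sub>M \<nu>)"
    using measurable_compose[OF measurable_Pair[OF measurable_snd measurable_fst] Lm] by simp
  then have "(\<lambda>y. \<integral>z. long_gaps (fill_time z) y \<partial>\<nu>) \<in> borel_measurable \<eta>"
    by (intro \<nu>.borel_measurable_lebesgue_integral) (simp add: split_beta')
  then show "(\<lambda>y. request_sum (\<lambda>s t. \<phi> (t - s)) y) \<in> borel_measurable \<eta>"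
    unfolding inner .
qed

text \<open>
  The bounds of \<open>misses_bounds\<close> have integrals with a common limit, the mean of \<open>m \<circ> M^{-1}\<close> under the gamma
  law.
\<close>

lemma expected_misses_eq:
  assumes \<theta>: "0 < \<theta>" and \<gamma>\<theta>: "\<gamma> = real C / \<theta>"
    and O: "prob_space Om" and X: "X \<in> measurable Om (configurations borel)" and R: "R \<in> measurable Om marked_configurations"
    and joint: "distr Om (\<eta> \<Otimes>\<^sub>M \<rho>) (\<lambda>w. (X w, R w)) = \<eta> \<Otimes>\<^sub>M \<rho>"
  shows "expected_misses Om C X R = (\<integral>z. m (fill_time z) \<partial>gamma_law C \<theta>)"
proof -
  define \<phi> where "\<phi> t = measure (gamma_law C \<theta>) {z. fill_time z < t}" for t
  note gap = gap_mean[OF \<theta> \<gamma>\<theta>, folded \<phi>_def]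
  have \<phi>: "\<phi> t = poisson_tail C (\<gamma> * M t)" if "0 < t" for t
    unfolding \<phi>_def \<gamma>\<theta> by (rule fill_law[OF C \<theta> that])
  have i: "start_cell n \<in> measurable borel (count_space UNIV)" for n
    unfolding start_cell_def[abs_def] by measurable
  have ji: "(\<lambda>(s, t). inner_steps n s t) \<in> measurable (borel \<Otimes>\<^sub>M borel) (count_space UNIV)" for n
    unfolding inner_steps_def split_beta' by measurable
  have jo: "(\<lambda>(s, t). outer_steps n s t) \<in> measurable (borel \<Otimes>\<^sub>M borel) (count_space UNIV)" for n
    unfolding outer_steps_def split_beta' by measurable
  have Ei: "Measurable.pred \<rho> (inner_event n k j)" for n k j unfolding inner_event_def by measurable
  have Eo: "Measurable.pred \<rho> (outer_event n k j)" for n k j unfolding outer_event_def[abs_def] by measurable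
  note gi = grid_sum_mean[OF O X R joint Ei i ji]
  note go = grid_sum_mean[OF O X R joint Eo i jo]
  have lim: "(\<lambda>n. \<integral>y. request_sum (p n) y \<partial>\<eta>) \<longlonglongrightarrow> (\<integral>z. m (fill_time z) \<partial>gamma_law C \<theta>)"
    if pm: "\<And>n. (\<lambda>y. request_sum (p n) y) \<in> borel_measurable \<eta>"
      and p01: "\<And>n s t. 0 \<le> p n s t" "\<And>n s t. p n s t \<le> 1"
      and pl: "\<And>s t. s < t \<Longrightarrow> (\<lambda>n. p n s t) \<longlonglongrightarrow> poisson_tail C (\<gamma> * M (t - s))" for p :: "nat \<Rightarrow> real \<Rightarrow> real \<Rightarrow> real"
    unfolding gap(1)[symmetric]
  proof (rule integral_dominated_convergence[where w="\<lambda>y. real (card y)"])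
    show "AE y in \<eta>. (\<lambda>n. request_sum (p n) y)
      \<longlonglongrightarrow> request_sum (\<lambda>s t. \<phi> (t - s)) y"
      unfolding request_sum_def
    proof (intro AE_I2 tendsto_add tendsto_const tendsto_sum)
      fix y :: "real set" and r assume r: "r \<in> {2..card y}"
      show "(\<lambda>n. p n (nth_request (r - 1) y) (nth_request r y)) \<longlonglongrightarrow> \<phi> (nth_request r y - nth_request (r - 1) y)"
        using pl[OF nth_request_less[OF r]] \<phi>[of "nth_request r y - nth_request (r - 1) y"] nth_request_less[OF r] by simp
    qed
    show "AE y in \<eta>. norm (request_sum (p n) y) \<le> real (card y)" for n
      using request_sum_bounds[of "p n", OF p01] by (intro AE_I2) simp
  qed (use pm gap(2) card_integrable in auto)
  show ?thesis
    unfolding expected_misses_def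
  proof (rule integral_completion_sandwich)
    show "integrable Om (\<lambda>w. grid_sum (inner_event n) (start_cell n) (inner_steps n) (X w) (R w))" for n by (rule gi(1))
    show "integrable Om (\<lambda>w. grid_sum (outer_event n) (start_cell n) (outer_steps n) (X w) (R w))" for n by (rule go(1))
    show "(\<lambda>n. \<integral>w. grid_sum (inner_event n) (start_cell n) (inner_steps n) (X w) (R w) \<partial>Om) \<longlonglongrightarrow> (\<integral>z. m (fill_time z) \<partial>gamma_law C \<theta>)"
    proof -
      define p where "p n s t = measure \<rho> {R \<in> space \<rho>. inner_event n (start_cell n s) (inner_steps n s t) R}" for n s t
      have "(\<lambda>n. \<integral>y. request_sum (p n) y \<partial>\<eta>) \<longlonglongrightarrow> (\<integral>z. m (fill_time z) \<partial>gamma_law C \<theta>)"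
      proof (rule lim)
        show "(\<lambda>y. request_sum (p n) y) \<in> borel_measurable \<eta>" for n
          unfolding p_def by (rule gi(3))
        show "0 \<le> p n s t" "p n s t \<le> 1" for n s t unfolding p_def by (rule measure_nonneg, rule rest.prob_le_1)
        show "(\<lambda>n. p n s t) \<longlonglongrightarrow> poisson_tail C (\<gamma> * M (t - s))" if "s < t" for s t
          unfolding p_def by (rule event_tendsto(2)[OF that])
      qed
      then show ?thesis unfolding gi(2) p_def .
    qed
    show "(\<lambda>n. \<integral>w. grid_sum (outer_event n) (start_cell n) (outer_steps n) (X w) (R w) \<partial>Om) \<longlonglongrightarrow> (\<integral>z. m (fill_time z) \<partial>gamma_law C \<theta>)"
    proof -
      define p where "p n s t = measure \<rho> {R \<in> space \<rho>. outer_event n (start_cell n s) (outer_steps n s t) R}" for n s t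
      have "(\<lambda>n. \<integral>y. request_sum (p n) y \<partial>\<eta>) \<longlonglongrightarrow> (\<integral>z. m (fill_time z) \<partial>gamma_law C \<theta>)"
      proof (rule lim)
        show "(\<lambda>y. request_sum (p n) y) \<in> borel_measurable \<eta>" for n
          unfolding p_def by (rule go(3))
        show "0 \<le> p n s t" "p n s t \<le> 1" for n s t unfolding p_def by (rule measure_nonneg, rule rest.prob_le_1)
        show "(\<lambda>n. p n s t) \<longlonglongrightarrow> poisson_tail C (\<gamma> * M (t - s))" if "s < t" for s t
          unfolding p_def by (rule event_tendsto(1)[OF that])
      qed
      then show ?thesis unfolding go(2) p_def .
    qed
  qed (rule misses_bounds)+
qed

end

section \<open>The expansion of the expected number of misses\<close>

theorem theorem7:
  fixes P :: "'p measure" and lam :: "'p \<Rightarrow> real \<Rightarrow> real" and \<theta> :: real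
    and Q :: "nat \<Rightarrow> 'q measure" and \<Gamma> :: "nat \<Rightarrow> 'q \<Rightarrow> real set"
    and a :: "nat \<Rightarrow> nat \<Rightarrow> 'q \<Rightarrow> real" and l :: "nat \<Rightarrow> nat \<Rightarrow> 'q \<Rightarrow> real \<Rightarrow> real"
    and x :: "nat \<Rightarrow> nat \<Rightarrow> 'q \<Rightarrow> real set"
    and Om :: "nat \<Rightarrow> 'w measure" and tag_lam :: "nat \<Rightarrow> 'w \<Rightarrow> real \<Rightarrow> real"
    and \<xi> :: "nat \<Rightarrow> 'w \<Rightarrow> real set" and R :: "nat \<Rightarrow> 'w \<Rightarrow> (real \<times> real set) set"
  assumes canonical: "canonical_intensity P lam"
    and total_finite: "AE w in P. total_intensity (lam w) < \<infinity>"
    and active_finite: "\<And>s t. s \<le> t \<Longrightarrow>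
      (\<integral>\<^sup>+b\<in>{..t}. (\<integral>\<^sup>+w. ennreal (1 - exp (- (cum_intensity (\<lambda>u. lam w (u - b)) b t
          - cum_intensity (\<lambda>u. lam w (u - b)) b s))) \<partial>P) \<partial>lborel) < \<infinity>"
    and mean_pos: "0 < (\<integral>\<^sup>+w. total_intensity (lam w) \<partial>P)"
    and mean_finite: "(\<integral>\<^sup>+w. total_intensity (lam w) \<partial>P) < \<infinity>"
    and theta_pos: "0 < \<theta>"
    and m_C1: "\<And>t. 0 < t \<Longrightarrow> m_fun P lam differentiable (at t)"
    and m_C2: "\<And>t. 0 < t \<Longrightarrow> deriv (m_fun P lam) differentiable (at t)"
    and m_C2_cont: "continuous_on {0<..} (deriv (deriv (m_fun P lam)))"
    \<comment> \<open>for every cache size \<open>C\<close>, the model with catalog arrival rate \<open>C / \<theta>\<close>\<close>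
    and tagged_canonical: "\<And>C. 1 \<le> C \<Longrightarrow> canonical_intensity (Om C) (tag_lam C)"
    and tagged_law: "\<And>C. 1 \<le> C \<Longrightarrow> distr (Om C) paths (tag_lam C) = distr P paths lam"
    and tagged_cox: "\<And>C. 1 \<le> C \<Longrightarrow> cox_process (Om C) (tag_lam C) (\<xi> C)"
    and reference_catalog:
      "\<And>C. 1 \<le> C \<Longrightarrow> catalog (Q C) (real C / \<theta>) P lam (\<Gamma> C) (a C) (l C) (x C)"
    and rest_measurable: "\<And>C. 1 \<le> C \<Longrightarrow> R C \<in> measurable (Om C) marked_configurations"
    and rest_law: "\<And>C. 1 \<le> C \<Longrightarrow> distr (Om C) marked_configurations (R C) =
      distr (Q C) marked_configurations (marked_process (a C) (x C))"
    and independent: "\<And>C. 1 \<le> C \<Longrightarrow>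
      indep_objects (Om C) (paths \<Otimes>\<^sub>M configurations borel) (\<lambda>w. (tag_lam C w, \<xi> C w))
        marked_configurations (R C)"
  shows "(\<lambda>C. expected_misses (Om C) C (\<xi> C) (R C)
            - (m_fun P lam (char_time P lam \<theta>) + e_fun P lam \<theta> / real C))
         \<in> o(\<lambda>C. 1 / real C)"
proof -
  interpret finite_mean_intensity P lam
    using canonical mean_pos mean_finite
    by (intro finite_mean_intensity.intro finite_mean_intensity_axioms.intro) (simp_all add: canonical_intensity_def)
  have eq: "expected_misses (Om C) C (\<xi> C) (R C) = (\<integral>z. m_fun P lam (fill_time z) \<partial>gamma_law C \<theta>)" if C: "1 \<le> C" for C
  proof -
    interpret O: prob_space "Om C" using tagged_canonical[OF C] by (simp add: canonical_intensity_def)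
    interpret Q: prob_space "Q C" using reference_catalog[OF C] by (simp add: catalog_def)
    have tl: "random_intensity (Om C) (tag_lam C)" using tagged_canonical[OF C] by (simp add: canonical_intensity_def)
    have X: "\<xi> C \<in> measurable (Om C) (configurations borel)" using tagged_cox[OF C] by (simp add: cox_process_def cond_poisson_def)
    note Rm = rest_measurable[OF C]
    define \<eta> where "\<eta> = distr (Om C) (configurations borel) (\<xi> C)"
    define \<rho> where "\<rho> = distr (Om C) marked_configurations (R C)"
    have \<rho>: "\<rho> = distr (Q C) marked_configurations (marked_process (a C) (x C))" unfolding \<rho>_def by (rule rest_law[OF C])
    have prob_eta: "measure \<eta> {y \<in> space \<eta>. y \<inter> B = {}} = (\<integral>w. avoid (tag_lam C w) B \<partial>Om C)" if B[measurable]: "B \<in> sets borel" for B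
    proof -
      have S: "{y \<in> space (configurations borel). y \<inter> B = {}} \<in> sets (configurations borel)" by measurable
      have "\<xi> C -` {y \<in> space (configurations borel). y \<inter> B = {}} \<inter> space (Om C) = {w \<in> space (Om C). \<xi> C w \<inter> B = {}}" by auto
      then show ?thesis
        using measure_distr[OF X S] cox_void_probability[OF tagged_canonical[OF C] tagged_cox[OF C] B] by (simp add: \<eta>_def)
    qed
    \<comment> \<open>the void probabilities of the tagged requests are those of the canonical intensity, by equality of laws\<close>
    have tag: "tagged_document P lam \<eta>"
    proof (intro tagged_document.intro tagged_document_axioms.intro finite_mean_intensity_axioms)
      show "prob_space \<eta>" unfolding \<eta>_def by (rule O.prob_space_distr[OF X])
      show "sets \<eta> = sets (configurations borel)" by (simp add: \<eta>_def)
      show "measure \<eta> {y \<in> space \<eta>. y \<inter> {u..<v} = {}} = (\<integral>w. avoid (lam w) {u..<v} \<partial>P)" if "u \<le> v" for u v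
      proof -
        have "(\<integral>w. avoid (tag_lam C w) {u..<v} \<partial>Om C) = (\<integral>w. avoid (lam w) {u..<v} \<partial>P)"
          by (rule same_law_avoid[OF O.finite_measure_axioms finite_measure_axioms tl lam_intensity tagged_law[OF C]])
             (use that in \<open>simp_all add: emeasure_lborel_Ico\<close>)
        then show ?thesis by (simp add: prob_eta)
      qed
      interpret E: prob_space \<eta> unfolding \<eta>_def by (rule O.prob_space_distr[OF X])
      have "avoid (tag_lam C w) {..<0} = 1" if w: "w \<in> space (Om C)" for w
      proof -
        have "(\<integral>\<^sup>+u\<in>{..<0}. ennreal (tag_lam C w u) \<partial>lborel) = 0"
          using tagged_canonical[OF C] w by (auto simp: canonical_intensity_def nn_integral_0_iff_AE intro!: nn_integral_zero' AE_I2 split: split_indicator)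
        then show ?thesis by (simp add: avoid_def)
      qed
      then have "(\<integral>w. avoid (tag_lam C w) {..<0} \<partial>Om C) = 1" using O.prob_space by (simp cong: Bochner_Integration.integral_cong)
      then have "measure \<eta> {y \<in> space \<eta>. y \<inter> {..<0} = {}} = 1" by (simp add: prob_eta)
      then have "AE y in \<eta>. y \<in> {y \<in> space \<eta>. y \<inter> {..<0} = {}}" by (rule E.AE_prob_1)
      then show "AE y in \<eta>. y \<inter> {..<0} = {}" by eventually_elim simp
    qed
    have \<gamma>: "0 < real C / \<theta>" using C theta_pos by simp
    interpret tagged_document P lam \<eta> by (rule tag)
    interpret L: lru_model P lam \<eta> \<rho> "real C / \<theta>" C
    proof (intro lru_model.intro lru_model_axioms.intro tag)
      show "prob_space \<rho>" unfolding \<rho>_def by (rule O.prob_space_distr[OF Rm])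
      show "sets \<rho> = sets marked_configurations" by (simp add: \<rho>_def)
    qed (use \<gamma> C rest_probabilities[OF reference_catalog[OF C] \<gamma>, folded \<rho>] in auto)
    \<comment> \<open>independence of the sigma-algebras turns the joint law of requests and rest into a product\<close>
    have joint: "distr (Om C) (\<eta> \<Otimes>\<^sub>M \<rho>) (\<lambda>w. (\<xi> C w, R C w)) = \<eta> \<Otimes>\<^sub>M \<rho>"
    proof -
      have XR: "(\<lambda>w. (\<xi> C w, R C w)) \<in> measurable (Om C) (\<eta> \<Otimes>\<^sub>M \<rho>)"
        using X Rm by (intro measurable_Pair) (simp_all add: \<eta>_def \<rho>_def)
      have "\<eta> \<Otimes>\<^sub>M \<rho> = distr (Om C) (\<eta> \<Otimes>\<^sub>M \<rho>) (\<lambda>w. (\<xi> C w, R C w))"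
      proof (rule pair_measure_eqI)
        show "sigma_finite_measure \<eta>" "sigma_finite_measure \<rho>" by unfold_locales
        fix A B assume A: "A \<in> sets \<eta>" and B: "B \<in> sets \<rho>"
        have A': "A \<in> sets (configurations borel)" and B': "B \<in> sets marked_configurations"
          using A B by (simp_all add: \<eta>_def \<rho>_def)
        have "(\<lambda>w. (tag_lam C w, \<xi> C w)) -` (space paths \<times> A) \<inter> space (Om C)
            \<in> sets (vimage_algebra (space (Om C)) (\<lambda>w. (tag_lam C w, \<xi> C w)) (paths \<Otimes>\<^sub>M configurations borel))"
          using A' by (intro in_vimage_algebra) simp
        moreover have "(\<lambda>w. (tag_lam C w, \<xi> C w)) -` (space paths \<times> A) \<inter> space (Om C) = \<xi> C -` A \<inter> space (Om C)"
          by (auto simp: space_PiM)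
        ultimately have "\<xi> C -` A \<inter> space (Om C)
            \<in> sets (vimage_algebra (space (Om C)) (\<lambda>w. (tag_lam C w, \<xi> C w)) (paths \<Otimes>\<^sub>M configurations borel))" by simp
        from O.indep_setD[OF independent[OF C, unfolded indep_objects_def] this in_vimage_algebra[OF B']]
        have "measure (Om C) (\<xi> C -` A \<inter> space (Om C)) * measure (Om C) (R C -` B \<inter> space (Om C))
          = measure (Om C) ((\<xi> C -` A \<inter> space (Om C)) \<inter> (R C -` B \<inter> space (Om C)))" by simp
        moreover have "(\<xi> C -` A \<inter> space (Om C)) \<inter> (R C -` B \<inter> space (Om C)) = (\<lambda>w. (\<xi> C w, R C w)) -` (A \<times> B) \<inter> space (Om C)" by auto
        moreover have "emeasure (distr (Om C) (\<eta> \<Otimes>\<^sub>M \<rho>) (\<lambda>w. (\<xi> C w, R C w))) (A \<times> B) = emeasure (Om C) ((\<lambda>w. (\<xi> C w, R C w)) -` (A \<times> B) \<inter> space (Om C))"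
          using A B by (intro emeasure_distr XR) simp
        ultimately show "emeasure \<eta> A * emeasure \<rho> B = emeasure (distr (Om C) (\<eta> \<Otimes>\<^sub>M \<rho>) (\<lambda>w. (\<xi> C w, R C w))) (A \<times> B)"
          unfolding \<eta>_def \<rho>_def emeasure_distr[OF X A'] emeasure_distr[OF Rm B']
          by (simp add: O.emeasure_eq_measure ennreal_mult'[symmetric])
      qed simp
      then show ?thesis ..
    qed
    show ?thesis by (rule L.expected_misses_eq[OF theta_pos refl O.prob_space_axioms X Rm joint])
  qed
  have "\<forall>\<^sub>F C in sequentially. expected_misses (Om C) C (\<xi> C) (R C) - (m_fun P lam (char_time P lam \<theta>) + e_fun P lam \<theta> / real C)
     = (\<integral>z. m_fun P lam (fill_time z) \<partial>gamma_law C \<theta>) - (m_fun P lam (char_time P lam \<theta>) + e_fun P lam \<theta> / real C)"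
    using eventually_ge_at_top[of 1] by eventually_elim (simp add: eq)
  then show ?thesis
    using gamma_mean_expansion[OF theta_pos m_C1 m_C2] by (subst landau_o.small.in_cong)
qed

end
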